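(* Let $n\in\mathbb N$, let $(g,\kappa,\mathbf c,\delta)$ be a data, and let $f:\mathbb N^n\to\mathbb R$ be a multivariable multiplicative function belonging to the class $\mathcal C(g,\kappa,\mathbf c,\delta)$. Assume that the (finite) set $$I=\{\boldsymbol\nu\in\mathbb N_0^n \mid \kappa(\boldsymbol\nu)=1 \text{ and } g(\boldsymbol\nu)\neq 0\}$$ is nonempty. Then: 1. The multiple zeta function $$\mathbf s=(s_1,\dots,s_n)\mapsto \mathcal M(f;\mathbf s):=\sum_{m_1\ge 1,\dots,m_n\ge 1}\frac{f(m_1,\dots,m_n)}{m_1^{s_1}\cdots m_n^{s_n}}$$ converges absolutely in the domain $\{\mathbf s\in\mathbb C^n\mid \Re(s_i)>c_i\ \forall i=1,\dots,n\}$. 2. There exists $\varepsilon_0>0$ such that the function $$\mathbf s\mapsto \mathcal H(f,\mathbf c;\mathbf s):=\Big(\prod_{\boldsymbol\nu\in I}\langle\boldsymbol\nu,\mathbf s\rangle^{g(\boldsymbol\nu)}\Big)\,\mathcal M(f;\mathbf c+\mathbf s)$$ has a holomorphic continuation to the domain $\{\mathbf s\in\mathbb C^n\mid \Re(s_i)>-\varepsilon_0\ \forall i=1,\dots,n\}$ and satisfies in it the following estimate: for all $\varepsilon>0$, $$\mathcal H(f,\mathbf c;\mathbf s)\ll_\varepsilon \prod_{\boldsymbol\nu\in I}\big(|\langle\boldsymbol\nu,\mathbf s\rangle|+1\big)^{g(\boldsymbol\nu)\left(1-\frac12\min(0,\Re(\langle\boldsymbol\nu,\mathbf s\rangle))\right)+\varepsilon}.$$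 3. $\mathcal H(f,\mathbf c;\mathbf 0)$ is given by the following convergent Euler product over primes $p$: $$\mathcal H(f,\mathbf c;\mathbf 0)=\prod_p\Big(1-\frac1p\Big)^{\sum_{\boldsymbol\nu\in I}g(\boldsymbol\nu)}\Big(\sum_{\boldsymbol\nu\in\mathbb N_0^n}\frac{f(p^{\nu_1},\dots,p^{\nu_n})}{p^{\langle\boldsymbol\nu,\mathbf c\rangle}}\Big).$$
   Context: $\mathbb N=\{1,2,\dots\}$, $\mathbb N_0=\mathbb N\cup\{0\}$. For $\mathbf x\in\mathbb R^n$ and $\mathbf s\in\mathbb C^n$, $\langle\mathbf x,\mathbf s\rangle=\sum_i x_is_i$; $\|\mathbf x\|_1=\sum_i|x_i|$; $\mathbf 0=(0,\dots,0)$. Elements of $\mathbb N_0^n$ are written $\boldsymbol\nu=(\nu_1,\dots,\nu_n)$. The notation $A\ll_\varepsilon B$ (uniformly in the stated variables) means $|A|\le K B$ with a constant $K>0$ depending on $\varepsilon$ (and on the fixed objects $n,f,g,\kappa,\mathbf c,\delta$) but not on the variables. Multiplicative: $f:\mathbb N^n\to\mathbb C$ is multiplicative if $f(m_1m_1',\dots,m_nm_n')=f(m_1,\dots,m_n)f(m_1',\dots,m_n')$ whenever $\gcd(\operatorname{lcm}(m_i),\operatorname{lcm}(m_i'))=1$. Data: a quadruple $(g,\kappa,\mathbf c,\delta)$ is a data if (1) $g:\mathbb N_0^n\to\mathbb N_0$ has subexponential growth, i.e. for every $\varepsilon>0$, $g(\boldsymbol\nu)\ll_\varepsilon e^{\varepsilon\|\boldsymbol\nu\|_1}$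 uniformly in $\boldsymbol\nu\in\mathbb N_0^n$; (2) $\kappa:\mathbb N_0^n\to[1,\infty)\cup\{0\}$ satisfies $\kappa(\mathbf 0)=0$ and $\inf_{\boldsymbol\nu\in\mathbb N_0^n\setminus\{\mathbf 0\}}\kappa(\boldsymbol\nu)/\|\boldsymbol\nu\|_1>0$; (3) $\mathbf c=(c_1,\dots,c_n)\in[0,\infty)^n$ and $\delta\in(0,\infty)$. Class: a multiplicative function $f:\mathbb N^n\to\mathbb R$ is in the class $\mathcal C(g,\kappa,\mathbf c,\delta)$ if for every $\varepsilon>0$, $$f(p^{\nu_1},\dots,p^{\nu_n})-g(\boldsymbol\nu)\,p^{\langle\mathbf c,\boldsymbol\nu\rangle-\kappa(\boldsymbol\nu)}\ll_\varepsilon e^{\varepsilon\|\boldsymbol\nu\|_1}\,p^{\langle\mathbf c,\boldsymbol\nu\rangle-\kappa(\boldsymbol\nu)-\delta}$$ uniformly in $\boldsymbol\nu\in\mathbb N_0^n$ and $p$ prime. *)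

theory Defs
  imports "HOL-Analysis.Analysis" "HOL-Computational_Algebra.Primes"
begin

unbundle no fps_syntax

text \<open>
  The dimension is the cardinality of a finite index type \<open>'n\<close>; it is at least 1 because types
  are nonempty. Tuples of naturals are of type \<open>nat ^ 'n\<close>, which includes zero entries: a function
  defined on tuples of positive integers is a total function here, and only its values on
  \<open>pos_tuples\<close> are ever used.
\<close>

definition pos_tuples :: "(nat ^ 'n) set" where
  "pos_tuples = {m. \<forall>i. m $ i \<ge> 1}"

definition norm1 :: "nat ^ 'n \<Rightarrow> nat" where
  "norm1 \<nu> = (\<Sum>i\<in>UNIV. \<nu> $ i)"

text \<open>One operand of the bilinear pairing is always a tuple of naturals; the other one is real
  (the vector of exponents) or complex (the variable).\<close>

definition pairing :: "nat ^ 'n \<Rightarrow> 'a::comm_semiring_1 ^ 'n \<Rightarrow> 'a" where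
  "pairing \<nu> s = (\<Sum>i\<in>UNIV. of_nat (\<nu> $ i) * s $ i)"

definition prime_pow :: "nat \<Rightarrow> nat ^ 'n \<Rightarrow> nat ^ 'n" where
  "prime_pow p \<nu> = (\<chi> i. p ^ (\<nu> $ i))"

definition multiplicative_multi :: "(nat ^ 'n \<Rightarrow> 'a::times) \<Rightarrow> bool" where
  "multiplicative_multi f \<longleftrightarrow>
     (\<forall>m\<in>pos_tuples. \<forall>m'\<in>pos_tuples.
        gcd (Lcm (range (\<lambda>i. m $ i))) (Lcm (range (\<lambda>i. m' $ i))) = 1 \<longrightarrow>
        f (\<chi> i. m $ i * m' $ i) = f m * f m')"

definition subexponential :: "(nat ^ 'n \<Rightarrow> nat) \<Rightarrow> bool" where
  "subexponential g \<longleftrightarrow>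
     (\<forall>\<epsilon>>0. \<exists>K>0. \<forall>\<nu>. real (g \<nu>) \<le> K * exp (\<epsilon> * real (norm1 \<nu>)))"

text \<open>The real infimum below is over a nonempty set that is bounded below by 0, so it is the
  genuine infimum.\<close>

definition is_data ::
    "(nat ^ 'n \<Rightarrow> nat) \<Rightarrow> (nat ^ 'n \<Rightarrow> real) \<Rightarrow> real ^ 'n \<Rightarrow> real \<Rightarrow> bool" where
  "is_data g \<kappa> c \<delta> \<longleftrightarrow>
     subexponential g \<and>
     (\<forall>\<nu>. \<kappa> \<nu> = 0 \<or> \<kappa> \<nu> \<ge> 1) \<and> \<kappa> 0 = 0 \<and>
     (INF \<nu>\<in>UNIV - {0}. \<kappa> \<nu> / real (norm1 \<nu>)) > 0 \<and>
     (\<forall>i. c $ i \<ge> 0) \<and> \<delta> > 0"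

definition mult_class ::
    "(nat ^ 'n \<Rightarrow> nat) \<Rightarrow> (nat ^ 'n \<Rightarrow> real) \<Rightarrow> real ^ 'n \<Rightarrow> real \<Rightarrow> (nat ^ 'n \<Rightarrow> real) set" where
  "mult_class g \<kappa> c \<delta> = {f. multiplicative_multi f \<and>
     (\<forall>\<epsilon>>0. \<exists>K>0. \<forall>\<nu> p. prime p \<longrightarrow>
        \<bar>f (prime_pow p \<nu>) - real (g \<nu>) * real p powr (pairing \<nu> c - \<kappa> \<nu>)\<bar>
          \<le> K * (exp (\<epsilon> * real (norm1 \<nu>)) * real p powr (pairing \<nu> c - \<kappa> \<nu> - \<delta>)))}"

definition polar_set :: "(nat ^ 'n \<Rightarrow> nat) \<Rightarrow> (nat ^ 'n \<Rightarrow> real) \<Rightarrow> (nat ^ 'n) set" where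
  "polar_set g \<kappa> = {\<nu>. \<kappa> \<nu> = 1 \<and> g \<nu> \<noteq> 0}"

definition zeta_term :: "(nat ^ 'n \<Rightarrow> real) \<Rightarrow> complex ^ 'n \<Rightarrow> nat ^ 'n \<Rightarrow> complex" where
  "zeta_term f s m = of_real (f m) / (\<Prod>i\<in>UNIV. of_nat (m $ i) powr (s $ i))"

definition multi_zeta :: "(nat ^ 'n \<Rightarrow> real) \<Rightarrow> complex ^ 'n \<Rightarrow> complex" where
  "multi_zeta f s = (\<Sum>\<^sub>\<infinity>m\<in>pos_tuples. zeta_term f s m)"

definition right_region :: "real ^ 'n \<Rightarrow> (complex ^ 'n) set" where
  "right_region a = {s. \<forall>i. Re (s $ i) > a $ i}"

definition regularized_zeta ::
    "(nat ^ 'n \<Rightarrow> nat) \<Rightarrow> (nat ^ 'n \<Rightarrow> real) \<Rightarrow> (nat ^ 'n \<Rightarrow> real) \<Rightarrow> real ^ 'n \<Rightarrow> complex ^ 'n \<Rightarrow> complex" where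
  "regularized_zeta g \<kappa> f c s =
     (\<Prod>\<nu>\<in>polar_set g \<kappa>. pairing \<nu> s ^ g \<nu>) * multi_zeta f (\<chi> i. of_real (c $ i) + s $ i)"

text \<open>Holomorphy in several complex variables: Frechet differentiability with a complex-linear
  derivative. The type \<open>complex ^ 'n\<close> is only a real normed space, so complex linearity of the
  (real-linear) derivative is required separately. Meant for open \<open>S\<close>.\<close>

definition holomorphic_multi_on :: "(complex ^ 'n \<Rightarrow> complex) \<Rightarrow> (complex ^ 'n) set \<Rightarrow> bool" where
  "holomorphic_multi_on F S \<longleftrightarrow>
     (\<forall>z\<in>S. \<exists>D. (F has_derivative D) (at z within S) \<and> (\<forall>a v. D (a *s v) = a * D v))"

definition local_term :: "(nat ^ 'n \<Rightarrow> real) \<Rightarrow> real ^ 'n \<Rightarrow> nat \<Rightarrow> nat ^ 'n \<Rightarrow> real" where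
  "local_term f c p \<nu> = f (prime_pow p \<nu>) / real p powr pairing \<nu> c"

definition euler_factor ::
    "(nat ^ 'n \<Rightarrow> nat) \<Rightarrow> (nat ^ 'n \<Rightarrow> real) \<Rightarrow> (nat ^ 'n \<Rightarrow> real) \<Rightarrow> real ^ 'n \<Rightarrow> nat \<Rightarrow> real" where
  "euler_factor g \<kappa> f c p =
     (1 - 1 / real p) ^ (\<Sum>\<nu>\<in>polar_set g \<kappa>. g \<nu>) * (\<Sum>\<^sub>\<infinity>\<nu>\<in>UNIV. local_term f c p \<nu>)"

text \<open>Finiteness of the polar set, so that the products and sums over it are genuine.\<close>

lemma finite_polar_set:
  fixes g :: "nat ^ 'n \<Rightarrow> nat"
  assumes "is_data g \<kappa> c \<delta>"
  shows "finite (polar_set g \<kappa>)"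
proof -
  define q where "q = (INF \<nu>\<in>UNIV - {0}. \<kappa> \<nu> / real (norm1 \<nu>))"
  have q: "q > 0" and k0: "\<kappa> 0 = 0" and kge: "\<And>\<nu>. \<kappa> \<nu> \<ge> 0"
    using assms unfolding is_data_def q_def by (auto, smt (verit))
  have bdd: "bdd_below ((\<lambda>\<nu>. \<kappa> \<nu> / real (norm1 \<nu>)) ` (UNIV - {0}))"
    by (rule bdd_belowI[of _ 0]) (use kge in auto)
  define N where "N = nat \<lceil>1 / q\<rceil>"
  have "\<nu> $ i \<le> N" if "\<nu> \<in> polar_set g \<kappa>" for \<nu> i
  proof -
    have k1: "\<kappa> \<nu> = 1" using that by (simp add: polar_set_def)
    then have "\<nu> \<noteq> 0" using k0 by auto
    then have "q \<le> 1 / real (norm1 \<nu>)"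
      using cINF_lower[OF bdd, of \<nu>] k1 by (simp add: q_def)
    moreover have "norm1 \<nu> > 0"
      using calculation q by (cases "norm1 \<nu>") auto
    ultimately have "real (norm1 \<nu>) \<le> 1 / q"
      using q by (simp add: field_simps)
    then have "norm1 \<nu> \<le> N" unfolding N_def by linarith
    moreover have "\<nu> $ i \<le> norm1 \<nu>"
      unfolding norm1_def by (rule member_le_sum) auto
    ultimately show ?thesis by simp
  qed
  then have "polar_set g \<kappa> \<subseteq> vec_lambda ` (UNIV \<rightarrow>\<^sub>E {..N})"
    by (auto intro!: image_eqI[where x = "vec_nth _"] simp: PiE_iff)
  moreover have "finite (vec_lambda ` ((UNIV :: 'n set) \<rightarrow>\<^sub>E {..N}))"
    by (intro finite_imageI finite_PiE) auto
  ultimately show ?thesis by (rule finite_subset)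
qed

end

(*
  Near s = 0 the Euler factor at p of M(f; c + s) is 1 + sum over nu in I of
  g(nu) p^(-1 - <nu,s>), up to O(p^(-1-eta/2)) uniformly in Re s_i > -eps_0. Multiplying it by
  (1 - p^(-1 - <nu,s>))^g(nu) for nu in I therefore gives an absolutely convergent, bounded
  holomorphic product, and M(f; c + s) is this product times zeta(1 + <nu,s>)^g(nu) for nu in I.
  The growth estimate is then the convexity bound zeta(1 + w) << |w|^(-Re w / 2 + eps) for Re w
  slightly negative. It is proved without the functional equation: in a partial sum of length
  about |w|^(5/2) the terms below |w|^(1/2) are bounded trivially, the dyadic blocks above by
  van der Corput's second derivative test.
*)

theory Submission
  imports Defs "HOL-Complex_Analysis.Cauchy_Integral_Formula" "HOL-Real_Asymp.Real_Asymp"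
begin

section \<open>Holomorphic functions of several variables\<close>

text \<open>The region \<open>R\<close> reaches into negative real parts, where \<open>\<nu>\<close>
  costs a factor growing with its length, and infinitely many \<open>\<nu>\<close> must be treated
  at once. The growth of \<open>\<kappa>\<close> pays for this: \<open>\<kappa>\<close> is at least
  \<open>q\<close> times the length, so with \<open>\<epsilon>\<^sub>0 = q * \<tau>\<close> the cost
  at \<open>\<nu>\<close> is at most \<open>p powr (\<tau> * \<kappa> \<nu>)\<close>, a small
  fraction of the decay \<open>p powr (- \<kappa> \<nu>)\<close>. The same growth keeps the values
  of \<open>\<kappa>\<close> from accumulating at 1; the gap above 1, together with
  \<open>\<delta>\<close>, determines the error exponents. Zeta enters only as (s - 1) zeta(s),
  which is 1 at s = 1. The linear forms <nu,s> are thereby built in, no removable singularity arises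
  on the hyperplanes <nu,s> = 0, and the value at the origin needs no limit. Truncating zeta at N
  leaves an error of order |w|^2 / sqrt N, acceptable once N is at least |w|^2. Starting at
  |w|^(1/2), about 2 log2 |w| doublings multiply the length by |w|^2, which is enough. The resulting
  length |w|^(5/2) is still short enough for the boundary term N^(-w) to be O(|w|), because - Re w
  is at most 1/8.\<close>

lemma norm_smult_vec: "norm (a *s v) = norm a * norm v" for a :: complex and v :: "complex ^ 'n"
proof -
  have "L2_set (\<lambda>i. norm a * norm (v $ i)) UNIV = norm a * L2_set (\<lambda>i. norm (v $ i)) UNIV"
    by (simp add: L2_set_right_distrib)
  then show ?thesis by (simp add: norm_vec_def norm_mult)
qed

lemma bounded_linear_smult_left: "bounded_linear (\<lambda>a. a *s v)" for v :: "complex ^ 'n"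
  by (rule bounded_linear_intro[where K = "norm v"])
     (auto simp: norm_smult_vec vec_eq_iff algebra_simps)

lemma bounded_linear_pairing: "bounded_linear (pairing \<nu> :: complex ^ 'n \<Rightarrow> complex)"
  unfolding pairing_def
  by (intro bounded_linear_sum bounded_linear_compose[OF bounded_linear_mult_right bounded_linear_vec_nth])

lemma pairing_smult: "pairing \<nu> (a *s v) = a * pairing \<nu> v" for a :: complex
  by (simp add: pairing_def sum_distrib_left mult_ac)

lemma holomorphic_multi_on_imp_continuous_on:
  "holomorphic_multi_on F S \<Longrightarrow> continuous_on S F"
  by (meson continuous_on_eq_continuous_within has_derivative_continuous holomorphic_multi_on_def)

lemma holomorphic_multi_on_const: "holomorphic_multi_on (\<lambda>_. a) S"
  unfolding holomorphic_multi_on_def by (intro ballI exI[of _ "\<lambda>_. 0"]) auto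

lemma holomorphic_multi_on_add:
  assumes "holomorphic_multi_on F S" "holomorphic_multi_on G S"
  shows "holomorphic_multi_on (\<lambda>s. F s + G s) S"
  unfolding holomorphic_multi_on_def
proof
  fix z assume "z \<in> S"
  then obtain D E where "(F has_derivative D) (at z within S)" "\<forall>a v. D (a *s v) = a * D v"
    "(G has_derivative E) (at z within S)" "\<forall>a v. E (a *s v) = a * E v"
    using assms unfolding holomorphic_multi_on_def by meson
  then show "\<exists>D. ((\<lambda>s. F s + G s) has_derivative D) (at z within S) \<and> (\<forall>a v. D (a *s v) = a * D v)"
    by (intro exI[of _ "\<lambda>h. D h + E h"])
       (auto intro!: derivative_eq_intros simp: algebra_simps)
qed

lemma holomorphic_multi_on_mult:
  assumes "holomorphic_multi_on F S" "holomorphic_multi_on G S"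
  shows "holomorphic_multi_on (\<lambda>s. F s * G s) S"
  unfolding holomorphic_multi_on_def
proof
  fix z assume "z \<in> S"
  then obtain D E where "(F has_derivative D) (at z within S)" "\<forall>a v. D (a *s v) = a * D v"
    "(G has_derivative E) (at z within S)" "\<forall>a v. E (a *s v) = a * E v"
    using assms unfolding holomorphic_multi_on_def by meson
  then show "\<exists>D. ((\<lambda>s. F s * G s) has_derivative D) (at z within S) \<and> (\<forall>a v. D (a *s v) = a * D v)"
    by (intro exI[of _ "\<lambda>h. F z * E h + D h * G z"])
       (auto intro!: derivative_eq_intros simp: algebra_simps)
qed

lemma holomorphic_multi_on_diff:
  assumes "holomorphic_multi_on F S" "holomorphic_multi_on G S"
  shows "holomorphic_multi_on (\<lambda>s. F s - G s) S"
  using holomorphic_multi_on_add[OF assms(1)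
      holomorphic_multi_on_mult[OF holomorphic_multi_on_const[of "-1"] assms(2)]] by simp

lemma holomorphic_multi_on_prod:
  "(\<And>i. i \<in> A \<Longrightarrow> holomorphic_multi_on (F i) S) \<Longrightarrow> holomorphic_multi_on (\<lambda>s. \<Prod>i\<in>A. F i s) S"
  by (induction A rule: infinite_finite_induct)
     (auto intro!: holomorphic_multi_on_const holomorphic_multi_on_mult)

lemma holomorphic_multi_on_sum:
  "(\<And>i. i \<in> A \<Longrightarrow> holomorphic_multi_on (F i) S) \<Longrightarrow> holomorphic_multi_on (\<lambda>s. \<Sum>i\<in>A. F i s) S"
  by (induction A rule: infinite_finite_induct)
     (auto intro!: holomorphic_multi_on_const holomorphic_multi_on_add)

lemma holomorphic_multi_on_power:
  "holomorphic_multi_on F S \<Longrightarrow> holomorphic_multi_on (\<lambda>s. F s ^ k) S"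
  by (induction k) (auto intro!: holomorphic_multi_on_const holomorphic_multi_on_mult)

text \<open>The chain rule with the complex-linear map \<open>pairing \<nu>\<close>. Every
  transcendental function of several variables below is built from one-variable functions of
  \<open>a + pairing \<nu> s\<close>, so this lemma imports all one-variable holomorphy.\<close>

lemma holomorphic_multi_on_compose_pairing:
  assumes "h holomorphic_on T" "open T" "\<And>s. s \<in> S \<Longrightarrow> a + pairing \<nu> s \<in> T"
  shows "holomorphic_multi_on (\<lambda>s. h (a + pairing \<nu> s)) S"
  unfolding holomorphic_multi_on_def
proof
  fix z assume "z \<in> S"
  then have "(h has_field_derivative deriv h (a + pairing \<nu> z)) (at (a + pairing \<nu> z))"
    using assms holomorphic_derivI by blast
  then have "(h has_derivative (*) (deriv h (a + pairing \<nu> z))) (at (a + pairing \<nu> z))"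
    by (simp add: has_field_derivative_def)
  moreover have "((\<lambda>s. a + pairing \<nu> s) has_derivative pairing \<nu>) (at z within S)"
    using bounded_linear.has_derivative[OF bounded_linear_pairing has_derivative_ident]
    by (auto intro!: derivative_eq_intros)
  ultimately have "((\<lambda>s. h (a + pairing \<nu> s)) has_derivative
      (\<lambda>v. deriv h (a + pairing \<nu> z) * pairing \<nu> v)) (at z within S)"
    using has_derivative_compose by blast
  then show "\<exists>D. ((\<lambda>s. h (a + pairing \<nu> s)) has_derivative D) (at z within S) \<and>
      (\<forall>a v. D (a *s v) = a * D v)"
    by (intro exI conjI) (auto simp: pairing_smult)
qed

text \<open>The Cauchy estimate on the complex line through \<open>z\<close> in direction \<open>v\<close>.\<close>

lemma holomorphic_multi_derivative_bound:
  assumes F: "holomorphic_multi_on F S" and "open S" and sub: "cball z r \<subseteq> S" and "r > 0"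
    and B: "\<And>w. w \<in> cball z r \<Longrightarrow> norm (F w) \<le> B"
    and D: "(F has_derivative D) (at z)"
  shows "norm (D v) \<le> B / r * norm v"
proof (cases "v = 0")
  case True
  then show ?thesis
    using D by (metis has_derivative_bounded_linear linear_simps(3) mult_zero_right norm_zero order_refl)
next
  case False
  define \<phi> where "\<phi> \<zeta> = F (z + \<zeta> *s v)" for \<zeta>
  define \<rho> where "\<rho> = r / norm v"
  have \<rho>: "\<rho> > 0" using False \<open>r > 0\<close> by (simp add: \<rho>_def)
  have in_cball: "z + \<zeta> *s v \<in> cball z r" if "\<zeta> \<in> cball 0 \<rho>" for \<zeta>
    using that False by (simp add: \<rho>_def dist_norm norm_smult_vec field_simps)
  have ex: "\<exists>E. (\<phi> has_field_derivative E v) (at \<zeta>) \<and> (F has_derivative E) (at (z + \<zeta> *s v))"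
    if "\<zeta> \<in> cball 0 \<rho>" for \<zeta>
  proof -
    have "z + \<zeta> *s v \<in> S" using in_cball[OF that] sub by auto
    then obtain E where E: "(F has_derivative E) (at (z + \<zeta> *s v))" "\<forall>a v. E (a *s v) = a * E v"
      using F \<open>open S\<close> unfolding holomorphic_multi_on_def by (metis at_within_open)
    have "((\<lambda>\<zeta>. z + \<zeta> *s v) has_derivative (\<lambda>h. h *s v)) (at \<zeta>)"
      using bounded_linear.has_derivative[OF bounded_linear_smult_left has_derivative_ident]
      by (auto intro!: derivative_eq_intros)
    from has_derivative_compose[OF this E(1)] have "(\<phi> has_derivative (\<lambda>h. E (h *s v))) (at \<zeta>)"
      by (simp add: \<phi>_def[abs_def])
    \<comment> \<open>Complex linearity of \<open>E\<close> turns the real derivative along the line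
      into multiplication by \<open>E v\<close>, that is, into a complex derivative of
      \<open>\<phi>\<close>.\<close>
    moreover have "(\<lambda>h. E (h *s v)) = (*) (E v)" using E(2) by (auto simp: mult.commute)
    ultimately have "(\<phi> has_field_derivative E v) (at \<zeta>)" by (simp add: has_field_derivative_def)
    then show ?thesis using E(1) by blast
  qed
  have "\<phi> field_differentiable at \<zeta>" if "\<zeta> \<in> cball 0 \<rho>" for \<zeta>
    using ex[OF that] field_differentiable_def by blast
  then have holo: "\<phi> holomorphic_on cball 0 \<rho>"
    by (simp add: holomorphic_on_def field_differentiable_at_within)
  obtain E where E: "(\<phi> has_field_derivative E v) (at 0)" "(F has_derivative E) (at (z + 0 *s v))"
    using ex[of 0] \<rho> by auto
  have "E = D" using has_derivative_unique[of F E z D] E(2) D by simp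
  have "norm ((deriv ^^ 1) \<phi> 0) \<le> fact 1 * B / \<rho> ^ 1"
  proof (rule Cauchy_inequality)
    show "\<phi> holomorphic_on ball 0 \<rho>" using holo by (rule holomorphic_on_subset) auto
    show "continuous_on (cball 0 \<rho>) \<phi>" using holo by (rule holomorphic_on_imp_continuous_on)
    show "norm (\<phi> x) \<le> B" if "norm (0 - x) = \<rho>" for x
      unfolding \<phi>_def using that by (intro B in_cball) auto
  qed (use \<rho> in auto)
  moreover have "deriv \<phi> 0 = D v" using E(1) \<open>E = D\<close> DERIV_imp_deriv by blast
  ultimately show ?thesis by (simp add: \<rho>_def field_simps)
qed

text \<open>Uniform convergence of the derivatives comes from the Cauchy estimate.\<close>

theorem holomorphic_multi_on_uniform_limit:
  fixes F :: "nat \<Rightarrow> complex ^ 'n \<Rightarrow> complex"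
  assumes "open S" and holo: "\<And>k. holomorphic_multi_on (F k) S"
    and lim: "\<And>z. z \<in> S \<Longrightarrow> \<exists>r>0. cball z r \<subseteq> S \<and> uniform_limit (cball z r) F G sequentially"
  shows "holomorphic_multi_on G S"
  unfolding holomorphic_multi_on_def
proof
  fix z assume "z \<in> S"
  then obtain r where r: "r > 0" "cball z r \<subseteq> S" and ul: "uniform_limit (cball z r) F G sequentially"
    using lim by blast
  have "\<exists>E. (F k has_derivative E) (at x) \<and> (\<forall>a v. E (a *s v) = a * E v)" if "x \<in> S" for k x
    using bspec[OF holo[of k, unfolded holomorphic_multi_on_def] that]
    by (simp only: at_within_open[OF that \<open>open S\<close>])
  note ex = this
  define D where "D k x = (SOME E. (F k has_derivative E) (at x) \<and> (\<forall>a v. E (a *s v) = a * E v))" for k x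
  have DD: "(F k has_derivative D k x) (at x) \<and> (\<forall>a v. D k x (a *s v) = a * D k x v)"
    if "x \<in> S" for k x
    unfolding D_def by (rule someI_ex[OF ex[OF that]])
  have D: "(F k has_derivative D k x) (at x)" if "x \<in> S" for k x using DD[OF that] by blast
  have Dlin: "D k x (a *s v) = a * D k x v" if "x \<in> S" for k x a v using DD[OF that] by blast
  have sub: "cball x (r/2) \<subseteq> cball z r" if "x \<in> ball z (r/2)" for x
  proof
    fix w assume "w \<in> cball x (r/2)"
    then show "w \<in> cball z r" using that dist_triangle[of z w x] by auto
  qed
  have in_cball: "x \<in> cball z r" if "x \<in> ball z (r/2)" for x using that r(1) by auto
  then have inS: "x \<in> S" if "x \<in> ball z (r/2)" for x using that r(2) by blast
  \<comment> \<open>Halving the radius leaves a ball of radius \<open>r/2\<close> about each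
    \<open>x\<close> for the Cauchy estimate. Applied to \<open>F m - F n\<close>, it makes the
    derivatives uniformly Cauchy as operators, the form in which
    \<open>has_derivative_sequence\<close> takes convergence.\<close>
  have Dbound: "\<exists>M. \<forall>m\<ge>M. \<forall>n\<ge>M. \<forall>x\<in>ball z (r/2). \<forall>v. norm (D m x v - D n x v) \<le> e * norm v"
    if "e > 0" for e
  proof -
    have "e * (r/2) > 0" using that r by simp
    then obtain M where M: "\<And>m n x. m \<ge> M \<Longrightarrow> n \<ge> M \<Longrightarrow> x \<in> cball z r \<Longrightarrow> dist (F m x) (F n x) < e * (r/2)"
      using uniformly_convergent_Cauchy[OF uniformly_convergentI[OF ul]]
      unfolding uniformly_Cauchy_on_def by metis
    show ?thesis
    proof (intro exI[of _ M] allI impI ballI)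
      fix m n x v assume *: "M \<le> m" "M \<le> n" "x \<in> ball z (r/2)"
      then have "x \<in> S" by (rule_tac inS)
      have "norm ((\<lambda>v. D m x v - D n x v) v) \<le> (e * (r/2)) / (r/2) * norm v"
      proof (rule holomorphic_multi_derivative_bound[where S = S and F = "\<lambda>w. F m w - F n w"])
        show "cball x (r/2) \<subseteq> S" using sub[of x] * r by auto
        show "norm (F m w - F n w) \<le> e * (r/2)" if "w \<in> cball x (r/2)" for w
          using M[OF *(1,2), of w] sub[OF *(3)] that by (auto simp: dist_norm)
        show "((\<lambda>w. F m w - F n w) has_derivative (\<lambda>v. D m x v - D n x v)) (at x)"
          using D[OF \<open>x \<in> S\<close>] by (intro derivative_intros)
      qed (use holo \<open>open S\<close> r in \<open>auto intro: holomorphic_multi_on_diff\<close>)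
      then show "norm (D m x v - D n x v) \<le> e * norm v" using r by simp
    qed
  qed
  define D' where "D' x v = lim (\<lambda>k. D k x v)" for x v
  have conv: "(\<lambda>k. D k x v) \<longlonglongrightarrow> D' x v" if "x \<in> ball z (r/2)" for x v
  proof -
    have "Cauchy (\<lambda>k. D k x v)"
    proof (rule metric_CauchyI)
      fix e :: real assume "e > 0"
      \<comment> \<open>Dividing by \<open>norm v + 1\<close> rather than \<open>norm v\<close>
        covers \<open>v = 0\<close> and makes the final inequality strict.\<close>
      have pos: "norm v + 1 > 0" by (smt (verit) norm_ge_zero)
      then have e': "e / (norm v + 1) > 0" using \<open>e > 0\<close> by simp
      obtain M where "\<forall>m\<ge>M. \<forall>n\<ge>M. \<forall>x\<in>ball z (r/2). \<forall>v'. norm (D m x v' - D n x v') \<le> e / (norm v + 1) * norm v'"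
        using Dbound[OF e'] by auto
      then have M: "norm (D m x v - D n x v) \<le> e / (norm v + 1) * norm v" if "m \<ge> M" "n \<ge> M" for m n
        using that \<open>x \<in> _\<close> by simp
      have "e / (norm v + 1) * norm v < e"
        using \<open>e > 0\<close> pos by (simp add: pos_divide_less_eq)
      then show "\<exists>M. \<forall>m\<ge>M. \<forall>n\<ge>M. dist (D m x v) (D n x v) < e"
        using M by (intro exI[of _ M]) (auto simp: dist_norm intro: le_less_trans)
    qed
    then show ?thesis unfolding D'_def by (simp add: Cauchy_convergent_iff convergent_LIMSEQ_iff)
  qed
  have "\<exists>g. \<forall>x\<in>ball z (r/2). (\<lambda>n. F n x) \<longlonglongrightarrow> g x \<and> (g has_derivative D' x) (at x within ball z (r/2))"
  proof (rule has_derivative_sequence[where f = F and f' = D])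
    show "convex (ball z (r/2))" by simp
    show "z \<in> ball z (r/2)" using r by simp
    show "(\<lambda>n. F n z) \<longlonglongrightarrow> G z" using tendsto_uniform_limitI[OF ul, of z] r by simp
    show "(F n has_derivative D n x) (at x within ball z (r/2))" if "x \<in> ball z (r/2)" for n x
      by (rule has_derivative_at_withinI[OF D[OF inS[OF that]]])
    show "\<forall>\<^sub>F n in sequentially. \<forall>x\<in>ball z (r/2). \<forall>v. norm (D n x v - D' x v) \<le> e * norm v"
      if "e > 0" for e
    proof -
      obtain M where M: "\<forall>m\<ge>M. \<forall>n\<ge>M. \<forall>x\<in>ball z (r/2). \<forall>v. norm (D m x v - D n x v) \<le> e * norm v"
        using Dbound[OF \<open>e > 0\<close>] by auto
      have "norm (D n x v - D' x v) \<le> e * norm v" if "n \<ge> M" "x \<in> ball z (r/2)" for n x v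
      proof (rule tendsto_upperbound)
        show "(\<lambda>m. norm (D n x v - D m x v)) \<longlonglongrightarrow> norm (D n x v - D' x v)"
          using conv[OF that(2)] by (intro tendsto_intros)
        show "\<forall>\<^sub>F m in sequentially. norm (D n x v - D m x v) \<le> e * norm v"
          using M that by (intro eventually_sequentiallyI[of M]) auto
      qed auto
      then show ?thesis by (intro eventually_sequentiallyI[of M]) auto
    qed
  qed
  then obtain g where g: "\<And>x. x \<in> ball z (r/2) \<Longrightarrow> (\<lambda>n. F n x) \<longlonglongrightarrow> g x"
    "\<And>x. x \<in> ball z (r/2) \<Longrightarrow> (g has_derivative D' x) (at x within ball z (r/2))" by blast
  have gG: "g x = G x" if "x \<in> ball z (r/2)" for x
    using LIMSEQ_unique[OF g(1)[OF that] tendsto_uniform_limitI[OF ul in_cball[OF that]]] .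
  have z: "z \<in> ball z (r/2)" using r by simp
  have "(g has_derivative D' z) (at z)"
    using g(2)[OF z] by (simp add: at_within_open[OF z])
  then have "(G has_derivative D' z) (at z)"
    by (rule has_derivative_transform_within_open[of _ _ _ UNIV "ball z (r/2)"]) (use z gG in auto)
  then have "(G has_derivative D' z) (at z within S)" by (rule has_derivative_at_withinI)
  moreover have "D' z (a *s v) = a * D' z v" for a v
  proof (rule LIMSEQ_unique)
    show "(\<lambda>k. D k z (a *s v)) \<longlonglongrightarrow> D' z (a *s v)" by (rule conv[OF z])
    show "(\<lambda>k. D k z (a *s v)) \<longlonglongrightarrow> a * D' z v"
      unfolding Dlin[OF \<open>z \<in> S\<close>] by (intro tendsto_intros conv[OF z])
  qed
  ultimately show "\<exists>D. (G has_derivative D) (at z within S) \<and> (\<forall>a v. D (a *s v) = a * D v)" by (intro exI[of _ "D' z"]) simp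
qed

section \<open>Exponential sums\<close>

text \<open>Taylor's formula with a remainder of at most y^3/6, which is at most 2y/3 because y^2
  \<le> 4. The range covers \<open>pi * \<theta>\<close> for all \<theta> \<le> 1/2.\<close>

lemma sin_ge_third:
  fixes y :: real assumes "0 \<le> y" "y \<le> 2" shows "y / 3 \<le> sin y"
proof -
  have "\<bar>sin y - (\<Sum>m<3. sin_coeff m * y ^ m)\<bar> \<le> inverse (fact 3) * \<bar>y\<bar> ^ 3"
    by (rule Maclaurin_sin_bound)
  moreover have "(\<Sum>m<3. sin_coeff m * y ^ m) = y"
    by (simp add: numeral_3_eq_3 sin_coeff_def)
  moreover have "inverse (fact 3) * \<bar>y\<bar> ^ 3 \<le> y * (2 / 3)"
  proof -
    have "y * y \<le> 2 * 2" using assms by (intro mult_mono) auto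
    then have "y * (y * y) \<le> y * 4" using assms by (intro mult_left_mono) auto
    then show ?thesis using assms by (simp add: power3_eq_cube fact_numeral)
  qed
  ultimately show ?thesis by linarith
qed

lemma cot_antimono: fixes x y :: real assumes "0 < x" "x \<le> y" "y < pi"
  shows "cot y \<le> cot x"
proof -
  have "cot x - cot y = sin (y - x) / (sin x * sin y)"
    using assms sin_gt_zero[of x] sin_gt_zero[of y] by (simp add: cot_def sin_diff field_simps)
  moreover have "sin (y - x) \<ge> 0" using assms by (intro sin_ge_zero) auto
  moreover have "sin x * sin y > 0" using assms by (intro mult_pos_pos sin_gt_zero) auto
  ultimately show ?thesis by (smt (verit) divide_nonneg_pos)
qed

text \<open>Writing \<open>z n = (z (n+1) - z n) c n\<close> with \<open>c n = 1 / (cis (2 \<pi> u n) - 1) = - 1/2 - (i/2) cot (\<pi> u n)\<close>,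
  summation by parts turns the sum into boundary terms plus a telescoping variation of the cotangent.\<close>

lemma kusmin_landau:
  fixes \<phi> :: "nat \<Rightarrow> real" and k :: int and \<theta> :: real
  assumes "a \<le> b" "0 < \<theta>" "\<theta> \<le> 1/2"
    and u: "\<And>n. n \<in> {a..<b} \<Longrightarrow> \<phi> (Suc n) - \<phi> n \<in> {real_of_int k + \<theta>..real_of_int k + 1 - \<theta>}"
    and mono: "\<And>n. a \<le> n \<Longrightarrow> Suc n < b \<Longrightarrow> \<phi> (Suc (Suc n)) - \<phi> (Suc n) \<le> \<phi> (Suc n) - \<phi> n"
  shows "norm (\<Sum>n\<in>{a..<b}. cis (2 * pi * \<phi> n)) \<le> 2 / sin (pi * \<theta>)"
proof -
  define s where "s = sin (pi * \<theta>)"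
  have s: "s > 0" unfolding s_def using assms(2,3) by (intro sin_gt_zero) (auto simp: field_simps)
  \<comment> \<open>Half the angle from \<open>z n\<close> to \<open>z (Suc n)\<close>, reduced by
    \<open>k * pi\<close> into the open interval (0, pi), where the sine is positive and the
    cotangent decreases.\<close>
  define x where "x n = pi * (\<phi> (Suc n) - \<phi> n - k)" for n
  define c where "c n = Complex (- 1/2) (- cot (x n) / 2)" for n
  define z where "z n = cis (2 * pi * \<phi> n)" for n
  have x: "pi * \<theta> \<le> x n" "x n \<le> pi - pi * \<theta>" if "n \<in> {a..<b}" for n
    using u[OF that] mult_left_mono[of \<theta> "\<phi> (Suc n) - \<phi> n - k" pi]
      mult_left_mono[of "\<phi> (Suc n) - \<phi> n - k" "1 - \<theta>" pi]
    by (auto simp: x_def algebra_simps)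
  have th: "0 < pi * \<theta>" "pi * \<theta> \<le> pi / 2" using assms(2,3) by auto
  have sin_x: "sin (x n) \<ge> s" if n: "n \<in> {a..<b}" for n
  proof (cases "x n \<le> pi / 2")
    case True
    then show ?thesis unfolding s_def using x[OF n] th by (intro sin_monotone_2pi_le) auto
  next
    case False
    have "sin (pi * \<theta>) \<le> sin (pi - x n)"
      using x[OF n] th False by (intro sin_monotone_2pi_le) auto
    then show ?thesis by (simp add: s_def)
  qed
  have cot_x: "\<bar>cot (x n)\<bar> \<le> 1 / s" if n: "n \<in> {a..<b}" for n
  proof -
    have "\<bar>cot (x n)\<bar> = \<bar>cos (x n)\<bar> / sin (x n)" using sin_x[OF n] s by (simp add: cot_def)
    also have "\<dots> \<le> 1 / s" using sin_x[OF n] s by (intro frac_le) auto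
    finally show ?thesis .
  qed
  have norm_c: "norm (c n) \<le> 1 / (2 * s)" if n: "n \<in> {a..<b}" for n
  proof -
    have sx: "sin (x n) > 0" using sin_x[OF n] s by simp
    have "(norm (c n))\<^sup>2 = (1 / 2)\<^sup>2 + (cot (x n) / 2)\<^sup>2"
      unfolding cmod_power2 by (simp add: c_def)
    also have "\<dots> = ((sin (x n))\<^sup>2 + (cos (x n))\<^sup>2) / (2 * sin (x n))\<^sup>2"
      using sx by (simp add: cot_def power2_eq_square field_simps)
    finally have "(norm (c n))\<^sup>2 = (1 / (2 * sin (x n)))\<^sup>2"
      by (simp add: power_one_over)
    then have "norm (c n) = 1 / (2 * sin (x n))" using sx by (simp add: power2_eq_iff_nonneg)
    also have "\<dots> \<le> 1 / (2 * s)" using sin_x[OF n] s by (intro frac_le) auto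
    finally show ?thesis .
  qed
  have step: "z n = (z (Suc n) - z n) * c n" if n: "n \<in> {a..<b}" for n
  proof -
    have sx: "sin (x n) > 0" using sin_x[OF n] s by simp
    have "2 * pi * \<phi> (Suc n) = 2 * pi * \<phi> n + 2 * x n + 2 * pi * k" by (simp add: x_def algebra_simps)
    then have "z (Suc n) = z n * cis (2 * x n) * cis (2 * pi * k)"
      unfolding z_def by (simp only: cis_mult)
    also have "cis (2 * pi * k) = 1" by (rule cis_multiple_2pi) simp
    finally have zS: "z (Suc n) = z n * cis (2 * x n)" by simp
    have cis_eq: "cis (2 * x n) - 1 = Complex (- 2 * (sin (x n))\<^sup>2) (2 * sin (x n) * cos (x n))"
      by (simp add: complex_eq_iff sin_double cos_double_sin)
    have "(cis (2 * x n) - 1) * c n = Complex ((sin (x n))\<^sup>2 + (cos (x n))\<^sup>2) 0"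
      unfolding cis_eq using sx by (simp add: c_def cot_def complex_eq_iff field_simps power2_eq_square)
    then have "(cis (2 * x n) - 1) * c n = 1"
      by (simp add: complex_eq_iff)
    moreover have "(z n * cis (2 * x n) - z n) * c n = z n * ((cis (2 * x n) - 1) * c n)"
      by (simp add: algebra_simps)
    ultimately show ?thesis unfolding zS by simp
  qed
  \<comment> \<open>The boundary term at the current end stays on the left. Decreasing increments
    make the cotangents increase, so the norms of the differences of \<open>c\<close>
    telescope.\<close>
  have main: "norm ((\<Sum>n\<in>{a..<Suc m}. z n) - z (Suc m) * c m) \<le> norm (c a) + (cot (x m) - cot (x a)) / 2"
    if "a \<le> m" "m < b" for m
    using that
  proof (induction m rule: dec_induct)
    case base
    have "z a - z (Suc a) * c a = - z a * c a" using step[of a] base by (simp add: algebra_simps)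
    then show ?case by (simp add: norm_mult z_def)
  next
    case (step m)
    have "z (Suc m) = (z (Suc (Suc m)) - z (Suc m)) * c (Suc m)"
      using step.prems step.hyps by (intro \<open>\<And>n. n \<in> {a..<b} \<Longrightarrow> z n = _\<close>) auto
    then have "(\<Sum>n\<in>{a..<Suc (Suc m)}. z n) - z (Suc (Suc m)) * c (Suc m)
        = ((\<Sum>n\<in>{a..<Suc m}. z n) - z (Suc m) * c m) + z (Suc m) * (c m - c (Suc m))"
      using step.hyps by (simp add: algebra_simps)
    moreover have "norm (z (Suc m) * (c m - c (Suc m))) = (cot (x (Suc m)) - cot (x m)) / 2"
    proof -
      have x_mono: "x (Suc m) \<le> x m"
        unfolding x_def using mono[of m] step.prems step.hyps by (intro mult_left_mono) auto
      have "cot (x m) \<le> cot (x (Suc m))"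
        using x[of m] x[of "Suc m"] th mono[of m] step.prems step.hyps
        by (intro cot_antimono) (auto simp: x_mono)
      moreover have "c m - c (Suc m) = Complex 0 ((cot (x (Suc m)) - cot (x m)) / 2)"
        by (simp add: c_def complex_eq_iff field_simps)
      ultimately have "norm (c m - c (Suc m)) = (cot (x (Suc m)) - cot (x m)) / 2"
        by (simp add: cmod_def)
      then show ?thesis unfolding norm_mult by (simp add: z_def)
    qed
    ultimately have "norm ((\<Sum>n\<in>{a..<Suc (Suc m)}. z n) - z (Suc (Suc m)) * c (Suc m))
       \<le> norm ((\<Sum>n\<in>{a..<Suc m}. z n) - z (Suc m) * c m) + (cot (x (Suc m)) - cot (x m)) / 2"
      by (metis norm_triangle_ineq)
    then show ?case using step by (simp add: field_simps)
  qed
  show ?thesis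
  proof (cases "a = b")
    case True
    then show ?thesis using s by (simp add: s_def)
  next
    case False
    define m where "m = b - 1"
    have m: "a \<le> m" "m < b" "Suc m = b" using False assms(1) by (auto simp: m_def)
    have "norm (\<Sum>n\<in>{a..<b}. z n) \<le> norm ((\<Sum>n\<in>{a..<b}. z n) - z b * c m) + norm (z b * c m)"
      by (metis diff_add_cancel norm_triangle_ineq)
    also have "\<dots> \<le> norm (c a) + (cot (x m) - cot (x a)) / 2 + norm (c m)"
      using main[OF m(1,2)] m(3) by (simp add: norm_mult z_def)
    \<comment> \<open>Two boundary terms of size 1/(2s) and half of a cotangent variation of at most
      2/s.\<close>
    also have "\<dots> \<le> 1 / (2 * s) + (1 / s + 1 / s) / 2 + 1 / (2 * s)"
      using norm_c[of a] norm_c[of m] cot_x[of a] cot_x[of m] m by (intro add_mono divide_right_mono) auto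
    also have "\<dots> = 2 / s" using s by (simp add: field_simps)
    finally show ?thesis by (simp add: z_def s_def)
  qed
qed

text \<open>Brings a set of consecutive indices, cut out by a condition on monotone increments, into
  the interval form that \<open>kusmin_landau\<close> takes; the empty set becomes
  \<open>{0..<0}\<close>.\<close>

lemma finite_convex_nat_set:
  fixes C :: "nat set"
  assumes "finite C" and conv: "\<And>x y m. x \<in> C \<Longrightarrow> y \<in> C \<Longrightarrow> x \<le> m \<Longrightarrow> m \<le> y \<Longrightarrow> m \<in> C"
  obtains a b where "a \<le> b" "C = {a..<b}"
proof (cases "C = {}")
  case True
  then show ?thesis using that[of 0 0] by simp
next
  case False
  have "x \<in> C" if "Min C \<le> x" "x \<le> Max C" for x
    by (rule conv[OF Min_in[OF assms(1) False] Max_in[OF assms(1) False] that])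
  then have "C = {Min C..<Suc (Max C)}"
    using assms(1) by (auto simp: less_Suc_eq_le)
  moreover have "Min C \<le> Suc (Max C)"
    using Min_le[OF assms(1) Max_in[OF assms(1) False]] by simp
  ultimately show ?thesis using that by blast
qed

text \<open>The discrete form of van der Corput's second derivative test: near the integers the phase
  increments are counted trivially, elsewhere the Kusmin--Landau inequality applies.\<close>

lemma second_difference_test:
  fixes \<phi> :: "nat \<Rightarrow> real" and \<theta> \<mu> V :: real
  defines "u \<equiv> \<lambda>n. \<phi> (Suc n) - \<phi> n"
  assumes lam: "\<mu> > 0" and th: "0 < \<theta>" "\<theta> \<le> 1/2" and "V \<ge> 0"
    and gap: "\<And>n. a \<le> n \<Longrightarrow> Suc n < b \<Longrightarrow> u n - u (Suc n) \<ge> \<mu>"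
    and V: "u a - u (b - 1) \<le> V"
  shows "norm (\<Sum>n\<in>{a..<b}. cis (2 * pi * \<phi> n)) \<le> (V + 2) * (2 * (\<theta> / \<mu> + 1) + 2 / sin (pi * \<theta>))"
proof (cases "a < b")
  case False
  have "sin (pi * \<theta>) > 0" using th by (intro sin_gt_zero) (auto simp: field_simps)
  then show ?thesis using False assms by simp
next
  case ab: True
  have gap': "u m - u n \<ge> \<mu> * (real n - real m)" if "a \<le> m" "m \<le> n" "n < b" for m n
    using that(2,3,1)
  proof (induction n rule: dec_induct)
    case (step n)
    then show ?case using gap[of n] by (simp add: algebra_simps)
  qed simp
  have mono: "u n \<le> u m" if "a \<le> m" "m \<le> n" "n < b" for m n
  proof -
    have "0 \<le> \<mu> * (real n - real m)" using lam that by (intro mult_nonneg_nonneg) auto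
    then show ?thesis using gap'[OF that] by linarith
  qed
  \<comment> \<open>The increments are \<open>\<mu>\<close>-separated, so the first and the last
    index whose increments lie in a window of length \<open>\<theta>\<close> are at most
    \<open>\<theta> / \<mu>\<close> apart.\<close>
  have count: "real (card B) \<le> \<theta> / \<mu> + 1"
    if B: "B \<subseteq> {a..<b}" "\<And>n. n \<in> B \<Longrightarrow> x \<le> u n \<and> u n \<le> x + \<theta>" for B x
  proof (cases "B = {}")
    case True
    then show ?thesis using lam th by simp
  next
    case False
    have fin: "finite B" using B(1) finite_subset by blast
    note mm = Min_in[OF fin False] Max_in[OF fin False]
    have le: "Min B \<le> Max B" using fin False by simp
    have "card B \<le> card {Min B..Max B}" using fin by (intro card_mono) auto
    then have "real (card B) \<le> real (Max B) - real (Min B) + 1" using le by simp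
    moreover have "\<mu> * (real (Max B) - real (Min B)) \<le> u (Min B) - u (Max B)"
      by (rule gap') (use le mm B(1) in auto)
    then have "\<mu> * (real (Max B) - real (Min B)) \<le> \<theta>"
      using B(2)[OF mm(1)] B(2)[OF mm(2)] by linarith
    then have "real (Max B) - real (Min B) \<le> \<theta> / \<mu>"
      using lam by (simp add: pos_le_divide_eq mult.commute)
    ultimately show ?thesis by linarith
  qed
  define z where "z n = cis (2 * pi * \<phi> n)" for n
  define W where "W = 2 * (\<theta> / \<mu> + 1) + 2 / sin (pi * \<theta>)"
  have piece: "norm (\<Sum>n\<in>{n\<in>{a..<b}. \<lfloor>u n\<rfloor> = k}. z n) \<le> W" for k
  proof -
    define A where "A = {n\<in>{a..<b}. \<lfloor>u n\<rfloor> = k}"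
    define C where "C = {n\<in>{a..<b}. real_of_int k + \<theta> \<le> u n \<and> u n \<le> real_of_int k + 1 - \<theta>}"
    define B1 where "B1 = {n\<in>{a..<b}. real_of_int k \<le> u n \<and> u n \<le> real_of_int k + \<theta>}"
    define B2 where "B2 = {n\<in>{a..<b}. real_of_int k + 1 - \<theta> \<le> u n \<and> u n \<le> (real_of_int k + 1 - \<theta>) + \<theta>}"
    have fin: "finite A" "finite C" "finite B1" "finite B2" by (auto simp: A_def C_def B1_def B2_def)
    have "C \<subseteq> A" using th by (auto simp: A_def C_def floor_eq_iff)
    then have split: "sum z A = sum z C + sum z (A - C)"
      using fin by (metis add.commute sum.subset_diff)
    have "A - C \<subseteq> B1 \<union> B2"
      using floor_correct by (auto simp: A_def C_def B1_def B2_def floor_eq_iff)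
    then have "card (A - C) \<le> card B1 + card B2"
      using fin by (meson card_Un_le card_mono finite_UnI le_trans)
    then have "real (card (A - C)) \<le> real (card B1) + real (card B2)"
      by linarith
    moreover have "real (card B1) \<le> \<theta> / \<mu> + 1"
      by (rule count[of _ "real_of_int k"]) (auto simp: B1_def)
    moreover have "real (card B2) \<le> \<theta> / \<mu> + 1"
      by (rule count[of _ "real_of_int k + 1 - \<theta>"]) (auto simp: B2_def)
    ultimately have "real (card (A - C)) \<le> 2 * (\<theta> / \<mu> + 1)"
      unfolding mult_2 by linarith
    moreover have "norm (sum z (A - C)) \<le> real (card (A - C))"
      by (rule order_trans[OF norm_sum]) (simp add: z_def)
    moreover have "norm (sum z C) \<le> 2 / sin (pi * \<theta>)"
    proof -
      have "n \<in> C" if "x \<in> C" "y \<in> C" "x \<le> n" "n \<le> y" for x y n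
        using that mono[of x n] mono[of n y] unfolding C_def by fastforce
      then obtain a' b' where C: "a' \<le> b'" "C = {a'..<b'}"
        using finite_convex_nat_set[OF fin(2)] by metis
      show ?thesis unfolding C(2) z_def
      proof (rule kusmin_landau[OF C(1) th, where k = k])
        show "\<phi> (Suc n) - \<phi> n \<in> {real_of_int k + \<theta>..real_of_int k + 1 - \<theta>}" if "n \<in> {a'..<b'}" for n
          using that[folded C(2)] unfolding C_def u_def by auto
        show "\<phi> (Suc (Suc n)) - \<phi> (Suc n) \<le> \<phi> (Suc n) - \<phi> n" if "a' \<le> n" "Suc n < b'" for n
        proof -
          have "n \<in> C" "Suc n \<in> C" using that C(2) by auto
          then show ?thesis using mono[of n "Suc n"] unfolding C_def u_def by auto
        qed
      qed
    qed
    moreover have "norm (sum z A) \<le> norm (sum z C) + norm (sum z (A - C))"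
      unfolding split by (rule norm_triangle_ineq)
    ultimately show ?thesis unfolding W_def A_def by linarith
  qed
  define K where "K = {\<lfloor>u (b - 1)\<rfloor>..\<lfloor>u a\<rfloor>}"
  have "(\<lambda>n. \<lfloor>u n\<rfloor>) ` {a..<b} \<subseteq> K"
    unfolding K_def using mono ab by (auto intro!: floor_mono)
  then have "(\<Sum>n\<in>{a..<b}. z n) = (\<Sum>k\<in>K. \<Sum>n\<in>{n\<in>{a..<b}. \<lfloor>u n\<rfloor> = k}. z n)"
    by (subst sum.group) (auto simp: K_def)
  also have "norm \<dots> \<le> (\<Sum>k\<in>K. W)"
    by (intro order_trans[OF norm_sum] sum_mono piece)
  also have "\<dots> = real (card K) * W" by simp
  also have "\<dots> \<le> (V + 2) * W"
  proof (rule mult_right_mono)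
    have "sin (pi * \<theta>) > 0" using th by (intro sin_gt_zero) (auto simp: field_simps)
    then show "0 \<le> W" unfolding W_def using lam th by simp
    \<comment> \<open>The increments drop by at most \<open>V\<close> in total, so their integer
      parts take at most \<open>V + 2\<close> values.\<close>
    have "real_of_int (\<lfloor>u a\<rfloor> - \<lfloor>u (b - 1)\<rfloor> + 1) \<le> V + 2" using V by linarith
    then show "real (card K) \<le> V + 2" unfolding K_def using \<open>V \<ge> 0\<close> by simp
  qed
  finally show ?thesis unfolding W_def z_def .
qed

lemma exponential_sum_log_block:
  fixes t :: real and N b :: nat
  assumes N: "N \<ge> 1" "sqrt t \<le> real N" and t: "t > 0" and b: "b \<le> 2 * N"
  shows "norm (\<Sum>n\<in>{N..<b}. cis (t * ln (real n))) \<le> 200 * (sqrt t + real N / sqrt t)"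
proof (cases "N < b")
  case False
  then show ?thesis using t by simp
next
  case True
  define \<phi> where "\<phi> n = t / (2 * pi) * ln (real n)" for n :: nat
  \<comment> \<open>Equal to \<open>t / (2 * pi)\<close> times 1 / (2N)^2: a lower bound for the
    second differences, as \<open>Suc n\<close> stays below \<open>2 * N\<close>.\<close>
  define \<mu> where "\<mu> = t / (8 * pi * (real N)\<^sup>2)"
  define \<theta> where "\<theta> = sqrt \<mu>"
  define V where "V = t / (2 * pi * real N)"
  have pi2: "2 * pi > 0" by simp
  have N0: "real N > 0" using N by simp
  have lam: "\<mu> > 0" using t N0 by (simp add: \<mu>_def)
  have tN: "t \<le> (real N)\<^sup>2" using N(2) t by (simp add: sqrt_le_D)
  have "\<mu> \<le> 1 / (8 * pi)" using tN t N0 by (simp add: \<mu>_def field_simps)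
  also have "\<dots> \<le> (1/2)\<^sup>2" using pi_gt3 by (simp add: field_simps power2_eq_square)
  finally have "sqrt \<mu> \<le> sqrt ((1/2)\<^sup>2)" by (rule real_sqrt_le_mono)
  then have th: "0 < \<theta>" "\<theta> \<le> 1/2" using lam by (auto simp: \<theta>_def real_sqrt_abs)
  have thlam: "\<theta> / \<mu> = 1 / \<theta>" using lam by (simp add: \<theta>_def field_simps)
  have sin_th: "sin (pi * \<theta>) \<ge> \<theta>"
  proof -
    have "pi * \<theta> \<le> 4 * (1/2)" using th pi_less_4 by (intro mult_mono) auto
    then have "pi * \<theta> / 3 \<le> sin (pi * \<theta>)" using th by (intro sin_ge_third) auto
    moreover have "\<theta> \<le> pi * \<theta> / 3" using th pi_gt3 by simp
    ultimately show ?thesis by linarith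
  qed
  have "norm (\<Sum>n\<in>{N..<b}. cis (2 * pi * \<phi> n)) \<le> (V + 2) * (2 * (\<theta> / \<mu> + 1) + 2 / sin (pi * \<theta>))"
  proof (rule second_difference_test[OF lam th])
    show "V \<ge> 0" using t by (simp add: V_def)
    fix n assume n: "N \<le> n" "Suc n < b"
    have n0: "real n > 0" using n N by simp
    have "(\<phi> (Suc n) - \<phi> n) - (\<phi> (Suc (Suc n)) - \<phi> (Suc n))
        = t / (2 * pi) * (2 * ln (real (Suc n)) - ln (real n) - ln (real (Suc (Suc n))))"
      by (simp add: \<phi>_def algebra_simps)
    \<comment> \<open>Since n (n + 2) = (n + 1)^2 - 1, the argument of the logarithm is 1 - 1 / (n +
      1)^2, and ln x \<le> x - 1 gives the lower bound.\<close>
    also have "2 * ln (real (Suc n)) - ln (real n) - ln (real (Suc (Suc n)))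
        = - ln (real n * real (Suc (Suc n)) / (real (Suc n))\<^sup>2)"
      using n0 by (simp add: ln_mult ln_div ln_realpow)
    also have "t / (2 * pi) * \<dots> \<ge> t / (2 * pi) * (1 / (real (Suc n))\<^sup>2)"
    proof (rule mult_left_mono)
      have "ln (real n * real (Suc (Suc n)) / (real (Suc n))\<^sup>2) \<le>
          real n * real (Suc (Suc n)) / (real (Suc n))\<^sup>2 - 1"
        using n0 by (intro ln_le_minus_one) (simp add: zero_less_divide_iff)
      also have "\<dots> = - (1 / (real (Suc n))\<^sup>2)"
      proof -
        have eq: "real n * real (Suc (Suc n)) = (real (Suc n))\<^sup>2 - 1"
          by (simp add: power2_eq_square algebra_simps)
        show ?thesis unfolding eq by (simp add: diff_divide_distrib)
      qed
      finally show "1 / (real (Suc n))\<^sup>2 \<le> - ln (real n * real (Suc (Suc n)) / (real (Suc n))\<^sup>2)"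
        by linarith
    qed (use t in auto)
    finally have *: "(\<phi> (Suc n) - \<phi> n) - (\<phi> (Suc (Suc n)) - \<phi> (Suc n)) \<ge> t / (2 * pi) * (1 / (real (Suc n))\<^sup>2)" .
    have "\<mu> = t / (2 * pi) * (1 / (2 * real N)\<^sup>2)" by (simp add: \<mu>_def power_mult_distrib field_simps)
    also have "\<dots> \<le> t / (2 * pi) * (1 / (real (Suc n))\<^sup>2)"
    proof (rule mult_left_mono)
      have "(real (Suc n))\<^sup>2 \<le> (2 * real N)\<^sup>2" using n b by (intro power_mono) auto
      then show "1 / (2 * real N)\<^sup>2 \<le> 1 / (real (Suc n))\<^sup>2" by (intro frac_le) auto
    qed (use t in simp)
    also note *
    finally show "\<mu> \<le> (\<phi> (Suc n) - \<phi> n) - (\<phi> (Suc (Suc n)) - \<phi> (Suc n))" .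
  next
    have "\<phi> (Suc N) - \<phi> N = t / (2 * pi) * ln (1 + 1 / real N)"
    proof -
      have "ln (1 + 1 / real N) = ln (real (Suc N) / real N)" using N0 by (simp add: field_simps)
      also have "\<dots> = ln (real (Suc N)) - ln (real N)" using N0 by (simp add: ln_div)
      finally show ?thesis by (simp add: \<phi>_def right_diff_distrib)
    qed
    also have "\<dots> \<le> t / (2 * pi) * (1 / real N)"
      using t N0 by (intro mult_left_mono ln_add_one_self_le_self) auto
    finally have "\<phi> (Suc N) - \<phi> N \<le> V" by (simp add: V_def)
    \<comment> \<open>The last increment is nonnegative, so the first one alone bounds the total
      drop.\<close>
    moreover have "\<phi> (b - 1) \<le> \<phi> (Suc (b - 1))"
    proof -
      have "ln (real (b - 1)) \<le> ln (real (Suc (b - 1)))"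
        using True N by (intro ln_mono) auto
      then show ?thesis unfolding \<phi>_def using t by (intro mult_left_mono) auto
    qed
    ultimately show "\<phi> (Suc N) - \<phi> N - (\<phi> (Suc (b - 1)) - \<phi> (b - 1)) \<le> V" by linarith
  qed
  also have "\<dots> \<le> (V + 2) * (5 / \<theta>)"
  proof (rule mult_left_mono)
    have "2 / sin (pi * \<theta>) \<le> 2 / \<theta>" using sin_th th by (intro divide_left_mono) auto
    moreover have "2 \<le> 1 / \<theta>" using th by (simp add: field_simps)
    ultimately show "2 * (\<theta> / \<mu> + 1) + 2 / sin (pi * \<theta>) \<le> 5 / \<theta>" unfolding thlam by simp
    show "0 \<le> V + 2" using t by (simp add: V_def)
  qed
  also have "\<dots> \<le> (t / real N + 2) * (30 * real N / sqrt t)"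
  proof (rule mult_mono)
    have "t / (2 * pi * real N) \<le> t / real N"
      using t N0 pi_gt3 by (intro divide_left_mono) auto
    then show "V + 2 \<le> t / real N + 2" by (simp add: V_def)
    have "sqrt (8 * pi) \<le> sqrt (6\<^sup>2)"
      using pi_less_4 by (intro real_sqrt_le_mono) simp
    then have "sqrt (8 * pi) \<le> 6" by simp
    then have "sqrt (8 * pi) * (real N / sqrt t) \<le> 6 * (real N / sqrt t)"
      using N0 t by (intro mult_right_mono) auto
    moreover have "1 / \<theta> = sqrt (8 * pi) * (real N / sqrt t)"
      using N0 t by (simp add: \<theta>_def \<mu>_def real_sqrt_divide real_sqrt_mult)
    ultimately show "5 / \<theta> \<le> 30 * real N / sqrt t" by simp
  qed (use t N0 th in auto)
  also have "\<dots> = 30 * (t / sqrt t) + 60 * (real N / sqrt t)"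
    using N0 t by (simp add: field_simps)
  also have "t / sqrt t = sqrt t" using t by (simp add: real_div_sqrt)
  also have "30 * sqrt t + 60 * (real N / sqrt t) \<le> 200 * (sqrt t + real N / sqrt t)"
  proof -
    have "0 \<le> sqrt t" "0 \<le> real N / sqrt t" using t by auto
    then show ?thesis unfolding distrib_left by linarith
  qed
  finally show ?thesis by (simp add: \<phi>_def)
qed

text \<open>Summation by parts: the weight differences are nonnegative, so their total is
  \<open>w N - w b\<close>, and the boundary term contributes the missing
  \<open>w b\<close>.\<close>

lemma abel_summation_bound:
  fixes w :: "nat \<Rightarrow> real" and z :: "nat \<Rightarrow> complex"
  assumes "N \<le> b" and w: "\<And>n. N \<le> n \<Longrightarrow> n \<le> b \<Longrightarrow> 0 \<le> w n" "\<And>n. N \<le> n \<Longrightarrow> n < b \<Longrightarrow> w (Suc n) \<le> w n"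
    and B: "\<And>m. N \<le> m \<Longrightarrow> m \<le> b \<Longrightarrow> norm (\<Sum>n\<in>{N..<m}. z n) \<le> B"
  shows "norm (\<Sum>n\<in>{N..<b}. of_real (w n) * z n) \<le> w N * B"
proof -
  define S where "S m = (\<Sum>n\<in>{N..<m}. z n)" for m
  have main: "norm ((\<Sum>n\<in>{N..<m}. of_real (w n) * z n) - of_real (w m) * S m) \<le> (w N - w m) * B"
    if "N \<le> m" "m \<le> b" for m
    using that
  proof (induction m rule: dec_induct)
    case (step m)
    have "(\<Sum>n\<in>{N..<Suc m}. of_real (w n) * z n) - of_real (w (Suc m)) * S (Suc m)
      = ((\<Sum>n\<in>{N..<m}. of_real (w n) * z n) - of_real (w m) * S m) + of_real (w m - w (Suc m)) * S (Suc m)"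
      using step.hyps by (simp add: S_def algebra_simps)
    also have "norm \<dots> \<le> (w N - w m) * B + (w m - w (Suc m)) * B"
    proof (intro order_trans[OF norm_triangle_ineq] add_mono)
      show "norm (of_real (w m - w (Suc m)) * S (Suc m)) \<le> (w m - w (Suc m)) * B"
        unfolding norm_mult norm_of_real using step w(2)[of m] B[of "Suc m"]
        by (auto simp: S_def intro!: mult_left_mono)
    qed (use step in auto)
    finally show ?case by (simp add: algebra_simps)
  qed (simp add: S_def)
  have "norm (\<Sum>n\<in>{N..<b}. of_real (w n) * z n) \<le>
      norm ((\<Sum>n\<in>{N..<b}. of_real (w n) * z n) - of_real (w b) * S b) + norm (of_real (w b) * S b)"
    by (metis diff_add_cancel norm_triangle_ineq)
  also have "\<dots> \<le> (w N - w b) * B + w b * B"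
    using main[of b] B[of b] w(1)[of b] \<open>N \<le> b\<close>
    by (intro add_mono) (auto simp: norm_mult S_def intro!: mult_left_mono)
  finally show ?thesis by (simp add: algebra_simps)
qed

section \<open>The regularized Riemann zeta function\<close>

definition zeta_block :: "nat \<Rightarrow> complex \<Rightarrow> complex" where
  "zeta_block n s = (s - 1) * of_nat n powr (- s) - (of_nat n powr (1 - s) - of_nat (Suc n) powr (1 - s))"

text \<open>This is \<open>(s - 1) \<zeta>(s)\<close>: each summand is \<open>(s - 1)\<close> times the difference between
  \<open>n powr (- s)\<close> and the integral of \<open>x powr (- s)\<close> over \<open>[n, n + 1]\<close>.\<close>

definition reg_zeta :: "complex \<Rightarrow> complex" where
  "reg_zeta s = 1 + (\<Sum>n. zeta_block (Suc n) s)"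

text \<open>The mean value inequality on the segment from n to n + 1, used twice. It bounds the
  variation of z^(-s) by |s| n^(- Re s - 1), and then the increment of \<open>h\<close>, whose
  derivative is (s - 1) (n^(-s) - z^(-s)) and whose increment over the segment is
  \<open>zeta_block n s\<close>.\<close>

lemma norm_zeta_block_le:
  assumes n: "n \<ge> 1" and s: "Re s \<ge> 0"
  shows "norm (zeta_block n s) \<le> norm (s - 1) * norm s * real n powr (- Re s - 1)"
proof -
  define S where "S = closed_segment (of_nat n) (of_nat (Suc n) :: complex)"
  define B where "B = real n powr (- Re s - 1)"
  have S: "\<exists>x. z = complex_of_real x \<and> real n \<le> x \<and> x \<le> real n + 1" if "z \<in> S" for z
  proof -
    from that obtain u where u: "0 \<le> u" "u \<le> 1" "z = (1 - u) *\<^sub>R of_nat n + u *\<^sub>R of_nat (Suc n)"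
      unfolding S_def closed_segment_def by blast
    then have "z = complex_of_real (real n + u)" by (simp add: scaleR_conv_of_real algebra_simps)
    then show ?thesis using u by (intro exI[of _ "real n + u"]) auto
  qed
  have nonpos: "z \<notin> \<real>\<^sub>\<le>\<^sub>0" if "z \<in> S" for z
  proof -
    obtain x where "z = complex_of_real x" "real n \<le> x" using S[OF \<open>z \<in> S\<close>] by blast
    then show ?thesis using n by simp
  qed
  have conv: "convex S" by (simp add: S_def)
  have ends: "of_nat n \<in> S" "of_nat (Suc n) \<in> S" unfolding S_def by auto
  have normS: "norm (z - of_nat n) \<le> 1" if "z \<in> S" for z
  proof -
    obtain x where x: "z = complex_of_real x" "real n \<le> x" "x \<le> real n + 1" using S[OF \<open>z \<in> S\<close>] by blast
    then have "z - of_nat n = complex_of_real (x - real n)" by simp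
    then show ?thesis using x(2,3) by (simp only: norm_of_real)
  qed
  have step1: "norm (z powr (- s) - of_nat n powr (- s)) \<le> norm s * B" if z: "z \<in> S" for z
  proof -
    have "norm (z powr (- s) - of_nat n powr (- s)) \<le> norm s * B * norm (z - of_nat n)"
    proof (rule field_differentiable_bound[OF conv _ _ z ends(1)])
      show "((\<lambda>z. z powr (- s)) has_field_derivative - s * w powr (- s - 1)) (at w within S)"
        if "w \<in> S" for w
        using has_field_derivative_powr[OF nonpos[OF that], of "- s"] has_field_derivative_at_within by blast
      show "norm (- s * w powr (- s - 1)) \<le> norm s * B" if "w \<in> S" for w
      proof -
        obtain x where x: "w = complex_of_real x" "real n \<le> x" using S[OF \<open>w \<in> S\<close>] by blast
        have "norm (w powr (- s - 1)) = x powr (- Re s - 1)"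
          using x n by (simp add: norm_powr_real_powr)
        also have "\<dots> \<le> B" unfolding B_def using x n s by (intro powr_mono2') auto
        finally show ?thesis by (simp add: norm_mult mult_left_mono)
      qed
    qed
    also have "\<dots> \<le> norm s * B * 1"
      using normS[OF z] by (intro mult_left_mono) (auto simp: B_def)
    finally show ?thesis by simp
  qed
  define h where "h z = (s - 1) * (z * of_nat n powr (- s)) + z powr (1 - s)" for z
  have "norm (h (of_nat (Suc n)) - h (of_nat n)) \<le> norm (s - 1) * (norm s * B) * norm (of_nat (Suc n) - of_nat n :: complex)"
  proof (rule field_differentiable_bound[OF conv _ _ ends(2,1)])
    show "(h has_field_derivative (s - 1) * of_nat n powr (- s) + (1 - s) * w powr (1 - s - 1)) (at w within S)"
      if "w \<in> S" for w
    proof -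
      have "((\<lambda>z. z powr (1 - s)) has_field_derivative (1 - s) * w powr (1 - s - 1)) (at w within S)"
        using has_field_derivative_powr[OF nonpos[OF that], of "1 - s"] has_field_derivative_at_within by blast
      moreover have "((\<lambda>z. (s - 1) * (z * of_nat n powr (- s))) has_field_derivative (s - 1) * of_nat n powr (- s)) (at w within S)"
        by (auto intro!: derivative_eq_intros)
      ultimately show ?thesis unfolding h_def by (rule DERIV_add[rotated])
    qed
    show "norm ((s - 1) * of_nat n powr (- s) + (1 - s) * w powr (1 - s - 1)) \<le> norm (s - 1) * (norm s * B)"
      if "w \<in> S" for w
    proof -
      have "(s - 1) * of_nat n powr (- s) + (1 - s) * w powr (1 - s - 1)
        = - ((s - 1) * (w powr (- s) - of_nat n powr (- s)))"
        by (simp add: algebra_simps)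
      then show ?thesis using step1[OF that] by (simp only: norm_minus_cancel norm_mult) (intro mult_left_mono, auto)
    qed
  qed
  moreover have "h (of_nat (Suc n)) - h (of_nat n) = zeta_block n s"
    by (simp add: h_def zeta_block_def algebra_simps)
  ultimately show ?thesis by (simp add: B_def mult.assoc)
qed

lemma sum_zeta_block:
  "1 + (\<Sum>n<N. zeta_block (Suc n) s)
   = (s - 1) * (\<Sum>n\<in>{1..<Suc N}. of_nat n powr (- s)) + of_nat (Suc N) powr (1 - s)"
  by (induction N) (simp_all add: zeta_block_def algebra_simps)

text \<open>The blocks decay at least like n^(-15/8) when Re s \<ge> 7/8. An exponent 1/2 is spent
  on the factor 1 / sqrt N and the summable n^(-11/8) remains. The explicit dependence on
  \<open>s\<close> serves both the locally uniform convergence and the choice of \<open>N\<close> in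
  the growth estimate.\<close>

lemma reg_zeta_approx:
  obtains C where "C \<ge> 0" and "\<And>s N. Re s \<ge> 7/8 \<Longrightarrow> N \<ge> 1 \<Longrightarrow>
    norm (reg_zeta s - ((s - 1) * (\<Sum>n\<in>{1..<N}. of_nat n powr (- s)) + of_nat N powr (1 - s)))
      \<le> C * (norm (s - 1) * norm s) / sqrt (real N)"
proof -
  define C where "C = (\<Sum>n. real (Suc n) powr (- (11/8)))"
  have summ: "summable (\<lambda>n. real (Suc n) powr (- (11/8)))"
    using summable_real_powr_iff[of "- (11/8)"] summable_Suc_iff[of "\<lambda>n. real n powr (- (11/8))"] by simp
  show ?thesis
  proof (rule that)
    show "C \<ge> 0" unfolding C_def by (intro suminf_nonneg summ) auto
    fix s :: complex and N :: nat
    assume s: "Re s \<ge> 7/8" and N: "N \<ge> 1"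
    define M where "M = N - 1"
    have M: "N = Suc M" using N by (simp add: M_def)
    define c where "c = norm (s - 1) * norm s / sqrt (real N)"
    have bound: "norm (zeta_block (Suc n) s) \<le> norm (s - 1) * norm s * (real (Suc n) powr (- (11/8)) / sqrt (real (Suc n)))"
      for n
    proof -
      have "norm (zeta_block (Suc n) s) \<le> norm (s - 1) * norm s * real (Suc n) powr (- Re s - 1)"
        using s by (intro norm_zeta_block_le) auto
      also have "\<dots> \<le> norm (s - 1) * norm s * real (Suc n) powr (- (11/8) - 1/2)"
        using s by (intro mult_left_mono powr_mono) auto
      also have "real (Suc n) powr (- (11/8) - 1/2) = real (Suc n) powr (- (11/8)) / sqrt (real (Suc n))"
        unfolding powr_diff by (simp add: powr_half_sqrt)
      finally show ?thesis .
    qed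
    have summ1: "summable (\<lambda>n. norm (s - 1) * norm s * real (Suc n) powr (- (11/8)))"
      by (intro summable_mult summ)
    have "summable (\<lambda>n. norm (zeta_block (Suc n) s))"
    proof (rule summable_comparison_test'[OF summ1, of 0])
      fix n
      have "real (Suc n) powr (- (11/8)) / sqrt (real (Suc n)) \<le> real (Suc n) powr (- (11/8)) / 1"
        by (intro divide_left_mono) auto
      then have "norm (s - 1) * norm s * (real (Suc n) powr (- (11/8)) / sqrt (real (Suc n)))
          \<le> norm (s - 1) * norm s * real (Suc n) powr (- (11/8))"
        by (intro mult_left_mono) auto
      then show "norm (norm (zeta_block (Suc n) s)) \<le> norm (s - 1) * norm s * real (Suc n) powr (- (11/8))"
        using bound[of n] by simp
    qed
    note sn = this
    have sc: "summable (\<lambda>n. zeta_block (Suc n) s)" using sn by (rule summable_norm_cancel)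
    have "reg_zeta s - (1 + (\<Sum>n<M. zeta_block (Suc n) s)) = (\<Sum>n. zeta_block (Suc (n + M)) s)"
      unfolding reg_zeta_def using suminf_minus_initial_segment[OF sc, of M] by simp
    also have "norm \<dots> \<le> (\<Sum>n. norm (zeta_block (Suc (n + M)) s))"
      using summable_iff_shift[of "\<lambda>n. norm (zeta_block (Suc n) s)" M] sn by (intro summable_norm) simp
    also have "\<dots> \<le> (\<Sum>n. c * real (Suc (n + M)) powr (- (11/8)))"
    proof (rule suminf_le)
      fix n
      have "real (Suc (n + M)) powr (- (11/8)) / sqrt (real (Suc (n + M)))
          \<le> real (Suc (n + M)) powr (- (11/8)) / sqrt (real N)"
        using M by (intro divide_left_mono) auto
      then have "norm (s - 1) * norm s * (real (Suc (n + M)) powr (- (11/8)) / sqrt (real (Suc (n + M))))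
          \<le> norm (s - 1) * norm s * (real (Suc (n + M)) powr (- (11/8)) / sqrt (real N))"
        by (intro mult_left_mono) auto
      then show "norm (zeta_block (Suc (n + M)) s) \<le> c * real (Suc (n + M)) powr (- (11/8))"
        using bound[of "n + M"] by (simp add: c_def)
    next
      show "summable (\<lambda>n. norm (zeta_block (Suc (n + M)) s))"
        using summable_iff_shift[of "\<lambda>n. norm (zeta_block (Suc n) s)" M] sn by simp
      show "summable (\<lambda>n. c * real (Suc (n + M)) powr (- (11/8)))"
        using summable_iff_shift[of "\<lambda>n. real (Suc n) powr (- (11/8))" M] summ by (intro summable_mult) simp
    qed
    also have "\<dots> = c * (\<Sum>n. real (Suc (n + M)) powr (- (11/8)))"
      using summable_iff_shift[of "\<lambda>n. real (Suc n) powr (- (11/8))" M] summ by (intro suminf_mult) simp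
    also have "\<dots> \<le> c * C"
    proof (rule mult_left_mono)
      have "0 \<le> (\<Sum>n<M. real (Suc n) powr (- (11/8)))" by (intro sum_nonneg) auto
      then show "(\<Sum>n. real (Suc (n + M)) powr (- (11/8))) \<le> C"
        unfolding C_def using suminf_minus_initial_segment[OF summ, of M] by simp
    qed (simp add: c_def)
    finally show "norm (reg_zeta s - ((s - 1) * (\<Sum>n\<in>{1..<N}. of_nat n powr (- s)) + of_nat N powr (1 - s)))
      \<le> C * (norm (s - 1) * norm s) / sqrt (real N)"
      unfolding sum_zeta_block M[symmetric] by (simp add: c_def mult.commute)
  qed
qed

lemma reg_zeta_1: "reg_zeta 1 = 1"
  by (simp add: reg_zeta_def zeta_block_def del: of_nat_Suc)

lemma holomorphic_reg_zeta: "reg_zeta holomorphic_on {s. Re s > 7/8}"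
proof (rule holomorphic_uniform_sequence)
  let ?f = "\<lambda>N s. (s - 1) * (\<Sum>n\<in>{1..<Suc N}. of_nat n powr (- s)) + of_nat (Suc N) powr (1 - s)"
  show op: "open {s. Re s > 7/8}" by (rule open_halfspace_Re_gt)
  show "?f N holomorphic_on {s. Re s > 7/8}" for N
    by (intro holomorphic_intros) auto
  obtain C where C: "C \<ge> 0" "\<And>s N. Re s \<ge> 7/8 \<Longrightarrow> N \<ge> 1 \<Longrightarrow>
    norm (reg_zeta s - ((s - 1) * (\<Sum>n\<in>{1..<N}. of_nat n powr (- s)) + of_nat N powr (1 - s)))
      \<le> C * (norm (s - 1) * norm s) / sqrt (real N)"
    using reg_zeta_approx by blast
  fix z :: complex assume "z \<in> {s. Re s > 7/8}"
  then obtain d where d: "d > 0" "cball z d \<subseteq> {s. Re s > 7/8}"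
    using op open_contains_cball by metis
  define B where "B = norm z + d"
  have "uniform_limit (cball z d) ?f reg_zeta sequentially"
  proof (rule uniform_limitI)
    fix e :: real assume e: "e > 0"
    have "(\<lambda>N. C * ((B + 1) * B) / sqrt (real (Suc N))) \<longlonglongrightarrow> 0"
      by real_asymp
    then have "\<forall>\<^sub>F N in sequentially. C * ((B + 1) * B) / sqrt (real (Suc N)) < e"
      using e by (auto simp: order_tendsto_iff)
    then show "\<forall>\<^sub>F N in sequentially. \<forall>s\<in>cball z d. dist (?f N s) (reg_zeta s) < e"
    proof (rule eventually_mono, intro ballI)
      fix N s assume N: "C * ((B + 1) * B) / sqrt (real (Suc N)) < e" and s: "s \<in> cball z d"
      have "norm s \<le> B" using s norm_triangle_ineq2[of s z] by (simp add: B_def dist_norm norm_minus_commute)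
      moreover have "norm (s - 1) \<le> norm s + 1" using norm_triangle_ineq4[of s 1] by simp
      ultimately have "norm (s - 1) * norm s \<le> (B + 1) * B"
        using norm_ge_zero[of z] d(1) by (intro mult_mono) (auto simp: B_def)
      then have "C * (norm (s - 1) * norm s) / sqrt (real (Suc N)) \<le> C * ((B + 1) * B) / sqrt (real (Suc N))"
        using C(1) by (intro divide_right_mono mult_left_mono) auto
      moreover have "norm (reg_zeta s - ?f N s) \<le> C * (norm (s - 1) * norm s) / sqrt (real (Suc N))"
        by (rule C(2)) (use s d in auto)
      ultimately show "dist (?f N s) (reg_zeta s) < e" using N by (simp add: dist_norm norm_minus_commute)
    qed
  qed
  then show "\<exists>d>0. cball z d \<subseteq> {s. 7 / 8 < Re s} \<and> uniform_limit (cball z d) ?f reg_zeta sequentially"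
    using d by blast
qed

text \<open>For Re s > 1 the boundary term N^(1-s) also tends to 0, which identifies
  \<open>reg_zeta\<close> with (s - 1) zeta(s) there.\<close>

lemma reg_zeta_sums:
  assumes "Re s > 1"
  shows "(\<lambda>N. (s - 1) * (\<Sum>n\<in>{1..<N}. of_nat n powr (- s))) \<longlonglongrightarrow> reg_zeta s"
proof -
  obtain C where C: "C \<ge> 0" "\<And>s N. Re s \<ge> 7/8 \<Longrightarrow> N \<ge> 1 \<Longrightarrow>
    norm (reg_zeta s - ((s - 1) * (\<Sum>n\<in>{1..<N}. of_nat n powr (- s)) + of_nat N powr (1 - s)))
      \<le> C * (norm (s - 1) * norm s) / sqrt (real N)"
    using reg_zeta_approx by blast
  have "(\<lambda>N. reg_zeta s - (s - 1) * (\<Sum>n\<in>{1..<N}. of_nat n powr (- s))) \<longlonglongrightarrow> 0"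
  proof (rule Lim_null_comparison)
    have "norm (reg_zeta s - (s - 1) * (\<Sum>n\<in>{1..<N}. of_nat n powr (- s)))
      \<le> C * (norm (s - 1) * norm s) / sqrt (real N) + real N powr (1 - Re s)" if "N \<ge> 1" for N
    proof -
      have "norm (of_nat N powr (1 - s)) = real N powr (1 - Re s)"
        using norm_powr_real_powr[of "complex_of_real (real N)" "1 - s"] by simp
      then show ?thesis
        using C(2)[of s N] assms that
          norm_triangle_ineq[of "reg_zeta s - ((s - 1) * (\<Sum>n\<in>{1..<N}. of_nat n powr (- s)) + of_nat N powr (1 - s))" "of_nat N powr (1 - s)"]
        by (simp add: algebra_simps)
    qed
    then show "\<forall>\<^sub>F N in sequentially. norm (reg_zeta s - (s - 1) * (\<Sum>n\<in>{1..<N}. of_nat n powr (- s)))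
      \<le> C * (norm (s - 1) * norm s) / sqrt (real N) + real N powr (1 - Re s)"
      by (intro eventually_sequentiallyI[of 1])
    have "(\<lambda>N. C * (norm (s - 1) * norm s) / sqrt (real N)) \<longlonglongrightarrow> 0" by real_asymp
    moreover have "(\<lambda>N. real N powr (1 - Re s)) \<longlonglongrightarrow> 0"
      using assms by (intro tendsto_neg_powr filterlim_real_sequentially) auto
    ultimately show "(\<lambda>N. C * (norm (s - 1) * norm s) / sqrt (real N) + real N powr (1 - Re s)) \<longlonglongrightarrow> 0"
      using tendsto_add by fastforce
  qed
  from tendsto_diff[OF tendsto_const this, of "reg_zeta s"] show ?thesis by simp
qed

section \<open>Growth of the regularized zeta function\<close>

lemma norm_sum_cis_log_block_le:
  fixes t :: real and N b :: nat
  assumes N: "N \<ge> 1" "sqrt \<bar>t\<bar> \<le> real N" and t: "t \<noteq> 0" and b: "b \<le> 2 * N"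
  shows "norm (\<Sum>n\<in>{N..<b}. cis (t * ln (real n))) \<le> 200 * (sqrt \<bar>t\<bar> + real N / sqrt \<bar>t\<bar>)"
proof (cases "t > 0")
  case True
  then show ?thesis using exponential_sum_log_block[OF N(1) _ True b] N(2) by simp
next
  case False
  have "(\<Sum>n\<in>{N..<b}. cis (t * ln (real n))) = cnj (\<Sum>n\<in>{N..<b}. cis (\<bar>t\<bar> * ln (real n)))"
    using False by (simp add: cis_cnj)
  then have "norm (\<Sum>n\<in>{N..<b}. cis (t * ln (real n))) = norm (\<Sum>n\<in>{N..<b}. cis (\<bar>t\<bar> * ln (real n)))"
    by (simp only: complex_mod_cnj)
  then show ?thesis using exponential_sum_log_block[OF N _ b] t by simp
qed

lemma of_nat_powr_eq_cis:
  assumes "n \<ge> 1"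
  shows "of_nat n powr (- s) = complex_of_real (real n powr (- Re s)) * cis (- Im s * ln (real n))"
proof -
  have "of_nat n powr (- s) = exp (- s * complex_of_real (ln (real n)))"
    using assms Ln_of_real[of "real n"] by (simp add: powr_def)
  also have "\<dots> = complex_of_real (exp (- Re s * ln (real n))) * cis (- Im s * ln (real n))"
    by (simp add: exp_eq_polar)
  finally show ?thesis using assms by (simp add: powr_def)
qed

lemma norm_of_nat_powr_complex: "norm (of_nat n powr s :: complex) = real n powr Re s"
  using norm_powr_real_powr[of "complex_of_real (real n)" s] by simp

text \<open>The summand is the decreasing weight n^(- Re s) times a pure phase, so partial summation
  reduces the block to the exponential sum and costs only the weight at its left end.\<close>

lemma norm_powr_sum_block_le:
  assumes M: "M \<ge> 1" "sqrt \<bar>Im s\<bar> \<le> real M" and s: "Im s \<noteq> 0" "Re s \<ge> 0"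
  shows "norm (\<Sum>n\<in>{M..<2 * M}. of_nat n powr (- s) :: complex)
    \<le> real M powr (- Re s) * (200 * (sqrt \<bar>Im s\<bar> + real M / sqrt \<bar>Im s\<bar>))"
proof -
  have "(\<Sum>n\<in>{M..<2 * M}. of_nat n powr (- s)) =
      (\<Sum>n\<in>{M..<2 * M}. of_real (real n powr (- Re s)) * cis (- Im s * ln (real n)))"
    using M(1) by (intro sum.cong of_nat_powr_eq_cis) auto
  also have "norm \<dots> \<le> real M powr (- Re s) * (200 * (sqrt \<bar>Im s\<bar> + real M / sqrt \<bar>Im s\<bar>))"
  proof (rule abel_summation_bound)
    show "real (Suc n) powr (- Re s) \<le> real n powr (- Re s)" if "M \<le> n" for n
      using that M(1) s by (intro powr_mono2') auto
    show "norm (\<Sum>n\<in>{M..<m}. cis (- Im s * ln (real n))) \<le> 200 * (sqrt \<bar>Im s\<bar> + real M / sqrt \<bar>Im s\<bar>)"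
      if "m \<le> 2 * M" for m
      using norm_sum_cis_log_block_le[of M "- Im s" m] M s that by simp
  qed auto
  finally show ?thesis .
qed

lemma sum_inverse_nat_le: "N \<ge> 1 \<Longrightarrow> (\<Sum>n\<in>{1..N}. 1 / real n) \<le> 1 + ln (real N)"
proof (induction N rule: dec_induct)
  case (step N)
  have "ln (real N / real (Suc N)) \<le> real N / real (Suc N) - 1"
    using step by (intro ln_le_minus_one) auto
  also have "\<dots> = - (1 / real (Suc N))" by (simp add: field_simps)
  finally have "1 / real (Suc N) \<le> ln (real (Suc N)) - ln (real N)"
    using step by (simp add: ln_divide_pos)
  then show ?case using step by simp
qed simp

lemma dyadic_sum:
  fixes f :: "nat \<Rightarrow> 'a::comm_monoid_add"
  assumes "A \<ge> 1"
  shows "(\<Sum>n\<in>{1..<A * 2 ^ J}. f n) = (\<Sum>n\<in>{1..<A}. f n) + (\<Sum>j<J. \<Sum>n\<in>{A * 2 ^ j..<2 * (A * 2 ^ j)}. f n)"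
proof (induction J)
  case (Suc J)
  have "(\<Sum>n\<in>{1..<A * 2 ^ Suc J}. f n) = (\<Sum>n\<in>{1..<A * 2 ^ J}. f n) + (\<Sum>n\<in>{A * 2 ^ J..<2 * (A * 2 ^ J)}. f n)"
    using assms by (subst sum.atLeastLessThan_concat) (auto simp: Suc_le_eq mult_ac)
  then show ?case using Suc by (simp add: add.assoc)
qed simp

text \<open>The exponential sum estimate starts at length sqrt t. Below that cut the terms are at
  most A^\<beta> / n, and the harmonic sum gives t^(\<beta>/2) times a logarithm. A dyadic block at
  M contributes M^(\<beta>-1) sqrt t, at most t^(\<beta>/2) because M \<ge> sqrt t, and M^\<beta> /
  sqrt t, bounded because M \<le> N. The number of blocks is O(1 + ln t). The lower bound on
  \<open>N\<close> controls the truncation error, the upper bound on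
  \<open>real N powr \<beta>\<close> the boundary term.\<close>

lemma power_sum_left_of_one:
  fixes s :: complex
  defines "t \<equiv> \<bar>Im s\<bar>" and "\<beta> \<equiv> 1 - Re s"
  assumes beta: "0 \<le> \<beta>" "\<beta> \<le> 1/8" and t: "t \<ge> 1"
  obtains N where "N \<ge> 1" "t\<^sup>2 \<le> real N" "real N powr \<beta> \<le> 2 * t"
    "norm (\<Sum>n\<in>{1..<N}. of_nat n powr (- s) :: complex) \<le> 4000 * (t powr (\<beta> / 2) * (1 + ln t))"
proof -
  define A where "A = nat \<lceil>sqrt t\<rceil>"
  define J where "J = nat \<lceil>2 * log 2 t\<rceil>"
  have st: "sqrt t \<ge> 1" using t by simp
  have A: "sqrt t \<le> real A" "real A \<le> 2 * sqrt t" "A \<ge> 1"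
    using st unfolding A_def by linarith+
  have log0: "log 2 t \<ge> 0" using t by simp
  have J: "2 * log 2 t \<le> real J" "real J \<le> 2 * log 2 t + 1"
    using log0 unfolding J_def by linarith+
  have two: "2 powr (2 * log 2 t) = t\<^sup>2"
    using t by (simp add: powr_powr[symmetric] mult.commute[of 2] powr_numeral)
  have pJ: "t\<^sup>2 \<le> 2 ^ J" "(2::real) ^ J \<le> 2 * t\<^sup>2"
  proof -
    have "2 powr (2 * log 2 t) \<le> 2 powr real J" using J by (intro powr_mono) auto
    then show "t\<^sup>2 \<le> 2 ^ J" unfolding two by (simp add: powr_realpow)
    have "2 powr real J \<le> 2 powr (2 * log 2 t + 1)" using J by (intro powr_mono) auto
    then show "(2::real) ^ J \<le> 2 * t\<^sup>2" unfolding powr_add two by (simp add: powr_realpow)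
  qed
  define N where "N = A * 2 ^ J"
  have lnt: "ln t \<ge> 0" using t by simp
  have tb: "t powr (\<beta> / 2) \<ge> 1" using t beta by (intro ge_one_powr_ge_zero) auto
  have sqrtt: "sqrt t = t powr (1/2)" using t by (simp add: powr_half_sqrt)
  \<comment> \<open>The quantity \<open>4 * t powr (5/2)\<close> bounds \<open>N\<close> from above.
    With \<beta> \<le> 1/8 the exponent of \<open>t\<close> is at most 5/16, well below 1/2.\<close>
  have powr_le: "(4 * t powr (5/2)) powr \<beta> \<le> 2 * sqrt t"
  proof -
    have "(4 * t powr (5/2)) powr \<beta> = 4 powr \<beta> * t powr (5/2 * \<beta>)"
      using t by (simp add: powr_mult powr_powr)
    also have "\<dots> \<le> 4 powr (1/2) * t powr (1/2)"
      using t beta by (intro mult_mono powr_mono) auto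
    also have "(4::real) powr (1/2) = 2" by (simp add: powr_half_sqrt)
    finally show ?thesis by (simp add: sqrtt)
  qed
  have M_le: "real M powr \<beta> \<le> 2 * sqrt t" if "M \<le> N" for M
  proof -
    have "real N = real A * 2 ^ J" by (simp add: N_def)
    also have "\<dots> \<le> (2 * sqrt t) * (2 * t\<^sup>2)" using A pJ st by (intro mult_mono) auto
    also have "\<dots> = 4 * t powr (5/2)"
    proof -
      have "sqrt t * t\<^sup>2 = t powr (1/2) * t powr 2" using t by (simp add: sqrtt powr_numeral)
      also have "\<dots> = t powr (5/2)" by (simp add: powr_add[symmetric])
      finally show ?thesis by simp
    qed
    finally have "real M \<le> 4 * t powr (5/2)" using that by linarith
    then have "real M powr \<beta> \<le> (4 * t powr (5/2)) powr \<beta>" using beta by (intro powr_mono2) auto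
    then show ?thesis using powr_le by linarith
  qed
  have sqrt_half: "sqrt t powr \<beta> = t powr (\<beta> / 2)" by (simp add: sqrtt powr_powr)
  have head: "norm (\<Sum>n\<in>{1..<A}. of_nat n powr (- s) :: complex) \<le> 2 * t powr (\<beta> / 2) * (2 + ln t)"
  proof -
    have "norm (\<Sum>n\<in>{1..<A}. of_nat n powr (- s) :: complex) \<le> (\<Sum>n\<in>{1..<A}. real A powr \<beta> * (1 / real n))"
    proof (intro order_trans[OF norm_sum] sum_mono)
      fix n assume n: "n \<in> {1..<A}"
      have "norm (of_nat n powr (- s) :: complex) = real n powr (\<beta> - 1)"
        by (simp add: norm_of_nat_powr_complex \<beta>_def)
      also have "\<dots> = real n powr \<beta> * (1 / real n)" using n by (simp add: powr_diff)
      also have "\<dots> \<le> real A powr \<beta> * (1 / real n)" using n beta by (intro mult_right_mono powr_mono2) auto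
      finally show "norm (of_nat n powr (- s) :: complex) \<le> real A powr \<beta> * (1 / real n)" .
    qed
    also have "\<dots> \<le> (\<Sum>n\<in>{1..A}. real A powr \<beta> * (1 / real n))" by (intro sum_mono2) auto
    also have "\<dots> = real A powr \<beta> * (\<Sum>n\<in>{1..A}. 1 / real n)" by (simp add: sum_distrib_left)
    also have "\<dots> \<le> (2 * t powr (\<beta> / 2)) * (1 + ln (real A))"
    proof (intro mult_mono sum_inverse_nat_le A(3))
      have "real A powr \<beta> \<le> (2 * sqrt t) powr \<beta>" using A beta by (intro powr_mono2) auto
      also have "\<dots> = 2 powr \<beta> * t powr (\<beta> / 2)" using st by (simp add: powr_mult sqrt_half)
      also have "\<dots> \<le> 2 powr 1 * t powr (\<beta> / 2)" using beta by (intro mult_right_mono powr_mono) auto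
      finally show "real A powr \<beta> \<le> 2 * t powr (\<beta> / 2)" by simp
    qed (auto intro!: sum_nonneg)
    also have "\<dots> \<le> (2 * t powr (\<beta> / 2)) * (2 + ln t)"
    proof (rule mult_left_mono)
      have "ln (real A) \<le> ln (2 * sqrt t)" using A st by (intro ln_mono) linarith+
      also have "\<dots> = ln 2 + ln t / 2" using t by (simp add: ln_mult ln_sqrt)
      also have "\<dots> \<le> 1 + ln t" using lnt ln_2_less_1 by linarith
      finally show "1 + ln (real A) \<le> 2 + ln t" by linarith
    qed simp
    finally show ?thesis .
  qed
  have block: "norm (\<Sum>n\<in>{M..<2 * M}. of_nat n powr (- s) :: complex) \<le> 600 * t powr (\<beta> / 2)"
    if M: "sqrt t \<le> real M" "M \<le> N" for M
  proof -
    have M0: "real M > 0" "M \<ge> 1" using M(1) st by linarith+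
    have "norm (\<Sum>n\<in>{M..<2 * M}. of_nat n powr (- s) :: complex)
        \<le> real M powr (- Re s) * (200 * (sqrt t + real M / sqrt t))"
      unfolding t_def using M0 M t beta by (intro norm_powr_sum_block_le) (auto simp: t_def \<beta>_def)
    also have "\<dots> = 200 * (real M powr (\<beta> - 1) * sqrt t + real M powr \<beta> / sqrt t)"
    proof -
      have "real M powr (- Re s) * real M = real M powr \<beta>"
        using M0 powr_add[of "real M" "- Re s" 1] by (simp add: \<beta>_def)
      then show ?thesis by (simp add: \<beta>_def algebra_simps)
    qed
    also have "\<dots> \<le> 200 * (t powr (\<beta> / 2) + 2)"
    proof (intro mult_left_mono add_mono)
      have "real M powr (\<beta> - 1) \<le> sqrt t powr (\<beta> - 1)" using M(1) st beta by (intro powr_mono2') auto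
      then have "real M powr (\<beta> - 1) * sqrt t \<le> sqrt t powr (\<beta> - 1) * sqrt t" using st by (intro mult_right_mono) auto
      also have "\<dots> = sqrt t powr \<beta>" using st powr_add[of "sqrt t" "\<beta> - 1" 1] by simp
      finally show "real M powr (\<beta> - 1) * sqrt t \<le> t powr (\<beta> / 2)" by (simp add: sqrt_half)
      show "real M powr \<beta> / sqrt t \<le> 2" using M_le[OF M(2)] st by (simp add: pos_divide_le_eq)
    qed auto
    also have "\<dots> \<le> 600 * t powr (\<beta> / 2)" using tb by (simp add: distrib_left)
    finally show ?thesis .
  qed
  show ?thesis
  proof (rule that[of N])
    show "N \<ge> 1" using A by (simp add: N_def)
    have "1 * t\<^sup>2 \<le> real A * 2 ^ J" using A(3) pJ by (intro mult_mono) auto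
    then show "t\<^sup>2 \<le> real N" by (simp add: N_def)
    have "sqrt t \<le> t" using st mult_right_mono[of 1 "sqrt t" "sqrt t"] t by simp
    then show "real N powr \<beta> \<le> 2 * t" using M_le[of N] by simp
    have "norm (\<Sum>n\<in>{1..<N}. of_nat n powr (- s) :: complex) \<le>
      2 * t powr (\<beta> / 2) * (2 + ln t) + (\<Sum>j<J. 600 * t powr (\<beta> / 2))"
      unfolding N_def dyadic_sum[OF A(3)]
    proof (rule order_trans[OF norm_triangle_ineq], rule add_mono[OF head],
        rule order_trans[OF norm_sum], rule sum_mono)
      fix j assume "j \<in> {..<J}"
      then have "A * 2 ^ j \<le> N" by (simp add: N_def)
      moreover have "real A * 1 \<le> real A * 2 ^ j" by (intro mult_left_mono) auto
      ultimately show "norm (\<Sum>n\<in>{A * 2 ^ j..<2 * (A * 2 ^ j)}. of_nat n powr (- s) :: complex) \<le> 600 * t powr (\<beta> / 2)"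
        using A(1) by (intro block) auto
    qed
    also have "\<dots> = t powr (\<beta> / 2) * (4 + 2 * ln t + 600 * real J)" by (simp add: algebra_simps)
    also have "\<dots> \<le> t powr (\<beta> / 2) * (4000 * (1 + ln t))"
    proof (rule mult_left_mono)
      have "log 2 t \<le> 2 * ln t"
      proof -
        have "ln t * 1 \<le> ln t * (2 * ln 2)"
          using lnt ln2_ge_two_thirds by (intro mult_left_mono) auto
        then show ?thesis by (simp add: log_def field_simps)
      qed
      then have "real J \<le> 4 * ln t + 1" using J by linarith
      then show "4 + 2 * ln t + 600 * real J \<le> 4000 * (1 + ln t)"
        using lnt by (simp add: distrib_left)
    qed simp
    also have "\<dots> = 4000 * (t powr (\<beta> / 2) * (1 + ln t))" by (rule mult.left_commute)
    finally show "norm (\<Sum>n\<in>{1..<N}. of_nat n powr (- s) :: complex) \<le> 4000 * (t powr (\<beta> / 2) * (1 + ln t))" .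
  qed
qed


text \<open>Three ranges, in each of which \<open>N\<close> brings the truncation error T^2 / sqrt N
  down to O(T). For Re w \<ge> 0 the terms are at most 1 / n, and N about T^2 gives a logarithm. For
  Re w < 0 and |Im w| < 1 the quantity T stays below 3, so N = 1 with an empty sum suffices.
  Otherwise T and t = |Im w| are comparable and \<open>power_sum_left_of_one\<close>
  applies.\<close>

lemma reg_zeta_log_bound:
  obtains C where "C > 0" and "\<And>w. Re w \<ge> - 1/8 \<Longrightarrow>
    norm (reg_zeta (1 + w)) \<le> C * ((norm w + 1) powr (1 - 1 / 2 * min 0 (Re w)) * (1 + ln (norm w + 1)))"
proof -
  obtain C where C: "C \<ge> 0" "\<And>s N. Re s \<ge> 7/8 \<Longrightarrow> N \<ge> 1 \<Longrightarrow>
    norm (reg_zeta s - ((s - 1) * (\<Sum>n\<in>{1..<N}. of_nat n powr (- s)) + of_nat N powr (1 - s)))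
      \<le> C * (norm (s - 1) * norm s) / sqrt (real N)"
    using reg_zeta_approx by blast
  define K where "K = 9000 + 40 * C"
  show ?thesis
  proof (rule that[of K])
    show "K > 0" using C(1) by (simp add: K_def)
    fix w :: complex assume w: "Re w \<ge> - 1/8"
    define T where "T = norm w + 1"
    define a where "a = - min 0 (Re w)"
    define P where "P = T powr (1 + a / 2)"
    define s where "s = 1 + w"
    have T: "T \<ge> 1" "norm w \<le> T" by (auto simp: T_def)
    have a: "a \<ge> 0" "a \<le> 1/8" using w by (auto simp: a_def)
    have lnT: "ln T \<ge> 0" using T by simp
    have PT: "T \<le> P" using T a powr_mono[of 1 "1 + a / 2" T] by (simp add: P_def)
    have PL: "x \<le> x * (1 + ln T)" if "x \<ge> 0" for x using that lnT by (simp add: distrib_left)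
    have s1: "s - 1 = w" by (simp add: s_def)
    have ns: "norm s \<le> T" unfolding s_def T_def using norm_triangle_ineq[of 1 w] by simp
    have Cs: "C * (norm (s - 1) * norm s) \<le> C * (T * T)"
      unfolding s1 using T ns C(1) by (intro mult_left_mono mult_mono) auto
    have approx: "norm (reg_zeta s) \<le> norm w * norm (\<Sum>n\<in>{1..<N}. of_nat n powr (- s) :: complex)
        + real N powr (- Re w) + C * (T * T) / sqrt (real N)" if "N \<ge> 1" for N
    proof -
      let ?S = "\<Sum>n\<in>{1..<N}. of_nat n powr (- s) :: complex"
      have "norm (reg_zeta s) \<le> norm (w * ?S + of_nat N powr (- w))
          + norm (reg_zeta s - (w * ?S + of_nat N powr (- w)))"
        using norm_triangle_ineq[of "w * ?S + of_nat N powr (- w)" "reg_zeta s - (w * ?S + of_nat N powr (- w))"] by simp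
      also have "norm (w * ?S + of_nat N powr (- w)) \<le> norm w * norm ?S + real N powr (- Re w)"
        using norm_triangle_ineq[of "w * ?S" "of_nat N powr (- w)"]
        by (simp add: norm_mult norm_of_nat_powr_complex)
      also have "norm (reg_zeta s - (w * ?S + of_nat N powr (- w))) \<le> C * (norm (s - 1) * norm s) / sqrt (real N)"
        using C(2)[of s N] w that by (simp add: s_def)
      also have "\<dots> \<le> C * (T * T) / sqrt (real N)" by (intro divide_right_mono Cs) auto
      finally show ?thesis by simp
    qed
    have "norm (reg_zeta s) \<le> K * (P * (1 + ln T))"
    proof (cases "Re w \<ge> 0")
      case True
      define N where "N = nat \<lceil>T\<^sup>2\<rceil>"
      have T2: "T\<^sup>2 \<ge> 1" using T by simp
      have N: "T\<^sup>2 \<le> real N" "real N \<le> 2 * T\<^sup>2" "N \<ge> 1"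
        using T2 unfolding N_def by linarith+
      have "norm (\<Sum>n\<in>{1..<N}. of_nat n powr (- s) :: complex) \<le> (\<Sum>n\<in>{1..<N}. 1 / real n)"
      proof (intro order_trans[OF norm_sum] sum_mono)
        fix n assume n: "n \<in> {1..<N}"
        have "norm (of_nat n powr (- s) :: complex) \<le> real n powr (- 1)"
          unfolding norm_of_nat_powr_complex using n True by (intro powr_mono) (auto simp: s_def)
        then show "norm (of_nat n powr (- s) :: complex) \<le> 1 / real n" by (simp add: powr_minus field_simps)
      qed
      also have "\<dots> \<le> (\<Sum>n\<in>{1..N}. 1 / real n)" by (intro sum_mono2) auto
      also have "\<dots> \<le> 1 + ln (real N)" by (rule sum_inverse_nat_le[OF N(3)])
      also have "\<dots> \<le> 1 + ln (2 * T\<^sup>2)" using N T by simp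
      also have "\<dots> \<le> 2 + 2 * ln T" using T ln_2_less_1 by (simp add: ln_mult ln_realpow)
      finally have S: "norm (\<Sum>n\<in>{1..<N}. of_nat n powr (- s) :: complex) \<le> 2 + 2 * ln T" .
      have "real N powr (- Re w) \<le> 1" using N(3) True powr_mono[of "- Re w" 0 "real N"] by simp
      moreover have "T \<le> sqrt (real N)" using N(1) T by (intro real_le_rsqrt)
      then have "C * (T * T) / sqrt (real N) \<le> C * (T * T) / T"
        using C(1) T N(3) by (intro divide_left_mono) auto
      then have "C * (T * T) / sqrt (real N) \<le> C * T" using T by simp
      moreover have "norm w * norm (\<Sum>n\<in>{1..<N}. of_nat n powr (- s) :: complex) \<le> T * (2 + 2 * ln T)"
        using T S lnT by (intro mult_mono) auto
      ultimately have "norm (reg_zeta s) \<le> T * (2 + 2 * ln T) + 1 + C * T" using approx[OF N(3)] by linarith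
      also have "\<dots> \<le> 2 * (T * (1 + ln T)) + T * (1 + ln T) + C * (T * (1 + ln T))"
      proof (intro add_mono mult_left_mono)
        show "T * (2 + 2 * ln T) \<le> 2 * (T * (1 + ln T))" by (simp add: algebra_simps)
        show "1 \<le> T * (1 + ln T)" using PL[of T] T by linarith
      qed (use PL[of T] T C(1) in auto)
      also have "\<dots> = (3 + C) * (T * (1 + ln T))" by (simp add: algebra_simps)
      also have "\<dots> \<le> K * (P * (1 + ln T))"
        using PT lnT C(1) T by (intro mult_mono) (auto simp: K_def)
      finally show ?thesis .
    next
      case left: False
      then have aw: "a = - Re w" by (simp add: a_def)
      define t where "t = \<bar>Im w\<bar>"
      have Tt: "T \<le> 2 + t" using cmod_le[of w] w left by (simp add: T_def t_def)
      show ?thesis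
      proof (cases "t \<ge> 1")
        case False
        then have "T * T \<le> 3 * T" using Tt T by (intro mult_right_mono) auto
        then have "C * (T * T) \<le> C * (3 * T)" using C(1) by (intro mult_left_mono)
        then have "norm (reg_zeta s) \<le> 1 + 3 * C * T" using approx[of 1] by simp
        also have "\<dots> \<le> T + 3 * C * T" using T by simp
        also have "\<dots> = (1 + 3 * C) * T" by (simp add: algebra_simps)
        also have "\<dots> \<le> (1 + 3 * C) * (T * (1 + ln T))" using PL[of T] T C(1) by (intro mult_left_mono) auto
        also have "\<dots> \<le> K * (P * (1 + ln T))"
          using PT lnT C(1) T by (intro mult_mono) (auto simp: K_def)
        finally show ?thesis .
      next
        case True
        have "t \<le> norm w" unfolding t_def by (rule abs_Im_le_cmod)
        then have tT: "t \<le> T" "T \<le> 3 * t" using Tt True T by auto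
        have Im_s: "\<bar>Im s\<bar> = t" "1 - Re s = a" using aw by (auto simp: s_def t_def)
        obtain N where N: "N \<ge> 1" "t\<^sup>2 \<le> real N" "real N powr a \<le> 2 * t"
          "norm (\<Sum>n\<in>{1..<N}. of_nat n powr (- s) :: complex) \<le> 4000 * (t powr (a / 2) * (1 + ln t))"
          using power_sum_left_of_one[of s] unfolding Im_s using a True by metis
        have "t \<le> sqrt (real N)" using N(2) True by (intro real_le_rsqrt)
        then have "C * (T * T) / sqrt (real N) \<le> C * (T * T) / t"
          using C(1) True N(1) by (intro divide_left_mono) auto
        also have "\<dots> \<le> C * (T * (3 * t)) / t" using tT C(1) T True by (intro divide_right_mono mult_left_mono) auto
        also have "\<dots> = 3 * C * T" using True by simp
        finally have tail: "C * (T * T) / sqrt (real N) \<le> 3 * C * T" .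
        have main: "norm w * norm (\<Sum>n\<in>{1..<N}. of_nat n powr (- s) :: complex) \<le> 4000 * (P * (1 + ln T))"
        proof -
          have "norm w * norm (\<Sum>n\<in>{1..<N}. of_nat n powr (- s) :: complex) \<le> T * (4000 * (T powr (a / 2) * (1 + ln T)))"
          proof (intro mult_mono order_trans[OF N(4)] mult_left_mono)
            show "t powr (a / 2) \<le> T powr (a / 2)" using tT True a by (intro powr_mono2) auto
            show "1 + ln t \<le> 1 + ln T" using tT True T by simp
          qed (use T lnT True in auto)
          also have "\<dots> = 4000 * ((T * T powr (a / 2)) * (1 + ln T))" by (simp add: mult_ac)
          also have "T * T powr (a / 2) = P" using T by (simp add: P_def powr_add)
          finally show ?thesis .
        qed
        have "norm (reg_zeta s) \<le> 4000 * (P * (1 + ln T)) + 2 * T + 3 * C * T"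
          using approx[OF N(1)] main tail N(3) tT(1) unfolding aw by linarith
        also have "\<dots> \<le> 4000 * (P * (1 + ln T)) + 2 * (P * (1 + ln T)) + 3 * C * (P * (1 + ln T))"
        proof -
          have "T \<le> P * (1 + ln T)" using PL[of P] PT T by linarith
          then show ?thesis using C(1) PT T by (intro add_mono mult_left_mono) auto
        qed
        also have "\<dots> = (4002 + 3 * C) * (P * (1 + ln T))" by (simp add: algebra_simps)
        also have "\<dots> \<le> K * (P * (1 + ln T))"
          using PT lnT C(1) T by (intro mult_right_mono) (auto simp: K_def)
        finally show ?thesis .
      qed
    qed
    then show "norm (reg_zeta (1 + w)) \<le> K * ((norm w + 1) powr (1 - 1 / 2 * min 0 (Re w)) * (1 + ln (norm w + 1)))"
      by (simp add: P_def T_def a_def s_def)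
  qed
qed

theorem reg_zeta_convexity_bound:
  assumes "\<epsilon> > 0"
  obtains K where "K > 0" and "\<And>w. Re w \<ge> - 1/8 \<Longrightarrow>
    norm (reg_zeta (1 + w)) \<le> K * (norm w + 1) powr (1 - 1 / 2 * min 0 (Re w) + \<epsilon>)"
proof -
  obtain C where C: "C > 0" "\<And>w. Re w \<ge> - 1/8 \<Longrightarrow>
    norm (reg_zeta (1 + w)) \<le> C * ((norm w + 1) powr (1 - 1 / 2 * min 0 (Re w)) * (1 + ln (norm w + 1)))"
    using reg_zeta_log_bound by blast
  show ?thesis
  proof (rule that[of "C * (1 + 1 / \<epsilon>)"])
    show "C * (1 + 1 / \<epsilon>) > 0" using C(1) assms by (simp add: add_pos_pos)
    fix w :: complex assume w: "Re w \<ge> - 1/8"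
    define T where "T = norm w + 1"
    have T: "T \<ge> 1" by (simp add: T_def)
    have "1 + ln T \<le> T powr \<epsilon> + T powr \<epsilon> / \<epsilon>"
      using ln_powr_bound[OF T assms] ge_one_powr_ge_zero[of T \<epsilon>] T assms by (intro add_mono) auto
    then have "1 + ln T \<le> (1 + 1 / \<epsilon>) * T powr \<epsilon>" by (simp add: algebra_simps)
    then have "C * (T powr (1 - 1 / 2 * min 0 (Re w)) * (1 + ln T))
        \<le> C * (T powr (1 - 1 / 2 * min 0 (Re w)) * ((1 + 1 / \<epsilon>) * T powr \<epsilon>))"
      using C(1) by (intro mult_left_mono) auto
    also have "\<dots> = C * (1 + 1 / \<epsilon>) * T powr (1 - 1 / 2 * min 0 (Re w) + \<epsilon>)"
      unfolding powr_add by (simp add: mult_ac)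
    finally show "norm (reg_zeta (1 + w)) \<le> C * (1 + 1 / \<epsilon>) * (norm w + 1) powr (1 - 1 / 2 * min 0 (Re w) + \<epsilon>)"
      using C(2)[OF w] by (simp add: T_def)
  qed
qed

section \<open>Euler products\<close>

text \<open>The strict bound makes the step from \<open>p\<close> to \<open>Suc p\<close> adjoin
  exactly the prime \<open>p\<close>, and leaves only the tuple \<open>1\<close> at the start of the
  induction.\<close>

definition smooth_tuples :: "nat \<Rightarrow> (nat ^ 'n) set" where
  "smooth_tuples N = {m \<in> pos_tuples. \<forall>i p. prime p \<longrightarrow> p dvd m $ i \<longrightarrow> p < N}"

lemma prime_pow_in_pos_tuples: "p > 0 \<Longrightarrow> prime_pow p \<nu> \<in> pos_tuples"
  by (simp add: prime_pow_def pos_tuples_def Suc_le_eq)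

lemma smooth_tuples_subset: "smooth_tuples N \<subseteq> pos_tuples"
  by (auto simp: smooth_tuples_def)

lemma smooth_tuples_mono:
  assumes "M \<le> N"
  shows "smooth_tuples M \<subseteq> smooth_tuples N"
proof
  fix m :: "nat ^ 'n" assume m: "m \<in> smooth_tuples M"
  then have "p < N" if "prime p" "p dvd m $ i" for p i
    using that assms less_le_trans[of p M N] by (simp add: smooth_tuples_def)
  then show "m \<in> smooth_tuples N" using m by (simp add: smooth_tuples_def)
qed

lemma smooth_tuples_0: "smooth_tuples 0 = {1 :: nat ^ 'n}"
proof -
  have "m = 1" if m: "m \<in> smooth_tuples 0" for m :: "nat ^ 'n"
  proof -
    have "m $ i = 1" for i
    proof (rule ccontr)
      assume "m $ i \<noteq> 1"
      then obtain p where "prime p" "p dvd m $ i" using prime_factor_nat by blast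
      then show False using m by (simp add: smooth_tuples_def)
    qed
    then show ?thesis by (simp add: vec_eq_iff)
  qed
  moreover have "(1 :: nat ^ 'n) \<in> smooth_tuples 0"
    by (auto simp: smooth_tuples_def pos_tuples_def)
  ultimately show ?thesis by blast
qed

lemma smooth_tuples_Suc_nonprime: "\<not> prime N \<Longrightarrow> smooth_tuples (Suc N) = smooth_tuples N"
  by (auto simp: smooth_tuples_def less_Suc_eq)

text \<open>Unique factorization, entry by entry: the inverse splits off the full power of
  \<open>p\<close> from each entry.\<close>

lemma bij_betw_smooth_tuples_Suc:
  assumes p: "prime p"
  shows "bij_betw (\<lambda>(m, \<nu>). \<chi> i. m $ i * prime_pow p \<nu> $ i)
    (smooth_tuples p \<times> UNIV) (smooth_tuples (Suc p) :: (nat ^ 'n) set)"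
proof (rule bij_betwI[where g = "\<lambda>m. (\<chi> i. m $ i div p ^ multiplicity p (m $ i), \<chi> i. multiplicity p (m $ i))"])
  show "(\<lambda>(m, \<nu>). \<chi> i. m $ i * prime_pow p \<nu> $ i) \<in> smooth_tuples p \<times> UNIV \<rightarrow> (smooth_tuples (Suc p) :: (nat ^ 'n) set)"
    (is "?f \<in> _")
  proof (rule Pi_I)
    fix x :: "(nat ^ 'n) \<times> (nat ^ 'n)" assume "x \<in> smooth_tuples p \<times> UNIV"
    then obtain m \<nu> where x: "x = (m, \<nu>)" and m: "m \<in> smooth_tuples p" by auto
    have "q < Suc p" if q: "prime q" "q dvd m $ i * p ^ (\<nu> $ i)" for q i
    proof -
      from q have "q dvd m $ i \<or> q dvd p" using prime_dvd_mult_iff prime_dvd_power by blast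
      then show ?thesis
      proof
        assume "q dvd m $ i"
        then show ?thesis using m q(1) by (auto simp: smooth_tuples_def intro: less_SucI)
      next
        assume "q dvd p"
        then show ?thesis using primes_dvd_imp_eq[OF q(1) p] by simp
      qed
    qed
    moreover have "m $ i * p ^ (\<nu> $ i) \<ge> 1" for i
      using m p prime_gt_0_nat[OF p] by (simp add: smooth_tuples_def pos_tuples_def Suc_le_eq)
    ultimately show "?f x \<in> smooth_tuples (Suc p)"
      by (auto simp: x smooth_tuples_def pos_tuples_def prime_pow_def)
  qed
  show "(\<lambda>m. (\<chi> i. m $ i div p ^ multiplicity p (m $ i), \<chi> i. multiplicity p (m $ i)))
    \<in> (smooth_tuples (Suc p) :: (nat ^ 'n) set) \<rightarrow> smooth_tuples p \<times> UNIV" (is "?g \<in> _")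
  proof (rule Pi_I)
    fix m :: "nat ^ 'n" assume m: "m \<in> smooth_tuples (Suc p)"
    have m0: "m $ i > 0" for i using m by (auto simp: smooth_tuples_def pos_tuples_def Suc_le_eq)
    have pow: "m $ i = p ^ multiplicity p (m $ i) * (m $ i div p ^ multiplicity p (m $ i))" for i
      by (simp add: multiplicity_dvd)
    have nd: "\<not> p dvd m $ i div p ^ multiplicity p (m $ i)" for i
      using multiplicity_decompose[of "m $ i" p] m0[of i] p prime_gt_1_nat[OF p] by simp
    have "q < p" if q: "prime q" "q dvd m $ i div p ^ multiplicity p (m $ i)" for q i
    proof -
      have "q dvd m $ i" using q(2) pow[of i] by (metis dvd_mult)
      then have "q < Suc p" using m q(1) by (auto simp: smooth_tuples_def)
      moreover have "q \<noteq> p" using q nd by blast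
      ultimately show ?thesis by simp
    qed
    moreover have "m $ i div p ^ multiplicity p (m $ i) \<ge> 1" for i
      using pow[of i] m0[of i] by (metis One_nat_def Suc_leI bot_nat_0.not_eq_extremum mult_0_right)
    ultimately have "(\<chi> i. m $ i div p ^ multiplicity p (m $ i)) \<in> smooth_tuples p"
      by (auto simp: smooth_tuples_def pos_tuples_def)
    then show "?g m \<in> smooth_tuples p \<times> UNIV" by simp
  qed
  fix x :: "(nat ^ 'n) \<times> (nat ^ 'n)" assume "x \<in> smooth_tuples p \<times> UNIV"
  then obtain m \<nu> where x: "x = (m, \<nu>)" and m: "m \<in> smooth_tuples p" by auto
  have "m $ i > 0" "\<not> p dvd m $ i" for i
    using m p by (auto simp: smooth_tuples_def pos_tuples_def Suc_le_eq)
  then have "multiplicity p (m $ i * p ^ (\<nu> $ i)) = \<nu> $ i" for i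
    using p prime_gt_0_nat[OF p] by (subst prime_elem_multiplicity_mult_distrib)
      (auto simp: not_dvd_imp_multiplicity_0 prime_elem_multiplicity_power_distrib prime_imp_prime_elem
         multiplicity_same_power not_prime_unit)
  then show "(\<lambda>m. (\<chi> i. m $ i div p ^ multiplicity p (m $ i), \<chi> i. multiplicity p (m $ i)))
      ((\<lambda>(m, \<nu>). \<chi> i. m $ i * prime_pow p \<nu> $ i) x) = x"
    using prime_gt_0_nat[OF p] by (simp add: x prime_pow_def vec_eq_iff)
next
  fix m :: "nat ^ 'n"
  show "(\<lambda>(m, \<nu>). \<chi> i. m $ i * prime_pow p \<nu> $ i)
      (\<chi> i. m $ i div p ^ multiplicity p (m $ i), \<chi> i. multiplicity p (m $ i)) = m"
    by (simp add: prime_pow_def vec_eq_iff multiplicity_dvd)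
qed

text \<open>Each \<open>Lcm\<close> divides the product of its entries, and these two products are
  coprime because \<open>p\<close> divides no entry of \<open>m\<close>.\<close>

lemma multiplicative_multi_prime_pow:
  fixes h :: "nat ^ 'n \<Rightarrow> 'a::times"
  assumes h: "multiplicative_multi h" and p: "prime p" and m: "m \<in> smooth_tuples p"
  shows "h (\<chi> i. m $ i * prime_pow p \<nu> $ i) = h m * h (prime_pow p \<nu>)"
proof -
  let ?P = "prime_pow p \<nu>"
  have "Lcm (range (\<lambda>i. m $ i)) dvd (\<Prod>i\<in>UNIV. m $ i)" by (rule Lcm_least) auto
  moreover have "Lcm (range (\<lambda>i. ?P $ i)) dvd (\<Prod>i\<in>UNIV. ?P $ i)" by (rule Lcm_least) auto
  moreover have "coprime (m $ i) (p ^ k)" for i k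
    using m p by (auto simp: smooth_tuples_def coprime_commute intro: prime_imp_coprime)
  then have "coprime (\<Prod>i\<in>UNIV. m $ i) (\<Prod>i\<in>UNIV. ?P $ i)"
    by (intro prod_coprime_left prod_coprime_right) (simp add: prime_pow_def)
  ultimately have "coprime (Lcm (range (\<lambda>i. m $ i))) (Lcm (range (\<lambda>i. ?P $ i)))"
    by (rule coprime_divisors)
  then show ?thesis
    using h m prime_pow_in_pos_tuples[of p \<nu>] prime_gt_0_nat[OF p] smooth_tuples_subset
    unfolding multiplicative_multi_def by (auto simp: coprime_iff_gcd_eq_1)
qed

lemma multiplicative_multi_norm:
  fixes h :: "nat ^ 'n \<Rightarrow> 'a::real_normed_field"
  shows "multiplicative_multi h \<Longrightarrow> multiplicative_multi (\<lambda>m. norm (h m))"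
  unfolding multiplicative_multi_def by (metis norm_mult)

text \<open>At a prime the bijection turns the sum into a double sum, which factors by Fubini.
  Fubini needs absolute summability, so this is carried along in the same induction.\<close>

lemma smooth_euler_product:
  fixes h :: "nat ^ 'n \<Rightarrow> 'a::{real_normed_field,banach}"
  assumes h: "multiplicative_multi h" "h 1 = 1"
    and summ: "\<And>p. prime p \<Longrightarrow> (\<lambda>\<nu>. norm (h (prime_pow p \<nu>))) summable_on UNIV"
  shows "(\<lambda>m. norm (h m)) summable_on smooth_tuples N \<and>
    infsum h (smooth_tuples N) = (\<Prod>p | p < N \<and> prime p. \<Sum>\<^sub>\<infinity>\<nu>\<in>UNIV. h (prime_pow p \<nu>))"
proof (induction N)
  case 0
  then show ?case using h(2) by (simp add: smooth_tuples_0)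
next
  case (Suc p)
  show ?case
  proof (cases "prime p")
    case False
    then have "{q. q < Suc p \<and> prime q} = {q. q < p \<and> prime q}" by (auto simp: less_Suc_eq)
    then show ?thesis using Suc False by (simp add: smooth_tuples_Suc_nonprime)
  next
    case True
    let ?g = "\<lambda>(m, \<nu>). (\<chi> i. m $ i * prime_pow p \<nu> $ i) :: nat ^ 'n"
    note bij = bij_betw_smooth_tuples_Suc[OF True, where 'n = 'n]
    have hg: "h (?g x) = h (fst x) * h (prime_pow p (snd x))" if "x \<in> smooth_tuples p \<times> UNIV" for x
      using that multiplicative_multi_prime_pow[OF h(1) True] by auto
    have s1: "(\<lambda>x. norm (h (fst x) * h (prime_pow p (snd x)))) summable_on (smooth_tuples p \<times> UNIV)"
    proof (rule summable_on_SigmaI[where g = "\<lambda>m. norm (h m) * (\<Sum>\<^sub>\<infinity>\<nu>\<in>UNIV. norm (h (prime_pow p \<nu>)))"])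
      fix m :: "nat ^ 'n" assume "m \<in> smooth_tuples p"
      show "((\<lambda>\<nu>. norm (h (fst (m, \<nu>)) * h (prime_pow p (snd (m, \<nu>))))) has_sum
          norm (h m) * (\<Sum>\<^sub>\<infinity>\<nu>\<in>UNIV. norm (h (prime_pow p \<nu>)))) UNIV"
        unfolding norm_mult fst_conv snd_conv
        by (intro has_sum_cmult_right has_sum_infsum summ True)
    next
      show "(\<lambda>m. norm (h m) * (\<Sum>\<^sub>\<infinity>\<nu>\<in>UNIV. norm (h (prime_pow p \<nu>)))) summable_on smooth_tuples p"
        using Suc by (intro summable_on_cmult_left) auto
    qed auto
    have "(\<lambda>x. norm (h (?g x))) summable_on (smooth_tuples p \<times> UNIV)"
      using s1 hg by (subst summable_on_cong[where g = "\<lambda>x. norm (h (fst x) * h (prime_pow p (snd x)))"]) auto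
    then have 1: "(\<lambda>m. norm (h m)) summable_on smooth_tuples (Suc p)"
      using summable_on_reindex_bij_betw[OF bij, of "\<lambda>m. norm (h m)"] by simp
    have "infsum h (smooth_tuples (Suc p)) = infsum (\<lambda>x. h (?g x)) (smooth_tuples p \<times> UNIV)"
      using infsum_reindex_bij_betw[OF bij, of h] by simp
    also have "\<dots> = infsum (\<lambda>x. h (fst x) * h (prime_pow p (snd x))) (smooth_tuples p \<times> UNIV)"
      by (rule infsum_cong) (rule hg)
    also have "\<dots> = infsum (\<lambda>m. infsum (\<lambda>\<nu>. h m * h (prime_pow p \<nu>)) UNIV) (smooth_tuples p)"
      using infsum_Sigma_banach[OF abs_summable_summable[OF s1]] by simp
    also have "\<dots> = infsum h (smooth_tuples p) * infsum (\<lambda>\<nu>. h (prime_pow p \<nu>)) UNIV"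
      by (simp add: infsum_cmult_right' infsum_cmult_left')
    also have "\<dots> = (\<Prod>q | q < Suc p \<and> prime q. \<Sum>\<^sub>\<infinity>\<nu>\<in>UNIV. h (prime_pow q \<nu>))"
    proof -
      have "{q. q < Suc p \<and> prime q} = insert p {q. q < p \<and> prime q}" using True by auto
      then show ?thesis using Suc by (simp add: mult.commute)
    qed
    finally show ?thesis using 1 by blast
  qed
qed

lemma finite_subset_smooth_tuples:
  fixes X :: "(nat ^ 'n) set"
  assumes "finite X" "X \<subseteq> pos_tuples"
  obtains N where "X \<subseteq> smooth_tuples N"
proof
  show "X \<subseteq> smooth_tuples (Suc (\<Sum>m\<in>X. \<Sum>i\<in>UNIV. m $ i))"
  proof
    fix m assume m: "m \<in> X"
    have "p < Suc (\<Sum>m\<in>X. \<Sum>i\<in>UNIV. m $ i)" if "p dvd m $ i" for p i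
    proof -
      have "m $ i > 0" using m assms(2) by (auto simp: pos_tuples_def Suc_le_eq)
      then have "p \<le> m $ i" using that by (rule dvd_imp_le[rotated])
      also have "\<dots> \<le> (\<Sum>i\<in>UNIV. m $ i)" by (rule member_le_sum) auto
      also have "\<dots> \<le> (\<Sum>m\<in>X. \<Sum>i\<in>UNIV. m $ i)"
        using m assms(1) member_le_sum[of m X "\<lambda>m :: nat ^ 'n. \<Sum>i\<in>UNIV. m $ i"] by simp
      finally show ?thesis by simp
    qed
    then show "m \<in> smooth_tuples (Suc (\<Sum>m\<in>X. \<Sum>i\<in>UNIV. m $ i))"
      using m assms(2) by (auto simp: smooth_tuples_def)
  qed
qed

text \<open>For the norms the finite Euler products are at most the exponential of the sum of
  \<open>b\<close>. Every finite set of tuples is smooth for some bound, so all finite partial sums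
  are bounded as well; the limit follows because the smooth tuples exhaust
  \<open>pos_tuples\<close>. The majorant \<open>b\<close> runs over all naturals, so that an
  ordinary series dominates the sums over primes.\<close>

theorem euler_product_multi:
  fixes h :: "nat ^ 'n \<Rightarrow> 'a::{real_normed_field,banach}"
  assumes h: "multiplicative_multi h" "h 1 = 1"
    and summ: "\<And>p. prime p \<Longrightarrow> (\<lambda>\<nu>. norm (h (prime_pow p \<nu>))) summable_on UNIV"
    and b: "summable b" "\<And>p. b p \<ge> 0"
      "\<And>p. prime p \<Longrightarrow> (\<Sum>\<^sub>\<infinity>\<nu>\<in>UNIV. norm (h (prime_pow p \<nu>))) \<le> 1 + b p"
  shows "(\<lambda>m. norm (h m)) summable_on pos_tuples"
    and "(\<lambda>N. \<Prod>p | p < N \<and> prime p. \<Sum>\<^sub>\<infinity>\<nu>\<in>UNIV. h (prime_pow p \<nu>)) \<longlonglongrightarrow> infsum h pos_tuples"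
proof -
  have norm_h: "multiplicative_multi (\<lambda>m. norm (h m))" "norm (h 1) = 1"
    using h multiplicative_multi_norm by auto
  have sm: "(\<lambda>m. norm (h m)) summable_on smooth_tuples N" for N
    using smooth_euler_product[OF h summ] by blast
  have bound: "infsum (\<lambda>m. norm (h m)) (smooth_tuples N) \<le> exp (suminf b)" for N
  proof -
    have "infsum (\<lambda>m. norm (h m)) (smooth_tuples N) =
      (\<Prod>p | p < N \<and> prime p. \<Sum>\<^sub>\<infinity>\<nu>\<in>UNIV. norm (h (prime_pow p \<nu>)))"
      using smooth_euler_product[OF norm_h] summ by simp
    also have "\<dots> \<le> (\<Prod>p | p < N \<and> prime p. exp (b p))"
    proof (intro prod_mono conjI)
      fix p assume "p \<in> {p. p < N \<and> prime p}"
      then have "prime p" by simp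
      from order_trans[OF b(3)[OF this] exp_ge_add_one_self]
      show "(\<Sum>\<^sub>\<infinity>\<nu>\<in>UNIV. norm (h (prime_pow p \<nu>))) \<le> exp (b p)" .
    qed (auto intro: infsum_nonneg)
    also have "\<dots> = exp (\<Sum>p | p < N \<and> prime p. b p)" by (simp add: exp_sum)
    also have "\<dots> \<le> exp (suminf b)" using b by (simp add: sum_le_suminf)
    finally show ?thesis .
  qed
  show abs: "(\<lambda>m. norm (h m)) summable_on pos_tuples"
  proof (rule nonneg_bdd_above_summable_on)
    show "bdd_above (sum (\<lambda>m. norm (h m)) ` {F. F \<subseteq> pos_tuples \<and> finite F})"
    proof (rule bdd_aboveI2)
      fix F :: "(nat ^ 'n) set" assume F: "F \<in> {F. F \<subseteq> pos_tuples \<and> finite F}"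
      then obtain N where "F \<subseteq> smooth_tuples N" using finite_subset_smooth_tuples[of F] by auto
      then have "(\<Sum>m\<in>F. norm (h m)) \<le> infsum (\<lambda>m. norm (h m)) (smooth_tuples N)"
        using F by (intro finite_sum_le_infsum sm) auto
      then show "(\<Sum>m\<in>F. norm (h m)) \<le> exp (suminf b)" using bound[of N] by linarith
    qed
  qed simp
  have "(\<lambda>N. infsum h (smooth_tuples N)) \<longlonglongrightarrow> infsum h pos_tuples"
  proof (rule LIMSEQ_I)
    fix e :: real assume e: "e > 0"
    define S where "S = infsum (\<lambda>m. norm (h m)) pos_tuples"
    have "(sum (\<lambda>m. norm (h m)) \<longlongrightarrow> S) (finite_subsets_at_top pos_tuples)"
      using has_sum_infsum[OF abs] by (simp add: has_sum_def S_def)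
    then have "\<forall>\<^sub>F X in finite_subsets_at_top pos_tuples. dist (\<Sum>m\<in>X. norm (h m)) S < e"
      using e by (rule tendstoD)
    then obtain X where X: "finite X" "X \<subseteq> pos_tuples" "dist (\<Sum>m\<in>X. norm (h m)) S < e"
      by (auto simp: eventually_finite_subsets_at_top)
    obtain N where N: "X \<subseteq> smooth_tuples N" using finite_subset_smooth_tuples[OF X(1,2)] .
    have "norm (infsum h (smooth_tuples M) - infsum h pos_tuples) < e" if "M \<ge> N" for M
    proof -
      have sub: "smooth_tuples M \<subseteq> (pos_tuples :: (nat ^ 'n) set)" by (rule smooth_tuples_subset)
      have XM: "X \<subseteq> smooth_tuples M" using N smooth_tuples_mono[OF that] by blast
      have absD: "(\<lambda>m. norm (h m)) summable_on (pos_tuples - smooth_tuples M)"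
        using abs by (rule summable_on_subset_banach) auto
      have "infsum h pos_tuples - infsum h (smooth_tuples M) = infsum h (pos_tuples - smooth_tuples M)"
        by (rule infsum_Diff[symmetric]) (use abs_summable_summable[OF abs] abs_summable_summable[OF sm] sub in auto)
      also have "norm \<dots> \<le> infsum (\<lambda>m. norm (h m)) (pos_tuples - smooth_tuples M)"
        by (rule norm_infsum_bound[OF absD])
      also have "\<dots> = S - infsum (\<lambda>m. norm (h m)) (smooth_tuples M)"
        unfolding S_def by (rule infsum_Diff) (use abs sm sub in auto)
      also have "\<dots> \<le> S - (\<Sum>m\<in>X. norm (h m))"
        using finite_sum_le_infsum[OF sm[of M] X(1) XM] by simp
      also have "\<dots> < e" using X(3) by (simp add: dist_norm)
      finally show ?thesis by (simp add: norm_minus_commute)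
    qed
    then show "\<exists>no. \<forall>M\<ge>no. norm (infsum h (smooth_tuples M) - infsum h pos_tuples) < e" by blast
  qed
  then show "(\<lambda>N. \<Prod>p | p < N \<and> prime p. \<Sum>\<^sub>\<infinity>\<nu>\<in>UNIV. h (prime_pow p \<nu>)) \<longlonglongrightarrow> infsum h pos_tuples"
    using smooth_euler_product[OF h summ] by simp
qed

section \<open>Sums over exponent vectors\<close>

lemma finite_norm1_le: "finite {\<nu> :: nat ^ 'n. norm1 \<nu> \<le> N}"
proof -
  have "{\<nu> :: nat ^ 'n. norm1 \<nu> \<le> N} \<subseteq> vec_lambda ` (UNIV \<rightarrow>\<^sub>E {..N})"
  proof
    fix \<nu> :: "nat ^ 'n" assume "\<nu> \<in> {\<nu>. norm1 \<nu> \<le> N}"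
    moreover have "\<nu> $ i \<le> norm1 \<nu>" for i unfolding norm1_def by (rule member_le_sum) auto
    ultimately have "\<nu> $ i \<le> N" for i using le_trans by blast
    then show "\<nu> \<in> vec_lambda ` (UNIV \<rightarrow>\<^sub>E {..N})"
      by (intro image_eqI[where x = "vec_nth \<nu>"]) (auto simp: PiE_iff)
  qed
  moreover have "finite (vec_lambda ` ((UNIV :: 'n set) \<rightarrow>\<^sub>E {..N}))"
    by (intro finite_imageI finite_PiE) auto
  ultimately show ?thesis by (rule finite_subset)
qed

lemma norm1_eq_0_iff: "norm1 \<nu> = 0 \<longleftrightarrow> \<nu> = 0"
  by (simp add: norm1_def vec_eq_iff)

text \<open>Turns an unordered limit over finite sets into a limit along a sequence, as the
  convergence theorem for holomorphic functions requires.\<close>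

lemma filterlim_norm1_le:
  "filterlim (\<lambda>N. {\<nu> :: nat ^ 'n. norm1 \<nu> \<le> N}) (finite_subsets_at_top UNIV) sequentially"
  unfolding filterlim_finite_subsets_at_top
proof (intro allI impI)
  fix X :: "(nat ^ 'n) set" assume X: "finite X \<and> X \<subseteq> UNIV"
  have "X \<subseteq> {\<nu>. norm1 \<nu> \<le> N}" if "N \<ge> (\<Sum>\<nu>\<in>X. norm1 \<nu>)" for N
    using X that member_le_sum[of _ X norm1] le_trans by fastforce
  then show "\<forall>\<^sub>F N in sequentially. finite {\<nu> :: nat ^ 'n. norm1 \<nu> \<le> N} \<and> X \<subseteq> {\<nu>. norm1 \<nu> \<le> N} \<and>
      {\<nu>. norm1 \<nu> \<le> N} \<subseteq> UNIV"
    by (intro eventually_sequentiallyI[of "\<Sum>\<nu>\<in>X. norm1 \<nu>"]) (auto simp: finite_norm1_le)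
qed

text \<open>The summand is a product of one geometric term per coordinate. A finite set lies in a
  cube, and over a cube the sum factors into truncated geometric series.\<close>

lemma summable_on_exp_norm1:
  assumes "\<epsilon> > 0"
  shows "(\<lambda>\<nu> :: nat ^ 'n. exp (- \<epsilon> * real (norm1 \<nu>))) summable_on UNIV"
proof (rule nonneg_bdd_above_summable_on)
  define x where "x = exp (- \<epsilon>)"
  have x: "0 < x" "x < 1" using assms by (auto simp: x_def)
  have eq: "exp (- \<epsilon> * real (norm1 \<nu>)) = (\<Prod>i\<in>UNIV. x ^ (\<nu> $ i))" for \<nu> :: "nat ^ 'n"
  proof -
    have "exp (- \<epsilon> * real (norm1 \<nu>)) = x ^ norm1 \<nu>"
      by (simp add: x_def exp_of_nat_mult[symmetric] mult.commute)
    also have "\<dots> = (\<Prod>i\<in>UNIV. x ^ (\<nu> $ i))" by (simp add: norm1_def power_sum)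
    finally show ?thesis .
  qed
  show "bdd_above (sum (\<lambda>\<nu> :: nat ^ 'n. exp (- \<epsilon> * real (norm1 \<nu>))) ` {F. F \<subseteq> UNIV \<and> finite F})"
  proof (rule bdd_aboveI2)
    fix F :: "(nat ^ 'n) set" assume F: "F \<in> {F. F \<subseteq> UNIV \<and> finite F}"
    define N where "N = (\<Sum>\<nu>\<in>F. norm1 \<nu>)"
    have le_N: "\<nu> $ i \<le> N" if "\<nu> \<in> F" for \<nu> i
    proof -
      have "\<nu> $ i \<le> norm1 \<nu>" unfolding norm1_def by (rule member_le_sum) auto
      also have "\<dots> \<le> N" unfolding N_def using F that by (intro member_le_sum) auto
      finally show ?thesis .
    qed
    let ?B = "PiE (UNIV :: 'n set) (\<lambda>_. {..N})"
    have inj: "inj_on vec_nth F" by (auto intro!: inj_onI simp: vec_nth_inject)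
    have "(\<Sum>\<nu>\<in>F. exp (- \<epsilon> * real (norm1 \<nu>))) = (\<Sum>k\<in>vec_nth ` F. \<Prod>i\<in>UNIV. x ^ k i)"
      unfolding eq by (simp add: sum.reindex[OF inj])
    also have "\<dots> \<le> (\<Sum>k\<in>?B. \<Prod>i\<in>UNIV. x ^ k i)"
    proof (rule sum_mono2)
      show "finite ?B" by (intro finite_PiE) auto
      show "vec_nth ` F \<subseteq> ?B" using le_N by auto
      show "0 \<le> (\<Prod>i\<in>UNIV. x ^ k i)" for k :: "'n \<Rightarrow> nat" using x by (intro prod_nonneg) auto
    qed
    also have "\<dots> = (\<Prod>i\<in>(UNIV :: 'n set). \<Sum>k\<in>{..N}. x ^ k)"
      by (rule prod_sum_PiE[symmetric]) auto
    also have "\<dots> \<le> (\<Prod>i\<in>(UNIV :: 'n set). 1 / (1 - x))"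
    proof (intro prod_mono conjI)
      show "(\<Sum>k\<in>{..N}. x ^ k) \<le> 1 / (1 - x)"
        using sum_le_suminf[of "\<lambda>k. x ^ k" "{..N}"] x by (simp add: suminf_geometric)
      show "0 \<le> (\<Sum>k\<in>{..N}. x ^ k)" using x by (intro sum_nonneg) auto
    qed
    finally show "(\<Sum>\<nu>\<in>F. exp (- \<epsilon> * real (norm1 \<nu>))) \<le> (\<Prod>i\<in>(UNIV :: 'n set). 1 / (1 - x))" .
  qed
qed simp

section \<open>First-order expansions with quadratic error\<close>

text \<open>The constant \<open>K\<close> is explicit so that products of expansions stay uniform.\<close>

definition expands :: "real \<Rightarrow> real \<Rightarrow> complex \<Rightarrow> complex \<Rightarrow> bool" where
  "expands X K A a \<longleftrightarrow> norm (A - 1 - a) \<le> K * X\<^sup>2 \<and> norm a \<le> K * X"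

text \<open>The linear parts add; every other term of the product contains two factors of size X or
  one of size X^2, and X \<le> 1 bounds what accompanies it.\<close>

lemma expands_mult:
  assumes X: "0 \<le> X" "X \<le> 1" and A: "expands X K A a" and B: "expands X L B b" and KL: "K \<ge> 0" "L \<ge> 0"
  shows "expands X (K * L + K * (1 + 2 * L) + L * (1 + K)) (A * B) (a + b)"
proof -
  define \<alpha> where "\<alpha> = A - 1 - a"
  define \<beta> where "\<beta> = B - 1 - b"
  have al: "norm \<alpha> \<le> K * X\<^sup>2" "norm a \<le> K * X" and be: "norm \<beta> \<le> L * X\<^sup>2" "norm b \<le> L * X"
    using A B by (auto simp: expands_def \<alpha>_def \<beta>_def)
  have X2: "X\<^sup>2 \<le> 1" using X by (simp add: power_le_one)
  have aK: "norm a \<le> K" and bL: "norm b \<le> L" and beL: "norm \<beta> \<le> L"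
    using al(2) be KL X X2 mult_left_mono[of X 1 K] mult_left_mono[of X 1 L] mult_left_mono[of "X\<^sup>2" 1 L]
    by auto
  have "A * B - 1 - (a + b) = a * b + \<alpha> * (1 + b + \<beta>) + \<beta> * (1 + a)"
    by (simp add: \<alpha>_def \<beta>_def algebra_simps)
  also have "norm \<dots> \<le> norm a * norm b + norm \<alpha> * norm (1 + b + \<beta>) + norm \<beta> * norm (1 + a)"
    by (metis (no_types) norm_mult norm_triangle_le add_mono norm_triangle_ineq order_refl)
  also have "\<dots> \<le> (K * X) * (L * X) + (K * X\<^sup>2) * (1 + 2 * L) + (L * X\<^sup>2) * (1 + K)"
  proof (intro add_mono mult_mono al be)
    show "norm (1 + b + \<beta>) \<le> 1 + 2 * L"
      using norm_triangle_ineq[of "1 + b" \<beta>] norm_triangle_ineq[of 1 b] bL beL by simp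
    show "norm (1 + a) \<le> 1 + K" using norm_triangle_ineq[of 1 a] aK by simp
  qed (use KL X in auto)
  also have "\<dots> = (K * L + K * (1 + 2 * L) + L * (1 + K)) * X\<^sup>2"
    by (simp add: power2_eq_square algebra_simps)
  finally have 1: "norm (A * B - 1 - (a + b)) \<le> (K * L + K * (1 + 2 * L) + L * (1 + K)) * X\<^sup>2" .
  have "norm (a + b) \<le> (K + L) * X"
    using norm_triangle_ineq[of a b] al(2) be(2) by (simp add: algebra_simps)
  also have "\<dots> \<le> (K * L + K * (1 + 2 * L) + L * (1 + K)) * X"
    using KL X by (intro mult_right_mono) (auto simp: algebra_simps)
  finally show ?thesis using 1 by (simp add: expands_def)
qed

text \<open>The new constant is quantified before \<open>X\<close>, \<open>A\<close> and
  \<open>a\<close>, because one constant has to serve all primes and all points of the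
  region.\<close>

lemma expands_power:
  assumes "K \<ge> 0"
  shows "\<exists>M\<ge>0. \<forall>X A a. 0 \<le> X \<longrightarrow> X \<le> 1 \<longrightarrow> expands X K A a \<longrightarrow> expands X M (A ^ n) (of_nat n * a)"
proof (induction n)
  case 0
  show ?case by (intro exI[of _ 0]) (auto simp: expands_def)
next
  case (Suc n)
  then obtain M where M: "M \<ge> 0"
    "\<And>X A a. 0 \<le> X \<Longrightarrow> X \<le> 1 \<Longrightarrow> expands X K A a \<Longrightarrow> expands X M (A ^ n) (of_nat n * a)" by blast
  show ?case
  proof (intro exI[of _ "K * M + K * (1 + 2 * M) + M * (1 + K)"] conjI allI impI)
    fix X A a assume *: "0 \<le> X" "X \<le> 1" "expands X K A a"
    from expands_mult[OF *(1,2,3) M(2)[OF *] assms M(1)]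
    show "expands X (K * M + K * (1 + 2 * M) + M * (1 + K)) (A ^ Suc n) (of_nat (Suc n) * a)"
      by (simp add: algebra_simps)
  qed (use assms M in auto)
qed

lemma expands_prod:
  assumes "finite I" "\<And>i. i \<in> I \<Longrightarrow> K i \<ge> 0"
  shows "\<exists>M\<ge>0. \<forall>X A a. 0 \<le> X \<longrightarrow> X \<le> 1 \<longrightarrow> (\<forall>i\<in>I. expands X (K i) (A i) (a i)) \<longrightarrow>
    expands X M (\<Prod>i\<in>I. A i) (\<Sum>i\<in>I. a i)"
  using assms
proof (induction I rule: finite_induct)
  case empty
  show ?case by (intro exI[of _ 0]) (auto simp: expands_def)
next
  case (insert j I)
  then obtain M where M: "M \<ge> 0" "\<And>X A a. 0 \<le> X \<Longrightarrow> X \<le> 1 \<Longrightarrow> (\<forall>i\<in>I. expands X (K i) (A i) (a i)) \<Longrightarrow>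
    expands X M (\<Prod>i\<in>I. A i) (\<Sum>i\<in>I. a i)" by auto
  have Kj: "K j \<ge> 0" using insert by simp
  show ?case
  proof (intro exI[of _ "K j * M + K j * (1 + 2 * M) + M * (1 + K j)"] conjI allI impI)
    fix X A a assume *: "0 \<le> X" "X \<le> 1" "\<forall>i\<in>insert j I. expands X (K i) (A i) (a i)"
    then have "expands X (K j) (A j) (a j)" "\<forall>i\<in>I. expands X (K i) (A i) (a i)" by auto
    from expands_mult[OF *(1,2) this(1) M(2)[OF *(1,2) this(2)] Kj M(1)]
    show "expands X (K j * M + K j * (1 + 2 * M) + M * (1 + K j)) (\<Prod>i\<in>insert j I. A i) (\<Sum>i\<in>insert j I. a i)"
      using insert by simp
  qed (use Kj M in auto)
qed

section \<open>Dirichlet terms at prime powers and the Euler product of zeta\<close>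

lemma of_nat_power_powr:
  assumes "p > 0"
  shows "(of_nat (p ^ k) :: complex) powr z = of_nat p powr (of_nat k * z)"
proof -
  have "ln (complex_of_real (real p ^ k)) = of_real (ln (real p ^ k))"
    using assms by (intro Ln_of_real) auto
  then have "ln (of_nat (p ^ k) :: complex) = of_nat k * of_real (ln (real p))"
    using assms by (simp add: ln_realpow)
  moreover have "ln (of_nat p :: complex) = of_real (ln (real p))"
    using assms Ln_of_real[of "real p"] by simp
  ultimately show ?thesis using assms by (simp add: powr_def mult_ac)
qed

lemma of_nat_mult_powr: "(of_nat (a * b) :: complex) powr z = of_nat a powr z * of_nat b powr z"
  by (simp add: powr_times_real)

lemma zeta_term_prime_pow:
  assumes "p > 0"
  shows "zeta_term f s (prime_pow p \<nu>) = of_real (f (prime_pow p \<nu>)) * of_nat p powr (- pairing \<nu> s)"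
proof -
  have "(\<Prod>i\<in>UNIV. (of_nat (prime_pow p \<nu> $ i) :: complex) powr (s $ i)) = (\<Prod>i\<in>UNIV. of_nat p powr (of_nat (\<nu> $ i) * s $ i))"
    using assms by (simp add: prime_pow_def of_nat_power_powr del: of_nat_power)
  also have "\<dots> = of_nat p powr pairing \<nu> s"
    using assms by (simp add: powr_def pairing_def exp_sum sum_distrib_right)
  finally show ?thesis by (simp add: zeta_term_def powr_minus_divide)
qed

lemma multiplicative_zeta_term:
  fixes f :: "nat ^ 'n \<Rightarrow> real"
  assumes "multiplicative_multi f"
  shows "multiplicative_multi (zeta_term f s)"
  unfolding multiplicative_multi_def
proof (intro ballI impI)
  fix m m' :: "nat ^ 'n"
  assume "m \<in> pos_tuples" "m' \<in> pos_tuples" "gcd (Lcm (range (($) m))) (Lcm (range (($) m'))) = 1"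
  then have "f (\<chi> i. m $ i * m' $ i) = f m * f m'"
    using assms unfolding multiplicative_multi_def by simp
  then show "zeta_term f s (\<chi> i. m $ i * m' $ i) = zeta_term f s m * zeta_term f s m'"
    by (simp add: zeta_term_def of_nat_mult_powr prod.distrib del: of_nat_mult)
qed

lemma bij_betw_vec_1: "bij_betw (\<lambda>k. \<chi> i. k) A {v :: 'a ^ 1. v $ 1 \<in> A}"
  by (rule bij_betwI[where g = "\<lambda>v. v $ 1"]) (auto simp: vec_eq_iff forall_1)

text \<open>The case of dimension one of \<open>euler_product_multi\<close>, with
  \<open>nat ^ 1\<close> identified with the naturals. The local sums are geometric, and 1 / (1 - x)
  \<le> 1 + 2x for x \<le> 1/2 supplies the majorant. The unordered sum is then compared with the
  ordered one in \<open>reg_zeta_sums\<close>.\<close>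

lemma reg_zeta_euler_product:
  assumes s: "Re s > 1"
  shows "(\<lambda>N. (s - 1) * (\<Prod>p | p < N \<and> prime p. inverse (1 - of_nat p powr (- s)))) \<longlonglongrightarrow> reg_zeta s"
proof -
  define h :: "nat ^ 1 \<Rightarrow> complex" where "h m = of_nat (m $ 1) powr (- s)" for m
  define h' :: "nat \<Rightarrow> complex" where "h' n = of_nat n powr (- s)" for n
  have mult: "multiplicative_multi h"
    unfolding multiplicative_multi_def h_def by (auto simp: of_nat_mult_powr simp del: of_nat_mult)
  have h1: "h 1 = 1" by (simp add: h_def)
  have norm_p: "norm (of_nat p powr (- s) :: complex) \<le> 1 / 2" "norm (of_nat p powr (- s) :: complex) \<le> real p powr (- Re s)"
    if "prime p" for p
  proof -
    have "real p powr (- Re s) \<le> real p powr (- 1)"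
      using s prime_gt_1_nat[OF that] by (intro powr_mono) auto
    also have "\<dots> \<le> 1 / 2" using prime_ge_2_nat[OF that] by (simp add: powr_minus_divide)
    finally show "norm (of_nat p powr (- s) :: complex) \<le> 1 / 2" by (simp add: norm_of_nat_powr_complex)
    show "norm (of_nat p powr (- s) :: complex) \<le> real p powr (- Re s)" by (simp add: norm_of_nat_powr_complex)
  qed
  have hp: "h (\<chi> i. p ^ k) = (of_nat p powr (- s)) ^ k" if "prime p" for p k
  proof -
    have "p > 0" using that by (rule prime_gt_0_nat)
    then show ?thesis
      unfolding h_def by (simp add: of_nat_power_powr powr_nat' powr_power mult.commute del: of_nat_power)
  qed
  have bij: "bij_betw (\<lambda>k. \<chi> i. k) UNIV (UNIV :: (nat ^ 1) set)"
    using bij_betw_vec_1[of "UNIV :: nat set"] by simp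
  have pp: "prime_pow p (\<chi> i. k) = (\<chi> i. p ^ k)" for p k by (simp add: prime_pow_def vec_eq_iff)
  have geo: "((\<lambda>k. x ^ k) has_sum 1 / (1 - x)) UNIV" if "norm x < 1" for x :: "'b::{real_normed_field,banach}"
    using that by (intro norm_summable_imp_has_sum) (auto simp: norm_power geometric_sums summable_geometric)
  have has1: "((\<lambda>\<nu>. norm (h (prime_pow p \<nu>))) has_sum 1 / (1 - norm (of_nat p powr (- s) :: complex))) UNIV"
    if "prime p" for p
  proof -
    have "((\<lambda>k. norm (h (prime_pow p (\<chi> i. k)))) has_sum 1 / (1 - norm (of_nat p powr (- s) :: complex))) UNIV"
      unfolding pp hp[OF that] norm_power using norm_p[OF that] by (intro geo) auto
    then show ?thesis using has_sum_reindex_bij_betw[OF bij, of "\<lambda>\<nu>. norm (h (prime_pow p \<nu>))"] by simp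
  qed
  have has2: "((\<lambda>\<nu>. h (prime_pow p \<nu>)) has_sum inverse (1 - of_nat p powr (- s))) UNIV" if "prime p" for p
  proof -
    have "((\<lambda>k. h (prime_pow p (\<chi> i. k))) has_sum 1 / (1 - of_nat p powr (- s))) UNIV"
      unfolding pp hp[OF that] using norm_p[OF that] by (intro geo) auto
    then show ?thesis using has_sum_reindex_bij_betw[OF bij, of "\<lambda>\<nu>. h (prime_pow p \<nu>)"]
      by (simp add: inverse_eq_divide)
  qed
  have summ: "summable (\<lambda>p. 2 * real p powr (- Re s))"
    using s by (intro summable_mult) (simp add: summable_real_powr_iff)
  have bd: "(\<Sum>\<^sub>\<infinity>\<nu>\<in>UNIV. norm (h (prime_pow p \<nu>))) \<le> 1 + 2 * real p powr (- Re s)" if "prime p" for p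
  proof -
    define x where "x = norm (of_nat p powr (- s) :: complex)"
    have x: "0 \<le> x" "x \<le> 1 / 2" "x \<le> real p powr (- Re s)" using norm_p[OF that] by (auto simp: x_def)
    have "1 / (1 - x) \<le> 1 + 2 * x"
    proof -
      have "x * (2 * x) \<le> x * 1" using x by (intro mult_left_mono) auto
      then show ?thesis using x by (simp add: pos_divide_le_eq algebra_simps)
    qed
    then show ?thesis using infsumI[OF has1[OF that]] x by (simp add: x_def)
  qed
  note euler = euler_product_multi[OF mult h1 _ summ _ bd]
  have abs: "(\<lambda>m. norm (h m)) summable_on pos_tuples"
    by (rule euler(1)) (use has1 in \<open>auto simp: summable_on_def\<close>)
  have "(\<lambda>N. \<Prod>p | p < N \<and> prime p. \<Sum>\<^sub>\<infinity>\<nu>\<in>UNIV. h (prime_pow p \<nu>)) \<longlonglongrightarrow> infsum h pos_tuples"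
    by (rule euler(2)) (use has1 in \<open>auto simp: summable_on_def\<close>)
  moreover have "(\<Sum>\<^sub>\<infinity>\<nu>\<in>UNIV. h (prime_pow p \<nu>)) = inverse (1 - of_nat p powr (- s))" if "prime p" for p
    using has2[OF that] by (rule infsumI)
  ultimately have lim1: "(\<lambda>N. \<Prod>p | p < N \<and> prime p. inverse (1 - of_nat p powr (- s))) \<longlonglongrightarrow> infsum h pos_tuples"
    by simp
  have "(h has_sum infsum h pos_tuples) pos_tuples"
    using abs_summable_summable[OF abs] by (rule has_sum_infsum)
  moreover have "pos_tuples = {v :: nat ^ 1. v $ 1 \<in> {1..}}"
    by (auto simp: pos_tuples_def forall_1)
  ultimately have "(h' has_sum infsum h pos_tuples) {1..}"
    using has_sum_reindex_bij_betw[OF bij_betw_vec_1[of "{1..}"], of h "infsum h pos_tuples"]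
    by (simp add: h_def h'_def[abs_def])
  moreover have "bij_betw Suc UNIV {1..}"
    by (rule bij_betwI[where g = "\<lambda>n. n - 1"]) auto
  ultimately have "((\<lambda>n. h' (Suc n)) has_sum infsum h pos_tuples) UNIV"
    by (simp add: has_sum_reindex_bij_betw)
  then have "(\<lambda>n. h' (Suc n)) sums infsum h pos_tuples" by (rule has_sum_imp_sums)
  then have "(\<lambda>N. \<Sum>n<N. h' (Suc n)) \<longlonglongrightarrow> infsum h pos_tuples" by (simp add: sums_def)
  moreover have "(\<Sum>n<N. h' (Suc n)) = (\<Sum>n\<in>{1..<Suc N}. h' n)" for N
    by (induction N) auto
  ultimately have "(\<lambda>N. \<Sum>n\<in>{1..<Suc N}. h' n) \<longlonglongrightarrow> infsum h pos_tuples" by simp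
  then have "(\<lambda>N. \<Sum>n\<in>{1..<N}. h' n) \<longlonglongrightarrow> infsum h pos_tuples"
    by (rule LIMSEQ_offset[where k = 1, simplified])
  then have "(\<lambda>N. (s - 1) * (\<Sum>n\<in>{1..<N}. h' n)) \<longlonglongrightarrow> (s - 1) * infsum h pos_tuples"
    by (intro tendsto_intros)
  then have "reg_zeta s = (s - 1) * infsum h pos_tuples"
    using reg_zeta_sums[OF s] LIMSEQ_unique unfolding h'_def by blast
  then show ?thesis using tendsto_mult[OF tendsto_const lim1] by simp
qed

section \<open>Continuation of the multiple zeta function\<close>

lemma powr_neg_tendsto_0:
  fixes a :: real assumes "a > 0"
  shows "(\<lambda>n. real n powr (- a)) \<longlonglongrightarrow> 0"
  using assms by (intro tendsto_neg_powr filterlim_real_sequentially) auto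

locale multi_zeta_class =
  fixes g :: "nat ^ 'n \<Rightarrow> nat" and \<kappa> :: "nat ^ 'n \<Rightarrow> real" and c :: "real ^ 'n" and \<delta> :: real
    and f :: "nat ^ 'n \<Rightarrow> real"
  assumes data: "is_data g \<kappa> c \<delta>" and f: "f \<in> mult_class g \<kappa> c \<delta>" and nonempty: "polar_set g \<kappa> \<noteq> {}"
begin

abbreviation "I \<equiv> polar_set g \<kappa>"

definition q :: real where "q = (INF \<nu>\<in>UNIV - {0}. \<kappa> \<nu> / real (norm1 \<nu>))"

lemma finite_I: "finite I"
  using finite_polar_set[OF data] .

lemma \<delta>_pos: "\<delta> > 0" and q_pos: "q > 0" and \<kappa>_0: "\<kappa> 0 = 0" and \<kappa>_cases: "\<kappa> \<nu> = 0 \<or> \<kappa> \<nu> \<ge> 1"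
  using data by (auto simp: is_data_def q_def)

lemma \<kappa>_ge_norm1: "q * real (norm1 \<nu>) \<le> \<kappa> \<nu>"
proof (cases "\<nu> = 0")
  case False
  have \<kappa>_nonneg: "\<kappa> \<mu> \<ge> 0" for \<mu> using \<kappa>_cases[of \<mu>] by auto
  have "bdd_below ((\<lambda>\<nu>. \<kappa> \<nu> / real (norm1 \<nu>)) ` (UNIV - {0}))"
    by (rule bdd_belowI[of _ 0]) (use \<kappa>_nonneg in auto)
  then have "q \<le> \<kappa> \<nu> / real (norm1 \<nu>)"
    unfolding q_def using False by (intro cINF_lower) auto
  moreover have "norm1 \<nu> > 0" using False norm1_eq_0_iff[of \<nu>] by auto
  ultimately show ?thesis by (simp add: field_simps)
qed (simp add: \<kappa>_0 norm1_def)

lemma \<kappa>_ge_1: "\<nu> \<noteq> 0 \<Longrightarrow> \<kappa> \<nu> \<ge> 1"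
proof (rule ccontr)
  assume "\<nu> \<noteq> 0" "\<not> \<kappa> \<nu> \<ge> 1"
  then have "\<kappa> \<nu> = 0" "norm1 \<nu> > 0" using \<kappa>_cases[of \<nu>] norm1_eq_0_iff[of \<nu>] by auto
  moreover from this have "q * real (norm1 \<nu>) > 0" using q_pos by (intro mult_pos_pos) auto
  ultimately show False using \<kappa>_ge_norm1[of \<nu>] by linarith
qed

text \<open>Linear growth leaves only finitely many \<nu> with \<kappa> \<nu> < 2, so the values
  above 1 cannot approach 1. The element 1 inserted into \<open>E\<close> keeps the minimum defined
  and at most 1, which covers the long \<nu>.\<close>

lemma \<kappa>_gap: "\<exists>\<eta>>0. \<forall>\<nu>. \<nu> \<noteq> 0 \<longrightarrow> \<kappa> \<nu> = 1 \<or> \<kappa> \<nu> \<ge> 1 + \<eta>"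
proof -
  define N where "N = nat \<lceil>2 / q\<rceil>"
  define E where "E = insert 1 ((\<lambda>\<nu>. \<kappa> \<nu> - 1) ` {\<nu>. norm1 \<nu> \<le> N \<and> \<kappa> \<nu> > 1})"
  have fin: "finite E"
    unfolding E_def using finite_norm1_le[of N] by (intro finite.insertI finite_imageI) (auto elim: finite_subset[rotated])
  have pos: "Min E > 0" using fin by (subst Min_gr_iff) (auto simp: E_def)
  have "\<kappa> \<nu> \<ge> 1 + Min E" if "\<nu> \<noteq> 0" "\<kappa> \<nu> \<noteq> 1" for \<nu>
  proof (cases "norm1 \<nu> \<le> N")
    case True
    then have "\<kappa> \<nu> - 1 \<in> E" using that \<kappa>_ge_1[OF that(1)] by (auto simp: E_def)
    then show ?thesis using Min_le[OF fin] by force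
  next
    case False
    then have "2 / q \<le> real (norm1 \<nu>)" unfolding N_def by linarith
    then have "2 \<le> q * real (norm1 \<nu>)" using q_pos by (simp add: field_simps)
    then have "\<kappa> \<nu> \<ge> 2" using \<kappa>_ge_norm1[of \<nu>] by linarith
    moreover have "Min E \<le> 1" using fin by (intro Min_le) (auto simp: E_def)
    ultimately show ?thesis by linarith
  qed
  then show ?thesis using pos by blast
qed

lemma f_mult: "multiplicative_multi f"
  and f_class: "\<epsilon> > 0 \<Longrightarrow> \<exists>K>0. \<forall>\<nu> p. prime p \<longrightarrow>
        \<bar>f (prime_pow p \<nu>) - real (g \<nu>) * real p powr (pairing \<nu> c - \<kappa> \<nu>)\<bar>
          \<le> K * (exp (\<epsilon> * real (norm1 \<nu>)) * real p powr (pairing \<nu> c - \<kappa> \<nu> - \<delta>))"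
  and g_subexp: "\<epsilon> > 0 \<Longrightarrow> \<exists>K>0. \<forall>\<nu>. real (g \<nu>) \<le> K * exp (\<epsilon> * real (norm1 \<nu>))"
  using f data by (auto simp: mult_class_def is_data_def subexponential_def)

lemma f_times_1: "m \<in> pos_tuples \<Longrightarrow> f m = f m * f 1"
proof -
  assume m: "m \<in> pos_tuples"
  have "(1 :: nat ^ 'n) \<in> pos_tuples" by (simp add: pos_tuples_def)
  moreover have "gcd (Lcm (range (\<lambda>i. m $ i))) (Lcm (range (\<lambda>i. (1 :: nat ^ 'n) $ i))) = 1"
    by simp
  moreover have "(\<chi> i. m $ i * (1 :: nat ^ 'n) $ i) = m" by (simp add: vec_eq_iff)
  ultimately show "f m = f m * f 1"
    using f_mult m unfolding multiplicative_multi_def by metis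
qed

text \<open>If \<open>f 1 = 0\<close> then \<open>f\<close> vanishes identically, and letting \<open>p\<close> tend to infinity in the
  defining estimate forces \<open>g \<nu> = 0\<close> for all \<open>\<nu>\<close>.\<close>

lemma f_1: "f 1 = 1"
proof -
  have "f 1 = f 1 * f 1" by (rule f_times_1) (simp add: pos_tuples_def)
  then have "f 1 = 0 \<or> f 1 = 1" by simp
  moreover have "f 1 \<noteq> 0"
  proof
    assume "f 1 = 0"
    then have f0: "f m = 0" if "m \<in> pos_tuples" for m using f_times_1[OF that] by simp
    obtain \<nu> where \<nu>: "\<nu> \<in> I" using nonempty by blast
    obtain K where K: "K > 0" "\<And>p. prime p \<Longrightarrow>
        \<bar>f (prime_pow p \<nu>) - real (g \<nu>) * real p powr (pairing \<nu> c - \<kappa> \<nu>)\<bar>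
          \<le> K * (exp (1 * real (norm1 \<nu>)) * real p powr (pairing \<nu> c - \<kappa> \<nu> - \<delta>))"
      using f_class[of 1] by auto
    define L where "L = K * exp (real (norm1 \<nu>))"
    have le: "real (g \<nu>) \<le> L * real p powr (- \<delta>)" if p: "prime p" for p
    proof -
      have p0: "real p > 0" using prime_gt_0_nat[OF p] by simp
      have "real (g \<nu>) * real p powr (pairing \<nu> c - \<kappa> \<nu>) \<le> L * real p powr (pairing \<nu> c - \<kappa> \<nu> - \<delta>)"
        using K(2)[OF p] f0[OF prime_pow_in_pos_tuples[OF prime_gt_0_nat[OF p]]] by (simp add: L_def mult_ac)
      also have "\<dots> = (L * real p powr (- \<delta>)) * real p powr (pairing \<nu> c - \<kappa> \<nu>)"
        by (simp add: powr_add[symmetric])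
      finally show ?thesis using p0 by simp
    qed
    have "(\<lambda>n. L * real n powr (- \<delta>)) \<longlonglongrightarrow> L * 0"
      by (intro tendsto_intros powr_neg_tendsto_0 \<delta>_pos)
    then have "\<forall>\<^sub>F n in sequentially. L * real n powr (- \<delta>) < 1"
      by (rule order_tendstoD) simp
    then obtain N where N: "\<And>n. n \<ge> N \<Longrightarrow> L * real n powr (- \<delta>) < 1"
      by (auto simp: eventually_at_top_linorder)
    obtain p where "prime p" "p > N" using bigger_prime by blast
    then have "real (g \<nu>) < 1" using le[of p] N[of p] by linarith
    then show False using \<nu> by (simp add: polar_set_def)
  qed
  ultimately show ?thesis by blast
qed

text \<open>\<open>\<kappa>\<close> takes no value strictly between \<open>1\<close> and \<open>1 + \<eta>\<close>. The choice \<open>2 \<tau> (1 + \<eta>) = \<eta> / 2\<close>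
  leaves the error exponent \<open>1 + \<eta> / 2\<close> after paying \<open>p powr (\<tau> \<kappa> \<nu>)\<close> for negative real parts
  and reserving \<open>p powr (- \<tau> \<kappa> \<nu>)\<close> for the summation over \<open>\<nu>\<close>.\<close>

definition \<eta> :: real where
  "\<eta> = min (1/2) (min \<delta> (SOME \<eta>. \<eta> > 0 \<and> (\<forall>\<nu>. \<nu> \<noteq> 0 \<longrightarrow> \<kappa> \<nu> = 1 \<or> \<kappa> \<nu> \<ge> 1 + \<eta>)))"

lemma \<eta>: "\<eta> > 0" "\<eta> \<le> 1/2" "\<eta> \<le> \<delta>" "\<nu> \<noteq> 0 \<Longrightarrow> \<kappa> \<nu> \<noteq> 1 \<Longrightarrow> \<kappa> \<nu> \<ge> 1 + \<eta>"
  using someI_ex[OF \<kappa>_gap] \<delta>_pos by (auto simp: \<eta>_def min_le_iff_disj)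

definition \<tau> :: real where "\<tau> = \<eta> / (4 * (1 + \<eta>))"

lemma \<tau>: "\<tau> > 0" "\<tau> < 1/8" "2 * \<tau> * (1 + \<eta>) = \<eta> / 2" "4 * \<tau> \<le> \<eta>"
proof -
  show "\<tau> > 0" using \<eta> by (simp add: \<tau>_def)
  have "\<tau> \<le> \<eta> / 4" unfolding \<tau>_def using \<eta> by (intro divide_left_mono) auto
  then show "4 * \<tau> \<le> \<eta>" by simp
  show "2 * \<tau> * (1 + \<eta>) = \<eta> / 2" using \<eta> by (simp add: \<tau>_def field_simps)
  show "\<tau> < 1/8" using \<eta> by (simp add: \<tau>_def field_simps)
qed

definition \<epsilon>\<^sub>0 :: real where "\<epsilon>\<^sub>0 = q * \<tau>"

lemma \<epsilon>\<^sub>0_pos: "\<epsilon>\<^sub>0 > 0" using q_pos \<tau> by (simp add: \<epsilon>\<^sub>0_def)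

abbreviation R :: "(complex ^ 'n) set" where "R \<equiv> right_region (\<chi> i. - \<epsilon>\<^sub>0)"

lemma open_right_region: "open (right_region a)" for a :: "real ^ 'n"
proof -
  have "right_region a = (\<Inter>i\<in>UNIV. {s. Re (s $ i) > a $ i})" by (auto simp: right_region_def)
  also have "open \<dots>"
    by (intro open_INT open_Collect_less continuous_intros ballI) auto
  finally show ?thesis .
qed

lemma Re_pairing: "Re (pairing \<nu> s) = (\<Sum>i\<in>UNIV. real (\<nu> $ i) * Re (s $ i))"
  by (simp add: pairing_def)

text \<open>The loss from negative real parts is at most
  \<open>\<epsilon>\<^sub>0 * norm1 \<nu>\<close>, which is \<open>\<tau> * q * norm1 \<nu>\<close>.
  Measuring it by \<open>\<kappa> \<nu>\<close> lets it be set against the decay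
  \<open>p powr (- \<kappa> \<nu>)\<close>, uniformly in \<nu>.\<close>

lemma Re_pairing_ge: "s \<in> R \<Longrightarrow> Re (pairing \<nu> s) \<ge> - \<tau> * \<kappa> \<nu>"
proof -
  assume s: "s \<in> R"
  have "- \<tau> * \<kappa> \<nu> \<le> - \<tau> * (q * real (norm1 \<nu>))"
    using \<tau> \<kappa>_ge_norm1[of \<nu>] by (intro mult_left_mono_neg) auto
  also have "\<dots> = (\<Sum>i\<in>UNIV. real (\<nu> $ i) * - \<epsilon>\<^sub>0)"
    by (simp add: norm1_def \<epsilon>\<^sub>0_def sum_negf sum_distrib_left mult_ac)
  also have "\<dots> \<le> Re (pairing \<nu> s)"
    unfolding Re_pairing using s by (intro sum_mono mult_left_mono) (auto simp: right_region_def less_imp_le)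
  finally show ?thesis .
qed

lemma I_nonzero: "\<nu> \<in> I \<Longrightarrow> \<nu> \<noteq> 0" and I_\<kappa>: "\<nu> \<in> I \<Longrightarrow> \<kappa> \<nu> = 1" and I_g: "\<nu> \<in> I \<Longrightarrow> g \<nu> > 0"
  using \<kappa>_0 by (auto simp: polar_set_def)

section \<open>Expansion of the Euler factors\<close>

text \<open>The term of the series for M(f; c + s) at \<open>prime_pow p \<nu>\<close>. Its exponent
  is kept as a constant plus \<open>pairing \<nu> s\<close>, the shape that
  \<open>holomorphic_multi_on_compose_pairing\<close> takes.\<close>

definition local_summand :: "nat \<Rightarrow> complex ^ 'n \<Rightarrow> nat ^ 'n \<Rightarrow> complex" where
  "local_summand p s \<nu> = of_real (f (prime_pow p \<nu>)) * of_nat p powr (- (of_real (pairing \<nu> c) + pairing \<nu> s))"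

text \<open>The main term of the class estimate, kept only where \<kappa> \<nu> = 1. At the origin
  the exact value \<open>f 1 = 1\<close> is used instead of \<open>g 0\<close>.\<close>

definition leading_summand :: "nat \<Rightarrow> complex ^ 'n \<Rightarrow> nat ^ 'n \<Rightarrow> complex" where
  "leading_summand p s \<nu> = (if \<nu> = 0 then 1 else if \<nu> \<in> I then of_nat (g \<nu>) * of_nat p powr (- 1 - pairing \<nu> s) else 0)"

text \<open>Half of the exponential rate of \<open>2 powr (- \<tau> * q * norm1 \<nu>)\<close>. The
  growth conditions on \<open>f\<close> and \<open>g\<close> are invoked with this value: the
  reserve at the smallest prime absorbs the growth and still leaves
  \<open>exp (- \<epsilon>\<^sub>1 * norm1 \<nu>)\<close> for summation.\<close>

definition \<epsilon>\<^sub>1 :: real where "\<epsilon>\<^sub>1 = \<tau> * q * ln 2 / 2"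

lemma \<epsilon>\<^sub>1_pos: "\<epsilon>\<^sub>1 > 0" using \<tau> q_pos by (simp add: \<epsilon>\<^sub>1_def)

lemma exp_growth_absorbed:
  assumes p: "p \<ge> 2"
  shows "exp (\<epsilon>\<^sub>1 * real (norm1 \<nu>)) * real p powr (- \<tau> * (q * real (norm1 \<nu>))) \<le> exp (- \<epsilon>\<^sub>1 * real (norm1 \<nu>))"
proof -
  have "real p powr (- \<tau> * (q * real (norm1 \<nu>))) \<le> 2 powr (- \<tau> * (q * real (norm1 \<nu>)))"
    using p \<tau> q_pos by (intro powr_mono2') auto
  also have "\<dots> = exp (- 2 * \<epsilon>\<^sub>1 * real (norm1 \<nu>))"
    by (simp add: powr_def \<epsilon>\<^sub>1_def mult_ac)
  finally have "exp (\<epsilon>\<^sub>1 * real (norm1 \<nu>)) * real p powr (- \<tau> * (q * real (norm1 \<nu>)))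
      \<le> exp (\<epsilon>\<^sub>1 * real (norm1 \<nu>)) * exp (- 2 * \<epsilon>\<^sub>1 * real (norm1 \<nu>))"
    by (intro mult_left_mono) auto
  also have "\<dots> = exp (- \<epsilon>\<^sub>1 * real (norm1 \<nu>))" by (simp add: exp_add[symmetric])
  finally show ?thesis .
qed

text \<open>At \<nu> = 0 the remainder vanishes. For \<kappa> \<nu> = 1 the main term cancels and
  the class estimate gains p^(-\<delta>); 4 \<tau> \<le> \<eta> \<le> \<delta> leaves room for the
  loss \<tau> and the reserve \<tau>. Otherwise \<kappa> \<nu> \<ge> 1 + \<eta> and the whole term
  is error: loss and reserve take 2 \<tau> \<kappa> \<nu>, and (1 - 2 \<tau>) (1 + \<eta>) = 1 +
  \<eta>/2.\<close>

lemma local_remainder: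
  obtains K where "K \<ge> 0" "\<And>p s \<nu>. prime p \<Longrightarrow> s \<in> R \<Longrightarrow>
    norm (local_summand p s \<nu> - leading_summand p s \<nu>) \<le> K * exp (- \<epsilon>\<^sub>1 * real (norm1 \<nu>)) * real p powr (- (1 + \<eta> / 2))"
proof -
  obtain K1 where K1: "K1 > 0" "\<And>\<nu> p. prime p \<Longrightarrow>
        \<bar>f (prime_pow p \<nu>) - real (g \<nu>) * real p powr (pairing \<nu> c - \<kappa> \<nu>)\<bar>
          \<le> K1 * (exp (\<epsilon>\<^sub>1 * real (norm1 \<nu>)) * real p powr (pairing \<nu> c - \<kappa> \<nu> - \<delta>))"
    using f_class[OF \<epsilon>\<^sub>1_pos] by auto
  obtain K2 where K2: "K2 > 0" "\<And>\<nu>. real (g \<nu>) \<le> K2 * exp (\<epsilon>\<^sub>1 * real (norm1 \<nu>))"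
    using g_subexp[OF \<epsilon>\<^sub>1_pos] by auto
  show ?thesis
  proof (rule that[of "K1 + K2"])
    fix p :: nat and s :: "complex ^ 'n" and \<nu> :: "nat ^ 'n"
    assume p: "prime p" and s: "s \<in> R"
    define E where "E = exp (\<epsilon>\<^sub>1 * real (norm1 \<nu>))"
    define m where "m = real (norm1 \<nu>)"
    have p2: "p \<ge> 2" and p1: "real p \<ge> 1" and p0: "real p > 0"
      using prime_ge_2_nat[OF p] by auto
    have E: "E > 0" by (simp add: E_def)
    let ?z = "of_nat p powr (- (of_real (pairing \<nu> c) + pairing \<nu> s)) :: complex"
    have norm_z: "norm ?z \<le> real p powr (\<tau> * \<kappa> \<nu> - pairing \<nu> c)"
      unfolding norm_of_nat_powr_complex using p1 Re_pairing_ge[OF s, of \<nu>] by (intro powr_mono) auto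
    \<comment> \<open>The common end of the last two cases: an exponent with
      \<open>\<tau> * (q * m)\<close> to spare absorbs the growth \<open>E\<close> and becomes
      summable over \<nu>.\<close>
    have finish: "norm (local_summand p s \<nu> - leading_summand p s \<nu>) \<le> (K1 + K2) * exp (- \<epsilon>\<^sub>1 * m) * real p powr (- (1 + \<eta> / 2))"
      if le: "norm (local_summand p s \<nu> - leading_summand p s \<nu>) \<le> (K1 + K2) * (E * real p powr e)"
        and e: "e \<le> - (1 + \<eta> / 2) - \<tau> * (q * m)" for e
    proof -
      have "E * real p powr e \<le> E * real p powr (- \<tau> * (q * m) + - (1 + \<eta> / 2))"
        using e E p1 by (intro mult_left_mono powr_mono) auto
      also have "\<dots> = (E * real p powr (- \<tau> * (q * m))) * real p powr (- (1 + \<eta> / 2))"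
        by (simp add: powr_add[symmetric])
      also have "\<dots> \<le> exp (- \<epsilon>\<^sub>1 * m) * real p powr (- (1 + \<eta> / 2))"
        using exp_growth_absorbed[OF p2, of \<nu>] by (intro mult_right_mono) (auto simp: E_def m_def)
      finally have "(K1 + K2) * (E * real p powr e) \<le> (K1 + K2) * (exp (- \<epsilon>\<^sub>1 * m) * real p powr (- (1 + \<eta> / 2)))"
        using K1 K2 by (intro mult_left_mono) auto
      then show ?thesis using le by (simp add: mult.assoc)
    qed
    have qm: "q * m \<le> \<kappa> \<nu>" unfolding m_def by (rule \<kappa>_ge_norm1)
    consider "\<nu> = 0" | "\<nu> \<noteq> 0" "\<kappa> \<nu> = 1" | "\<nu> \<noteq> 0" "\<kappa> \<nu> \<noteq> 1" by blast
    then have "norm (local_summand p s \<nu> - leading_summand p s \<nu>) \<le> (K1 + K2) * exp (- \<epsilon>\<^sub>1 * m) * real p powr (- (1 + \<eta> / 2))"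
    proof cases
      case 1
      have "prime_pow p (0 :: nat ^ 'n) = 1" by (simp add: prime_pow_def vec_eq_iff)
      then have "local_summand p s \<nu> = 1" using 1 p0 f_1 by (simp add: local_summand_def pairing_def powr_def)
      then show ?thesis using 1 K1 K2 by (simp add: leading_summand_def)
    next
      case 2
      have main_eq: "leading_summand p s \<nu> = of_real (real (g \<nu>) * real p powr (pairing \<nu> c - \<kappa> \<nu>)) * ?z"
      proof (cases "g \<nu> = 0")
        case True
        then show ?thesis using 2 by (simp add: leading_summand_def polar_set_def)
      next
        case False
        have "of_real (real p powr (pairing \<nu> c - \<kappa> \<nu>)) = (of_nat p powr of_real (pairing \<nu> c - \<kappa> \<nu>) :: complex)"
          using p0 by (simp add: powr_of_real[symmetric])
        then have "of_real (real p powr (pairing \<nu> c - \<kappa> \<nu>)) * ?z = of_nat p powr (of_real (pairing \<nu> c - \<kappa> \<nu>) + (- (of_real (pairing \<nu> c) + pairing \<nu> s)))"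
          by (simp only: powr_add)
        also have "of_real (pairing \<nu> c - \<kappa> \<nu>) + (- (of_real (pairing \<nu> c) + pairing \<nu> s)) = - 1 - pairing \<nu> s"
          using 2 by simp
        finally show ?thesis using False 2 by (simp add: leading_summand_def polar_set_def)
      qed
      have "local_summand p s \<nu> - leading_summand p s \<nu> = of_real (f (prime_pow p \<nu>) - real (g \<nu>) * real p powr (pairing \<nu> c - \<kappa> \<nu>)) * ?z"
        unfolding main_eq local_summand_def by (simp add: algebra_simps)
      then have "norm (local_summand p s \<nu> - leading_summand p s \<nu>) = \<bar>f (prime_pow p \<nu>) - real (g \<nu>) * real p powr (pairing \<nu> c - \<kappa> \<nu>)\<bar> * norm ?z"
        by (simp only: norm_mult norm_of_real)
      also have "\<dots> \<le> (K1 * (E * real p powr (pairing \<nu> c - \<kappa> \<nu> - \<delta>))) * real p powr (\<tau> * \<kappa> \<nu> - pairing \<nu> c)"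
        using K1(2)[OF p, of \<nu>] K1(1) E norm_z unfolding E_def by (intro mult_mono) auto
      also have "\<dots> = K1 * (E * real p powr ((pairing \<nu> c - \<kappa> \<nu> - \<delta>) + (\<tau> * \<kappa> \<nu> - pairing \<nu> c)))"
        by (simp only: powr_add mult.assoc)
      also have "\<dots> \<le> (K1 + K2) * (E * real p powr ((pairing \<nu> c - \<kappa> \<nu> - \<delta>) + (\<tau> * \<kappa> \<nu> - pairing \<nu> c)))"
        using K2 E by (intro mult_right_mono) auto
      finally show ?thesis
      proof (rule finish)
        have "\<tau> * (q * m) \<le> \<tau> * 1" using qm 2 \<tau> by (intro mult_left_mono) auto
        then show "(pairing \<nu> c - \<kappa> \<nu> - \<delta>) + (\<tau> * \<kappa> \<nu> - pairing \<nu> c) \<le> - (1 + \<eta> / 2) - \<tau> * (q * m)"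
          using 2 \<tau>(4) \<eta>(3) by simp
      qed
    next
      case 3
      have "\<bar>f (prime_pow p \<nu>)\<bar> \<le> real (g \<nu>) * real p powr (pairing \<nu> c - \<kappa> \<nu>)
          + K1 * (E * real p powr (pairing \<nu> c - \<kappa> \<nu> - \<delta>))"
      proof -
        have "0 \<le> real (g \<nu>) * real p powr (pairing \<nu> c - \<kappa> \<nu>)" by simp
        then show ?thesis using K1(2)[OF p, of \<nu>] unfolding E_def by linarith
      qed
      also have "\<dots> \<le> (K2 * E) * real p powr (pairing \<nu> c - \<kappa> \<nu>) + K1 * (E * real p powr (pairing \<nu> c - \<kappa> \<nu>))"
        using K2(2)[of \<nu>] K1(1) E p1 \<delta>_pos unfolding E_def
        by (intro add_mono mult_mono powr_mono) auto
      also have "\<dots> = (K1 + K2) * (E * real p powr (pairing \<nu> c - \<kappa> \<nu>))" by (simp add: algebra_simps)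
      finally have f_le: "\<bar>f (prime_pow p \<nu>)\<bar> \<le> (K1 + K2) * (E * real p powr (pairing \<nu> c - \<kappa> \<nu>))" .
      have "leading_summand p s \<nu> = 0" using 3 by (simp add: leading_summand_def polar_set_def)
      then have "norm (local_summand p s \<nu> - leading_summand p s \<nu>) = \<bar>f (prime_pow p \<nu>)\<bar> * norm ?z"
        by (simp add: local_summand_def norm_mult)
      also have "\<dots> \<le> ((K1 + K2) * (E * real p powr (pairing \<nu> c - \<kappa> \<nu>))) * real p powr (\<tau> * \<kappa> \<nu> - pairing \<nu> c)"
        using f_le norm_z K1 K2 E by (intro mult_mono) auto
      also have "\<dots> = (K1 + K2) * (E * real p powr ((pairing \<nu> c - \<kappa> \<nu>) + (\<tau> * \<kappa> \<nu> - pairing \<nu> c)))"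
        by (simp only: powr_add mult.assoc)
      finally show ?thesis
      proof (rule finish)
        have "\<tau> * (q * m) \<le> \<tau> * \<kappa> \<nu>" using qm \<tau> by (intro mult_left_mono) auto
        moreover have "(1 - 2 * \<tau>) * (1 + \<eta>) \<le> (1 - 2 * \<tau>) * \<kappa> \<nu>"
          using \<eta>(4)[OF 3] \<tau> by (intro mult_left_mono) auto
        then have "1 + \<eta> / 2 \<le> \<kappa> \<nu> - 2 * (\<tau> * \<kappa> \<nu>)"
          using \<tau>(3) by (simp add: algebra_simps)
        ultimately show "(pairing \<nu> c - \<kappa> \<nu>) + (\<tau> * \<kappa> \<nu> - pairing \<nu> c) \<le> - (1 + \<eta> / 2) - \<tau> * (q * m)"
          by linarith
      qed
    qed
    then show "norm (local_summand p s \<nu> - leading_summand p s \<nu>) \<le> (K1 + K2) * exp (- \<epsilon>\<^sub>1 * real (norm1 \<nu>)) * real p powr (- (1 + \<eta> / 2))"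
      by (simp add: m_def)
  qed (use K1 K2 in auto)
qed

lemma zeta_term_shift_prime_pow:
  "p > 0 \<Longrightarrow> zeta_term f (\<chi> i. of_real (c $ i) + s $ i) (prime_pow p \<nu>) = local_summand p s \<nu>"
  by (simp add: zeta_term_prime_pow local_summand_def pairing_def sum.distrib algebra_simps)

text \<open>Chosen so that the inverse of \<open>1 - pole_term p s \<nu>\<close> is the Euler factor
  at p of zeta(1 + <nu,s>).\<close>

definition pole_term :: "nat \<Rightarrow> complex ^ 'n \<Rightarrow> nat ^ 'n \<Rightarrow> complex" where
  "pole_term p s \<nu> = of_nat p powr (- 1 - pairing \<nu> s)"

text \<open>Stated for a general \<open>h\<close> to serve with the identity and with the
  norm.\<close>

lemma leading_summand_has_sum:
  fixes h :: "complex \<Rightarrow> 'b::{comm_monoid_add,topological_space}"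
  assumes h0: "h 0 = 0"
  shows "((\<lambda>\<nu>. h (leading_summand p s \<nu>)) has_sum (h 1 + (\<Sum>\<nu>\<in>I. h (of_nat (g \<nu>) * pole_term p s \<nu>)))) UNIV"
proof -
  have "((\<lambda>\<nu>. h (leading_summand p s \<nu>)) has_sum (\<Sum>\<nu>\<in>insert 0 I. h (leading_summand p s \<nu>))) (insert 0 I)"
    using finite_I by (intro has_sum_finite) auto
  also have "?this \<longleftrightarrow> ((\<lambda>\<nu>. h (leading_summand p s \<nu>)) has_sum (\<Sum>\<nu>\<in>insert 0 I. h (leading_summand p s \<nu>))) UNIV"
    by (rule has_sum_cong_neutral) (auto simp: leading_summand_def h0)
  also have "(\<Sum>\<nu>\<in>insert 0 I. h (leading_summand p s \<nu>)) = h (leading_summand p s 0) + (\<Sum>\<nu>\<in>I. h (leading_summand p s \<nu>))"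
    using finite_I I_nonzero by (intro sum.insert) auto
  also have "(\<Sum>\<nu>\<in>I. h (leading_summand p s \<nu>)) = (\<Sum>\<nu>\<in>I. h (of_nat (g \<nu>) * pole_term p s \<nu>))"
    using I_nonzero by (intro sum.cong) (auto simp: leading_summand_def pole_term_def)
  finally show ?thesis by (simp add: leading_summand_def)
qed

text \<open>The square root of the error size, so that the remainders are quadratic in
  \<open>X p\<close>. The pole terms, of size at most p^(\<tau>-1), are then linear in it, since 1 -
  \<tau> > 7/8 exceeds 1/2 + \<eta>/4; their products fall into the error too.\<close>

definition X :: "nat \<Rightarrow> real" where "X p = real p powr (- ((1 + \<eta> / 2) / 2))"

lemma X: "p > 0 \<Longrightarrow> 0 \<le> X p" "p > 0 \<Longrightarrow> X p \<le> 1" "(X p)\<^sup>2 = real p powr (- (1 + \<eta> / 2))"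
proof -
  show "p > 0 \<Longrightarrow> X p \<le> 1"
    using \<eta> powr_mono[of "- ((1 + \<eta> / 2) / 2)" 0 "real p"] by (simp add: X_def)
  show "(X p)\<^sup>2 = real p powr (- (1 + \<eta> / 2))"
    by (simp add: X_def power2_eq_square powr_add[symmetric])
qed (simp add: X_def)

lemma norm_pole_term_le:
  assumes "p > 0" "s \<in> R" "\<nu> \<in> I"
  shows "norm (pole_term p s \<nu>) \<le> X p"
proof -
  have "Re (pairing \<nu> s) \<ge> - \<tau>" using Re_pairing_ge[OF assms(2), of \<nu>] I_\<kappa>[OF assms(3)] by simp
  moreover have "(1 + \<eta> / 2) / 2 = 1 / 2 + \<eta> / 4" by simp
  ultimately have "- 1 - Re (pairing \<nu> s) \<le> - ((1 + \<eta> / 2) / 2)" using \<tau>(2) \<eta>(2) by linarith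
  then have "real p powr (- 1 - Re (pairing \<nu> s)) \<le> real p powr (- ((1 + \<eta> / 2) / 2))"
    using assms(1) by (intro powr_mono) auto
  then show ?thesis by (simp add: pole_term_def norm_of_nat_powr_complex X_def)
qed

definition W :: real where "W = (\<Sum>\<^sub>\<infinity>\<nu>\<in>UNIV. exp (- \<epsilon>\<^sub>1 * real (norm1 (\<nu> :: nat ^ 'n))))"

lemma W_nonneg: "W \<ge> 0" unfolding W_def by (intro infsum_nonneg) auto

definition local_factor :: "nat \<Rightarrow> complex ^ 'n \<Rightarrow> complex" where
  "local_factor p s = (\<Sum>\<^sub>\<infinity>\<nu>\<in>UNIV. local_summand p s \<nu>)"

text \<open>Summing \<open>local_remainder\<close> over \<nu> gives the factor \<open>W\<close>. One
  constant serves all primes and all of \<open>R\<close>; the second clause feeds the corrected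
  product, the first and the third the absolute convergence of the multiple series.\<close>

lemma local_sums:
  "\<exists>K\<ge>0. \<forall>p s. prime p \<longrightarrow> s \<in> R \<longrightarrow> (\<lambda>\<nu>. norm (local_summand p s \<nu>)) summable_on UNIV \<and>
    norm (local_factor p s - (1 + (\<Sum>\<nu>\<in>I. of_nat (g \<nu>) * pole_term p s \<nu>))) \<le> K * (X p)\<^sup>2 \<and>
    (\<Sum>\<^sub>\<infinity>\<nu>\<in>UNIV. norm (local_summand p s \<nu>)) \<le> 1 + (K * (X p)\<^sup>2 + (\<Sum>\<nu>\<in>I. real (g \<nu>) * norm (pole_term p s \<nu>)))"
proof -
  obtain K where K: "K \<ge> 0" "\<And>p s \<nu>. prime p \<Longrightarrow> s \<in> R \<Longrightarrow>
    norm (local_summand p s \<nu> - leading_summand p s \<nu>) \<le> K * exp (- \<epsilon>\<^sub>1 * real (norm1 \<nu>)) * real p powr (- (1 + \<eta> / 2))"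
    using local_remainder by blast
  have all: "(\<lambda>\<nu>. norm (local_summand p s \<nu>)) summable_on UNIV \<and>
      norm (local_factor p s - (1 + (\<Sum>\<nu>\<in>I. of_nat (g \<nu>) * pole_term p s \<nu>))) \<le> K * W * (X p)\<^sup>2 \<and>
      (\<Sum>\<^sub>\<infinity>\<nu>\<in>UNIV. norm (local_summand p s \<nu>)) \<le> 1 + (K * W * (X p)\<^sup>2 + (\<Sum>\<nu>\<in>I. real (g \<nu>) * norm (pole_term p s \<nu>)))"
    if p: "prime p" and s: "s \<in> R" for p s
  proof -
    have r_le: "norm (local_summand p s \<nu> - leading_summand p s \<nu>) \<le> K * (X p)\<^sup>2 * exp (- \<epsilon>\<^sub>1 * real (norm1 \<nu>))" for \<nu>
      using K(2)[OF p s, of \<nu>] by (simp add: X mult_ac)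
    have E: "((\<lambda>\<nu>. K * (X p)\<^sup>2 * exp (- \<epsilon>\<^sub>1 * real (norm1 (\<nu> :: nat ^ 'n)))) has_sum K * (X p)\<^sup>2 * W) UNIV"
      unfolding W_def by (intro has_sum_cmult_right has_sum_infsum summable_on_exp_norm1 \<epsilon>\<^sub>1_pos)
    have r_abs: "(\<lambda>\<nu>. norm (local_summand p s \<nu> - leading_summand p s \<nu>)) summable_on UNIV"
      by (rule summable_on_comparison_test[OF has_sum_imp_summable[OF E]]) (use r_le in auto)
    have r_sum: "(\<Sum>\<^sub>\<infinity>\<nu>\<in>UNIV. norm (local_summand p s \<nu> - leading_summand p s \<nu>)) \<le> K * (X p)\<^sup>2 * W"
      using infsum_mono[OF r_abs has_sum_imp_summable[OF E]] r_le infsumI[OF E] by simp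
    have m_sum: "(leading_summand p s has_sum (1 + (\<Sum>\<nu>\<in>I. of_nat (g \<nu>) * pole_term p s \<nu>))) UNIV"
      using leading_summand_has_sum[of "\<lambda>x. x" p s] by simp
    have m_abs: "((\<lambda>\<nu>. norm (leading_summand p s \<nu>)) has_sum (1 + (\<Sum>\<nu>\<in>I. real (g \<nu>) * norm (pole_term p s \<nu>)))) UNIV"
      using leading_summand_has_sum[of norm p s] by (simp add: norm_mult)
    have up: "(\<lambda>\<nu>. norm (local_summand p s \<nu> - leading_summand p s \<nu>) + norm (leading_summand p s \<nu>)) summable_on UNIV"
      by (intro summable_on_add r_abs has_sum_imp_summable[OF m_abs])
    have T_le: "norm (local_summand p s \<nu>) \<le> norm (local_summand p s \<nu> - leading_summand p s \<nu>) + norm (leading_summand p s \<nu>)" for \<nu>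
      using norm_triangle_ineq[of "local_summand p s \<nu> - leading_summand p s \<nu>" "leading_summand p s \<nu>"] by simp
    have T_abs: "(\<lambda>\<nu>. norm (local_summand p s \<nu>)) summable_on UNIV"
      by (rule summable_on_comparison_test[OF up]) (use T_le in auto)
    have "(\<Sum>\<^sub>\<infinity>\<nu>\<in>UNIV. norm (local_summand p s \<nu>)) \<le> (\<Sum>\<^sub>\<infinity>\<nu>\<in>UNIV. norm (local_summand p s \<nu> - leading_summand p s \<nu>) + norm (leading_summand p s \<nu>))"
      by (intro infsum_mono T_abs up T_le)
    also have "\<dots> = (\<Sum>\<^sub>\<infinity>\<nu>\<in>UNIV. norm (local_summand p s \<nu> - leading_summand p s \<nu>)) + (\<Sum>\<^sub>\<infinity>\<nu>\<in>UNIV. norm (leading_summand p s \<nu>))"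
      by (intro infsum_add r_abs has_sum_imp_summable[OF m_abs])
    also have "\<dots> \<le> K * (X p)\<^sup>2 * W + (1 + (\<Sum>\<nu>\<in>I. real (g \<nu>) * norm (pole_term p s \<nu>)))"
      using r_sum infsumI[OF m_abs] by simp
    finally have 1: "(\<Sum>\<^sub>\<infinity>\<nu>\<in>UNIV. norm (local_summand p s \<nu>)) \<le>
        1 + (K * W * (X p)\<^sup>2 + (\<Sum>\<nu>\<in>I. real (g \<nu>) * norm (pole_term p s \<nu>)))"
      by (simp add: mult_ac)
    have "local_factor p s - (1 + (\<Sum>\<nu>\<in>I. of_nat (g \<nu>) * pole_term p s \<nu>)) = (\<Sum>\<^sub>\<infinity>\<nu>\<in>UNIV. local_summand p s \<nu> - leading_summand p s \<nu>)"
      using infsum_add[OF abs_summable_summable[OF r_abs] has_sum_imp_summable[OF m_sum]] infsumI[OF m_sum]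
      by (simp add: local_factor_def)
    also have "norm \<dots> \<le> (\<Sum>\<^sub>\<infinity>\<nu>\<in>UNIV. norm (local_summand p s \<nu> - leading_summand p s \<nu>))"
      by (rule norm_infsum_bound[OF r_abs])
    finally show ?thesis using T_abs 1 r_sum by (simp add: mult_ac)
  qed
  show ?thesis
    by (intro exI[of _ "K * W"] conjI allI impI all[THEN conjunct1] all[THEN conjunct2, THEN conjunct1]
        all[THEN conjunct2, THEN conjunct2] mult_nonneg_nonneg K(1) W_nonneg)
qed

text \<open>A majorant free of \<open>s\<close>, as the Weierstrass test demands. The finite support
  of the leading summands is dominated by 1 + g \<nu>, the pole terms being at most 1 in
  norm.\<close>

lemma local_summand_uniform_bound:
  assumes p: "prime p"
  obtains M where "M summable_on UNIV" "\<And>\<nu> s. s \<in> R \<Longrightarrow> norm (local_summand p s \<nu>) \<le> M \<nu>"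
proof -
  obtain K where K: "K \<ge> 0" "\<And>p s \<nu>. prime p \<Longrightarrow> s \<in> R \<Longrightarrow>
    norm (local_summand p s \<nu> - leading_summand p s \<nu>) \<le> K * exp (- \<epsilon>\<^sub>1 * real (norm1 \<nu>)) * real p powr (- (1 + \<eta> / 2))"
    using local_remainder by blast
  define M where "M \<nu> = K * exp (- \<epsilon>\<^sub>1 * real (norm1 \<nu>)) * real p powr (- (1 + \<eta> / 2))
    + (if \<nu> \<in> insert 0 I then 1 + real (g \<nu>) else 0)" for \<nu> :: "nat ^ 'n"
  have p0: "p > 0" using prime_gt_0_nat[OF p] .
  have main_le: "norm (leading_summand p s \<nu>) \<le> (if \<nu> \<in> insert 0 I then 1 + real (g \<nu>) else 0)" if s: "s \<in> R" for s \<nu>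
  proof -
    have "norm (pole_term p s \<nu>) \<le> 1" if "\<nu> \<in> I"
      using norm_pole_term_le[OF p0 s that] X(2)[OF p0] by linarith
    then have "real (g \<nu>) * norm (pole_term p s \<nu>) \<le> 1 + real (g \<nu>)" if "\<nu> \<in> I"
      using that mult_left_mono[of "norm (pole_term p s \<nu>)" 1 "real (g \<nu>)"] by simp
    then show ?thesis by (auto simp: leading_summand_def norm_mult pole_term_def)
  qed
  have "(\<lambda>\<nu> :: nat ^ 'n. if \<nu> \<in> insert 0 I then 1 + real (g \<nu>) else 0) summable_on UNIV"
  proof -
    have "(\<lambda>\<nu>. 1 + real (g \<nu>)) summable_on insert 0 I" using finite_I by (intro summable_on_finite) auto
    also have "?this \<longleftrightarrow> (\<lambda>\<nu> :: nat ^ 'n. if \<nu> \<in> insert 0 I then 1 + real (g \<nu>) else 0) summable_on UNIV"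
      by (rule summable_on_cong_neutral) auto
    finally show ?thesis .
  qed
  then have "M summable_on UNIV"
    unfolding M_def by (intro summable_on_add summable_on_cmult_left summable_on_cmult_right summable_on_exp_norm1 \<epsilon>\<^sub>1_pos)
  moreover have "norm (local_summand p s \<nu>) \<le> M \<nu>" if "s \<in> R" for \<nu> s
    using K(2)[OF p that, of \<nu>] main_le[OF that, of \<nu>]
      norm_triangle_ineq[of "local_summand p s \<nu> - leading_summand p s \<nu>" "leading_summand p s \<nu>"] unfolding M_def by simp
  ultimately show ?thesis by (rule that)
qed

lemma holomorphic_local_factor:
  assumes p: "prime p"
  shows "holomorphic_multi_on (local_factor p) R"
proof (rule holomorphic_multi_on_uniform_limit[OF open_right_region])
  obtain M where M: "M summable_on UNIV" "\<And>\<nu> s. s \<in> R \<Longrightarrow> norm (local_summand p s \<nu>) \<le> M \<nu>"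
    using local_summand_uniform_bound[OF p] by blast
  have "uniform_limit R (\<lambda>A s. \<Sum>\<nu>\<in>A. local_summand p s \<nu>) (local_factor p) (finite_subsets_at_top UNIV)"
    unfolding local_factor_def using M by (intro Weierstrass_m_test_general) auto
  then have ul: "uniform_limit R (\<lambda>N s. \<Sum>\<nu> | norm1 \<nu> \<le> N. local_summand p s \<nu>) (local_factor p) sequentially"
    by (rule filterlim_compose[OF _ filterlim_norm1_le])
  show "\<exists>r>0. cball z r \<subseteq> R \<and> uniform_limit (cball z r) (\<lambda>N s. \<Sum>\<nu> | norm1 \<nu> \<le> N. local_summand p s \<nu>) (local_factor p) sequentially"
    if "z \<in> R" for z
  proof -
    obtain r where "r > 0" "cball z r \<subseteq> R" using open_right_region \<open>z \<in> R\<close> open_contains_cball by metis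
    then show ?thesis using uniform_limit_on_subset[OF ul] by blast
  qed
  show "holomorphic_multi_on (\<lambda>s. \<Sum>\<nu> | norm1 \<nu> \<le> N. local_summand p s \<nu>) R" for N
  proof (rule holomorphic_multi_on_sum)
    fix \<nu> :: "nat ^ 'n"
    have "(\<lambda>w. of_real (f (prime_pow p \<nu>)) * of_nat p powr (- w) :: complex) holomorphic_on UNIV"
      by (intro holomorphic_intros) (use prime_gt_0_nat[OF p] in auto)
    then show "holomorphic_multi_on (\<lambda>s. local_summand p s \<nu>) R"
      unfolding local_summand_def by (rule holomorphic_multi_on_compose_pairing) auto
  qed
qed

section \<open>The corrected Euler product\<close>

text \<open>The default 1 at non-primes makes products over an initial segment of the naturals
  products over primes.\<close>

definition corrected_factor :: "nat \<Rightarrow> complex ^ 'n \<Rightarrow> complex" where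
  "corrected_factor p s = (if prime p then (\<Prod>\<nu>\<in>I. (1 - pole_term p s \<nu>) ^ g \<nu>) * local_factor p s else 1)"

lemma holomorphic_corrected_factor: "holomorphic_multi_on (corrected_factor p) R"
proof (cases "prime p")
  case True
  have "holomorphic_multi_on (\<lambda>s. pole_term p s \<nu>) R" for \<nu>
  proof -
    have "(\<lambda>w. of_nat p powr (- w) :: complex) holomorphic_on UNIV"
      by (intro holomorphic_intros) (use prime_gt_0_nat[OF True] in auto)
    then have "holomorphic_multi_on (\<lambda>s. of_nat p powr (- (1 + pairing \<nu> s))) R"
      by (rule holomorphic_multi_on_compose_pairing) auto
    then show ?thesis by (simp add: pole_term_def)
  qed
  then show ?thesis using True unfolding corrected_factor_def
    by (auto intro!: holomorphic_multi_on_mult holomorphic_multi_on_prod holomorphic_multi_on_power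
        holomorphic_multi_on_diff holomorphic_multi_on_const holomorphic_local_factor)
qed (simp add: corrected_factor_def[abs_def] holomorphic_multi_on_const)

text \<open>The linear part of the correction is minus the sum of the terms g \<nu>
  \<open>pole_term\<close>, exactly opposite to that of the local factor. The product therefore
  expands with linear part 0, which leaves an error of order X^2.\<close>

lemma norm_corrected_factor_minus_1_le:
  obtains M where "M \<ge> 0" "\<And>p s. s \<in> R \<Longrightarrow> norm (corrected_factor p s - 1) \<le> M * real p powr (- (1 + \<eta> / 2))"
proof -
  obtain K where K1: "K \<ge> 0" and K2: "\<forall>p s. prime p \<longrightarrow> s \<in> R \<longrightarrow> (\<lambda>\<nu>. norm (local_summand p s \<nu>)) summable_on UNIV \<and>
      norm (local_factor p s - (1 + (\<Sum>\<nu>\<in>I. of_nat (g \<nu>) * pole_term p s \<nu>))) \<le> K * (X p)\<^sup>2 \<and>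
      (\<Sum>\<^sub>\<infinity>\<nu>\<in>UNIV. norm (local_summand p s \<nu>)) \<le> 1 + (K * (X p)\<^sup>2 + (\<Sum>\<nu>\<in>I. real (g \<nu>) * norm (pole_term p s \<nu>)))"
    using local_sums by auto
  have K: "norm (local_factor p s - (1 + (\<Sum>\<nu>\<in>I. of_nat (g \<nu>) * pole_term p s \<nu>))) \<le> K * (X p)\<^sup>2"
    if "prime p" "s \<in> R" for p s
    using K2[rule_format, OF that] by blast
  define K' where "K' = K + (\<Sum>\<nu>\<in>I. real (g \<nu>))"
  have K': "K' \<ge> 0" unfolding K'_def using K1 by (intro add_nonneg_nonneg sum_nonneg) auto
  have F_exp: "expands (X p) K' (local_factor p s) (\<Sum>\<nu>\<in>I. of_nat (g \<nu>) * pole_term p s \<nu>)"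
    if p: "prime p" and s: "s \<in> R" for p s
    unfolding expands_def
  proof
    have "norm (\<Sum>\<nu>\<in>I. of_nat (g \<nu>) * pole_term p s \<nu>) \<le> (\<Sum>\<nu>\<in>I. real (g \<nu>) * X p)"
      using prime_gt_0_nat[OF p] s
      by (intro order_trans[OF norm_sum] sum_mono) (auto simp: norm_mult intro!: mult_left_mono norm_pole_term_le)
    also have "\<dots> \<le> K' * X p"
      unfolding K'_def sum_distrib_right[symmetric] using K1 X(1)[OF prime_gt_0_nat[OF p]] by (intro mult_right_mono) auto
    finally show "norm (\<Sum>\<nu>\<in>I. of_nat (g \<nu>) * pole_term p s \<nu>) \<le> K' * X p" .
    have "norm (local_factor p s - 1 - (\<Sum>\<nu>\<in>I. of_nat (g \<nu>) * pole_term p s \<nu>)) \<le> K * (X p)\<^sup>2"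
      using K[OF p s] by (simp add: algebra_simps)
    also have "\<dots> \<le> K' * (X p)\<^sup>2" unfolding K'_def by (intro mult_right_mono) (auto intro: sum_nonneg)
    finally show "norm (local_factor p s - 1 - (\<Sum>\<nu>\<in>I. of_nat (g \<nu>) * pole_term p s \<nu>)) \<le> K' * (X p)\<^sup>2" .
  qed
  have "\<exists>L\<ge>0. \<forall>x A a. 0 \<le> x \<longrightarrow> x \<le> 1 \<longrightarrow> expands x 1 A a \<longrightarrow> expands x L (A ^ g \<nu>) (of_nat (g \<nu>) * a)" for \<nu>
    by (rule expands_power) simp
  then obtain L where L: "\<And>\<nu>. L \<nu> \<ge> 0"
    "\<And>\<nu> x A a. 0 \<le> x \<Longrightarrow> x \<le> 1 \<Longrightarrow> expands x 1 A a \<Longrightarrow> expands x (L \<nu>) (A ^ g \<nu>) (of_nat (g \<nu>) * a)"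
    by metis
  obtain M where M: "M \<ge> 0" "\<And>x A a. 0 \<le> x \<Longrightarrow> x \<le> 1 \<Longrightarrow> (\<forall>\<nu>\<in>I. expands x (L \<nu>) (A \<nu>) (a \<nu>)) \<Longrightarrow>
    expands x M (\<Prod>\<nu>\<in>I. A \<nu>) (\<Sum>\<nu>\<in>I. a \<nu>)"
    using expands_prod[OF finite_I, of L] L(1) by blast
  define N where "N = M * K' + M * (1 + 2 * K') + K' * (1 + M)"
  show ?thesis
  proof (rule that[of N])
    show N: "N \<ge> 0" unfolding N_def using M(1) K' by auto
    fix p s assume s: "s \<in> R"
    show "norm (corrected_factor p s - 1) \<le> N * real p powr (- (1 + \<eta> / 2))"
    proof (cases "prime p")
      case True
      have p0: "p > 0" using prime_gt_0_nat[OF True] .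
      have "expands (X p) 1 (1 - pole_term p s \<nu>) (- pole_term p s \<nu>)" if "\<nu> \<in> I" for \<nu>
        using norm_pole_term_le[OF p0 s that] by (simp add: expands_def)
      then have "\<forall>\<nu>\<in>I. expands (X p) (L \<nu>) ((1 - pole_term p s \<nu>) ^ g \<nu>) (of_nat (g \<nu>) * - pole_term p s \<nu>)"
        using X(1,2)[OF p0] by (intro ballI L) auto
      then have "expands (X p) M (\<Prod>\<nu>\<in>I. (1 - pole_term p s \<nu>) ^ g \<nu>) (\<Sum>\<nu>\<in>I. of_nat (g \<nu>) * - pole_term p s \<nu>)"
        using X(1,2)[OF p0] by (intro M) auto
      from expands_mult[OF X(1,2)[OF p0] this F_exp[OF True s] M(1) K']
      have "expands (X p) N (corrected_factor p s) 0"
        using True by (simp add: corrected_factor_def N_def sum_negf)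
      then show ?thesis by (simp add: expands_def X(3))
    qed (use N in \<open>simp add: corrected_factor_def\<close>)
  qed
qed

lemma summable_powr_eta: "summable (\<lambda>p. M * real p powr (- (1 + \<eta> / 2)))"
  using \<eta>(1) by (intro summable_mult) (simp add: summable_real_powr_iff)

definition corrected_product :: "complex ^ 'n \<Rightarrow> complex" where
  "corrected_product s = lim (\<lambda>N. \<Prod>p<N. corrected_factor p s)"

text \<open>Closed balls are compact, and on a compact set uniform convergence of the sums of
  |factor - 1|, with continuous factors, passes to the products.\<close>

lemma uniform_limit_corrected_product:
  assumes "cball z r \<subseteq> R"
  shows "uniform_limit (cball z r) (\<lambda>N s. \<Prod>p<N. corrected_factor p s) corrected_product sequentially"
proof -
  obtain M where M: "M \<ge> 0" "\<And>p s. s \<in> R \<Longrightarrow> norm (corrected_factor p s - 1) \<le> M * real p powr (- (1 + \<eta> / 2))"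
    using norm_corrected_factor_minus_1_le by blast
  have "uniform_limit (cball z r) (\<lambda>N s. \<Sum>p<N. norm (corrected_factor p s - 1)) (\<lambda>s. \<Sum>p. norm (corrected_factor p s - 1)) sequentially"
    by (rule Weierstrass_m_test[OF _ summable_powr_eta[of M]]) (use M assms in auto)
  then have "uniformly_convergent_on (cball z r) (\<lambda>N s. \<Sum>p<N. norm (corrected_factor p s - 1))"
    by (rule uniformly_convergentI)
  then have "uniformly_convergent_on (cball z r) (\<lambda>N s. \<Prod>p<N. corrected_factor p s)"
    using holomorphic_multi_on_imp_continuous_on[OF holomorphic_corrected_factor] assms
    by (intro uniformly_convergent_on_prod') (auto intro: continuous_on_subset)
  then show ?thesis
    unfolding corrected_product_def by (simp add: uniformly_convergent_uniform_limit_iff)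
qed

lemma corrected_product_tendsto: "s \<in> R \<Longrightarrow> (\<lambda>N. \<Prod>p<N. corrected_factor p s) \<longlonglongrightarrow> corrected_product s"
proof -
  assume s: "s \<in> R"
  then obtain r where "r > 0" "cball s r \<subseteq> R" using open_right_region open_contains_cball by metis
  then show ?thesis using tendsto_uniform_limitI[OF uniform_limit_corrected_product[of s r], of s] by simp
qed

lemma holomorphic_corrected_product: "holomorphic_multi_on corrected_product R"
proof (rule holomorphic_multi_on_uniform_limit[OF open_right_region])
  show "holomorphic_multi_on (\<lambda>s. \<Prod>p<N. corrected_factor p s) R" for N
    by (intro holomorphic_multi_on_prod holomorphic_corrected_factor)
  show "\<exists>r>0. cball z r \<subseteq> R \<and> uniform_limit (cball z r) (\<lambda>N s. \<Prod>p<N. corrected_factor p s) corrected_product sequentially"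
    if "z \<in> R" for z
  proof -
    obtain r where "r > 0" "cball z r \<subseteq> R" using open_right_region \<open>z \<in> R\<close> open_contains_cball by metis
    then show ?thesis using uniform_limit_corrected_product by blast
  qed
qed

lemma norm_corrected_product_le: obtains B where "B > 0" "\<And>s. s \<in> R \<Longrightarrow> norm (corrected_product s) \<le> B"
proof -
  obtain M where M: "M \<ge> 0" "\<And>p s. s \<in> R \<Longrightarrow> norm (corrected_factor p s - 1) \<le> M * real p powr (- (1 + \<eta> / 2))"
    using norm_corrected_factor_minus_1_le by blast
  let ?b = "\<lambda>p. M * real p powr (- (1 + \<eta> / 2))"
  show ?thesis
  proof (rule that[of "exp (suminf ?b)"])
    fix s assume s: "s \<in> R"
    have "norm (\<Prod>p<N. corrected_factor p s) \<le> exp (suminf ?b)" for N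
    proof -
      have "norm (\<Prod>p<N. corrected_factor p s) = (\<Prod>p<N. norm (corrected_factor p s))" by (simp add: prod_norm)
      also have "\<dots> \<le> (\<Prod>p<N. exp (?b p))"
      proof (intro prod_mono conjI)
        fix p
        have "norm (corrected_factor p s) \<le> 1 + ?b p"
          using M(2)[OF s, of p] norm_triangle_ineq[of 1 "corrected_factor p s - 1"] by simp
        also have "\<dots> \<le> exp (?b p)" by (rule exp_ge_add_one_self)
        finally show "norm (corrected_factor p s) \<le> exp (?b p)" .
      qed simp
      also have "\<dots> = exp (\<Sum>p<N. ?b p)" by (simp add: exp_sum)
      also have "\<dots> \<le> exp (suminf ?b)"
        using sum_le_suminf[OF summable_powr_eta[of M], of "{..<N}"] M(1) by simp
      finally show ?thesis .
    qed
    then show "norm (corrected_product s) \<le> exp (suminf ?b)"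
      using Lim_bounded[OF tendsto_norm[OF corrected_product_tendsto[OF s]], of 0] by simp
  qed simp
qed

section \<open>The continuation and its growth\<close>

definition continuation :: "complex ^ 'n \<Rightarrow> complex" where
  "continuation s = (\<Prod>\<nu>\<in>I. reg_zeta (1 + pairing \<nu> s) ^ g \<nu>) * corrected_product s"

lemma Re_pairing_I: "s \<in> R \<Longrightarrow> \<nu> \<in> I \<Longrightarrow> Re (pairing \<nu> s) > - 1/8"
  using Re_pairing_ge[of s \<nu>] I_\<kappa>[of \<nu>] \<tau>(2) by simp

lemma right_region_0_subset: "right_region 0 \<subseteq> R"
proof
  fix s :: "complex ^ 'n" assume "s \<in> right_region 0"
  then have "Re (s $ i) > - \<epsilon>\<^sub>0" for i
    using \<epsilon>\<^sub>0_pos by (auto simp: right_region_def intro: less_trans[of _ 0])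
  then show "s \<in> R" by (simp add: right_region_def)
qed

lemma Re_pairing_pos:
  assumes s: "s \<in> right_region 0" and \<nu>: "\<nu> \<in> I"
  shows "Re (pairing \<nu> s) > 0"
proof -
  obtain i where i: "\<nu> $ i \<noteq> 0" using I_nonzero[OF \<nu>] by (auto simp: vec_eq_iff)
  have "0 < real (\<nu> $ i) * Re (s $ i)" using i s by (simp add: right_region_def)
  also have "\<dots> \<le> (\<Sum>i\<in>UNIV. real (\<nu> $ i) * Re (s $ i))"
    using s by (intro member_le_sum) (auto simp: right_region_def less_imp_le)
  finally show ?thesis by (simp add: Re_pairing)
qed

text \<open>For positive real parts the pole terms themselves are summable over p, having exponent -
  1 - Re <nu,s> below -1, so the uncorrected local factors already satisfy the hypotheses of
  \<open>euler_product_multi\<close>.\<close>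

lemma multi_zeta_euler:
  assumes s: "s \<in> right_region 0"
  shows "(\<lambda>m. norm (zeta_term f (\<chi> i. of_real (c $ i) + s $ i) m)) summable_on pos_tuples" (is ?A)
    and "(\<lambda>N. \<Prod>p | p < N \<and> prime p. local_factor p s) \<longlonglongrightarrow> multi_zeta f (\<chi> i. of_real (c $ i) + s $ i)" (is ?B)
proof -
  let ?h = "zeta_term f (\<chi> i. of_real (c $ i) + s $ i)"
  have sR: "s \<in> R" using s right_region_0_subset by blast
  obtain K where K0: "K \<ge> 0" and K: "\<forall>p s. prime p \<longrightarrow> s \<in> R \<longrightarrow> (\<lambda>\<nu>. norm (local_summand p s \<nu>)) summable_on UNIV \<and>
      norm (local_factor p s - (1 + (\<Sum>\<nu>\<in>I. of_nat (g \<nu>) * pole_term p s \<nu>))) \<le> K * (X p)\<^sup>2 \<and>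
      (\<Sum>\<^sub>\<infinity>\<nu>\<in>UNIV. norm (local_summand p s \<nu>)) \<le> 1 + (K * (X p)\<^sup>2 + (\<Sum>\<nu>\<in>I. real (g \<nu>) * norm (pole_term p s \<nu>)))"
    using local_sums by auto
  have T_eq: "(\<lambda>\<nu>. ?h (prime_pow p \<nu>)) = local_summand p s" if "prime p" for p
    using zeta_term_shift_prime_pow[OF prime_gt_0_nat[OF that], of s] by auto
  let ?b = "\<lambda>p. K * (X p)\<^sup>2 + (\<Sum>\<nu>\<in>I. real (g \<nu>) * norm (pole_term p s \<nu>))"
  have h1: "?h 1 = 1" by (simp add: zeta_term_def f_1)
  have 1: "(\<lambda>\<nu>. norm (?h (prime_pow p \<nu>))) summable_on UNIV" if p: "prime p" for p
    using K[rule_format, OF p sR] T_eq[OF p] by (simp add: fun_eq_iff)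
  have 2: "summable ?b"
  proof (intro summable_add summable_sum summable_mult)
    show "summable (\<lambda>p. (X p)\<^sup>2)" using summable_powr_eta[of 1] by (simp add: X(3))
    show "summable (\<lambda>p. norm (pole_term p s \<nu>))" if "\<nu> \<in> I" for \<nu>
      using Re_pairing_pos[OF s that]
      by (simp add: pole_term_def norm_of_nat_powr_complex summable_real_powr_iff)
  qed
  have 3: "?b p \<ge> 0" for p using K0 by (intro add_nonneg_nonneg sum_nonneg) auto
  have 4: "(\<Sum>\<^sub>\<infinity>\<nu>\<in>UNIV. norm (?h (prime_pow p \<nu>))) \<le> 1 + ?b p" if p: "prime p" for p
    using K[rule_format, OF p sR] T_eq[OF p] by (simp add: fun_eq_iff)
  note E = euler_product_multi[OF multiplicative_zeta_term[OF f_mult] h1 1 2 3 4]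
  show ?A by (rule E(1))
  have "(\<Prod>p | p < N \<and> prime p. \<Sum>\<^sub>\<infinity>\<nu>\<in>UNIV. ?h (prime_pow p \<nu>)) = (\<Prod>p | p < N \<and> prime p. local_factor p s)" for N
    by (intro prod.cong refl) (simp add: T_eq local_factor_def)
  then show ?B using E(2) by (simp add: multi_zeta_def)
qed

text \<open>Both sides are limits of the same finite expressions: over the primes below N the Euler
  factors of zeta cancel the correction, and what remains is the product of the linear forms with
  the uncorrected local factors.\<close>

lemma continuation_eq_regularized_zeta:
  assumes s: "s \<in> right_region 0"
  shows "continuation s = regularized_zeta g \<kappa> f c s"
proof -
  have sR: "s \<in> R" using s right_region_0_subset by blast
  let ?w = "\<lambda>\<nu>. pairing \<nu> s"
  let ?P = "\<lambda>N. {p. p < N \<and> prime p}"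
  have zeta: "(\<lambda>N. ?w \<nu> * (\<Prod>p\<in>?P N. inverse (1 - pole_term p s \<nu>))) \<longlonglongrightarrow> reg_zeta (1 + ?w \<nu>)"
    if "\<nu> \<in> I" for \<nu>
    using reg_zeta_euler_product[of "1 + ?w \<nu>"] Re_pairing_pos[OF s that] by (simp add: pole_term_def)
  have lim1: "(\<lambda>N. (\<Prod>\<nu>\<in>I. (?w \<nu> * (\<Prod>p\<in>?P N. inverse (1 - pole_term p s \<nu>))) ^ g \<nu>) * (\<Prod>p<N. corrected_factor p s)) \<longlonglongrightarrow> continuation s"
    unfolding continuation_def by (intro tendsto_mult tendsto_prod tendsto_power zeta corrected_product_tendsto sR)
  \<comment> \<open>The norm of the pole term is strictly below 1 here, so the inverses are
    genuine.\<close>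
  have nz: "1 - pole_term p s \<nu> \<noteq> 0" if p: "prime p" and \<nu>: "\<nu> \<in> I" for p \<nu>
  proof -
    have "norm (pole_term p s \<nu>) < real p powr 0"
      unfolding pole_term_def norm_of_nat_powr_complex
      using Re_pairing_pos[OF s \<nu>] prime_gt_1_nat[OF p] by (intro powr_less_mono) auto
    then have "norm (pole_term p s \<nu>) \<noteq> 1" using prime_gt_0_nat[OF p] by simp
    then show ?thesis by auto
  qed
  have "(\<Prod>\<nu>\<in>I. (?w \<nu> * (\<Prod>p\<in>?P N. inverse (1 - pole_term p s \<nu>))) ^ g \<nu>) * (\<Prod>p<N. corrected_factor p s)
      = (\<Prod>\<nu>\<in>I. ?w \<nu> ^ g \<nu>) * (\<Prod>p\<in>?P N. local_factor p s)" for N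
  proof -
    have "(\<Prod>p<N. corrected_factor p s) = (\<Prod>p\<in>?P N. corrected_factor p s)"
      by (rule prod.mono_neutral_right) (auto simp: corrected_factor_def)
    also have "\<dots> = (\<Prod>p\<in>?P N. \<Prod>\<nu>\<in>I. (1 - pole_term p s \<nu>) ^ g \<nu>) * (\<Prod>p\<in>?P N. local_factor p s)"
      unfolding prod.distrib[symmetric] by (intro prod.cong) (auto simp: corrected_factor_def)
    also have "(\<Prod>p\<in>?P N. \<Prod>\<nu>\<in>I. (1 - pole_term p s \<nu>) ^ g \<nu>) = (\<Prod>\<nu>\<in>I. (\<Prod>p\<in>?P N. 1 - pole_term p s \<nu>) ^ g \<nu>)"
      by (subst prod.swap) (simp add: prod_power_distrib)
    finally have G_eq: "(\<Prod>p<N. corrected_factor p s) = (\<Prod>\<nu>\<in>I. (\<Prod>p\<in>?P N. 1 - pole_term p s \<nu>) ^ g \<nu>) * (\<Prod>p\<in>?P N. local_factor p s)" .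
    have cancel: "(?w \<nu> * (\<Prod>p\<in>?P N. inverse (1 - pole_term p s \<nu>))) ^ g \<nu> * (\<Prod>p\<in>?P N. 1 - pole_term p s \<nu>) ^ g \<nu> = ?w \<nu> ^ g \<nu>"
      if "\<nu> \<in> I" for \<nu>
    proof -
      have "(\<Prod>p\<in>?P N. inverse (1 - pole_term p s \<nu>)) * (\<Prod>p\<in>?P N. 1 - pole_term p s \<nu>) = 1"
        unfolding prod.distrib[symmetric] using nz[OF _ that] by (intro prod.neutral) auto
      then show ?thesis by (simp add: power_mult_distrib[symmetric] mult.assoc)
    qed
    show ?thesis unfolding G_eq mult.assoc[symmetric] prod.distrib[symmetric]
      using cancel by simp
  qed
  then have "(\<lambda>N. (\<Prod>\<nu>\<in>I. ?w \<nu> ^ g \<nu>) * (\<Prod>p\<in>?P N. local_factor p s)) \<longlonglongrightarrow> continuation s"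
    using lim1 by simp
  moreover have "(\<lambda>N. (\<Prod>\<nu>\<in>I. ?w \<nu> ^ g \<nu>) * (\<Prod>p\<in>?P N. local_factor p s)) \<longlonglongrightarrow>
      (\<Prod>\<nu>\<in>I. ?w \<nu> ^ g \<nu>) * multi_zeta f (\<chi> i. of_real (c $ i) + s $ i)"
    by (intro tendsto_mult tendsto_const multi_zeta_euler s)
  ultimately show ?thesis unfolding regularized_zeta_def by (rule LIMSEQ_unique)
qed

lemma holomorphic_continuation: "holomorphic_multi_on continuation R"
proof -
  have "holomorphic_multi_on (\<lambda>s. reg_zeta (1 + pairing \<nu> s)) R" if "\<nu> \<in> I" for \<nu>
  proof (rule holomorphic_multi_on_compose_pairing[OF holomorphic_reg_zeta])
    show "open {s. 7 / 8 < Re s}" by (rule open_halfspace_Re_gt)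
    show "1 + pairing \<nu> s \<in> {s. 7 / 8 < Re s}" if "s \<in> R" for s
      using Re_pairing_I[OF that \<open>\<nu> \<in> I\<close>] by simp
  qed
  then show ?thesis
    unfolding continuation_def[abs_def]
    by (intro holomorphic_multi_on_mult holomorphic_multi_on_prod holomorphic_multi_on_power holomorphic_corrected_product) auto
qed

lemma norm_continuation_le:
  assumes "\<epsilon> > 0"
  shows "\<exists>K>0. \<forall>s\<in>R. norm (continuation s) \<le> K * (\<Prod>\<nu>\<in>I. (norm (pairing \<nu> s) + 1) powr
             (real (g \<nu>) * (1 - 1 / 2 * min 0 (Re (pairing \<nu> s))) + \<epsilon>))"
proof -
  have "\<exists>K>0. \<forall>w. Re w \<ge> - 1/8 \<longrightarrow> norm (reg_zeta (1 + w) ^ g \<nu>) \<le>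
      K * (norm w + 1) powr (real (g \<nu>) * (1 - 1 / 2 * min 0 (Re w)) + \<epsilon>)" if \<nu>: "\<nu> \<in> I" for \<nu>
  proof -
    have g0: "real (g \<nu>) > 0" using I_g[OF \<nu>] by simp
    \<comment> \<open>Raising to the power \<open>g \<nu>\<close> multiplies the exponent, so
      \<open>\<epsilon> / g \<nu>\<close> is spent here; on \<open>I\<close> the value
      \<open>g \<nu>\<close> is positive.\<close>
    obtain K where K: "K > 0" "\<And>w. Re w \<ge> - 1/8 \<Longrightarrow>
        norm (reg_zeta (1 + w)) \<le> K * (norm w + 1) powr (1 - 1 / 2 * min 0 (Re w) + \<epsilon> / real (g \<nu>))"
      using reg_zeta_convexity_bound[of "\<epsilon> / real (g \<nu>)"] assms g0 by (metis divide_pos_pos)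
    show ?thesis
    proof (intro exI[of _ "K ^ g \<nu>"] conjI allI impI)
      fix w :: complex assume w: "Re w \<ge> - 1/8"
      define e where "e = 1 - 1 / 2 * min 0 (Re w) + \<epsilon> / real (g \<nu>)"
      have b: "norm w + 1 > 0" using norm_ge_zero[of w] by linarith
      have "norm (reg_zeta (1 + w) ^ g \<nu>) \<le> (K * (norm w + 1) powr e) ^ g \<nu>"
        unfolding norm_power e_def by (intro power_mono K(2)[OF w]) auto
      also have "\<dots> = K ^ g \<nu> * (norm w + 1) powr (real (g \<nu>) * e)"
        using b by (simp add: power_mult_distrib powr_power mult.commute)
      also have "real (g \<nu>) * e = real (g \<nu>) * (1 - 1 / 2 * min 0 (Re w)) + \<epsilon>"
        using g0 by (simp add: e_def distrib_left)
      finally show "norm (reg_zeta (1 + w) ^ g \<nu>) \<le>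
          K ^ g \<nu> * (norm w + 1) powr (real (g \<nu>) * (1 - 1 / 2 * min 0 (Re w)) + \<epsilon>)" .
    qed (use K in simp)
  qed
  then obtain K where K: "\<And>\<nu>. \<nu> \<in> I \<Longrightarrow> K \<nu> > 0" "\<And>\<nu> w. \<nu> \<in> I \<Longrightarrow> Re w \<ge> - 1/8 \<Longrightarrow>
      norm (reg_zeta (1 + w) ^ g \<nu>) \<le> K \<nu> * (norm w + 1) powr (real (g \<nu>) * (1 - 1 / 2 * min 0 (Re w)) + \<epsilon>)"
    by metis
  obtain B where B: "B > 0" "\<And>s. s \<in> R \<Longrightarrow> norm (corrected_product s) \<le> B" using norm_corrected_product_le by blast
  show ?thesis
  proof (intro exI[of _ "(\<Prod>\<nu>\<in>I. K \<nu>) * B"] conjI ballI)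
    show "(\<Prod>\<nu>\<in>I. K \<nu>) * B > 0" using K(1) B(1) by (intro mult_pos_pos prod_pos) auto
    fix s assume s: "s \<in> R"
    let ?e = "\<lambda>\<nu>. (norm (pairing \<nu> s) + 1) powr (real (g \<nu>) * (1 - 1 / 2 * min 0 (Re (pairing \<nu> s))) + \<epsilon>)"
    have "norm (continuation s) = (\<Prod>\<nu>\<in>I. norm (reg_zeta (1 + pairing \<nu> s) ^ g \<nu>)) * norm (corrected_product s)"
      by (simp add: continuation_def norm_mult prod_norm)
    also have "\<dots> \<le> (\<Prod>\<nu>\<in>I. K \<nu> * ?e \<nu>) * B"
    proof (intro mult_mono prod_mono conjI)
      show "norm (reg_zeta (1 + pairing \<nu> s) ^ g \<nu>) \<le> K \<nu> * ?e \<nu>" if "\<nu> \<in> I" for \<nu>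
        using Re_pairing_I[OF s that] by (intro K(2) that) simp
      show "0 \<le> (\<Prod>\<nu>\<in>I. K \<nu> * ?e \<nu>)"
        using K(1) by (intro prod_nonneg mult_nonneg_nonneg) (auto simp: less_imp_le)
    qed (use B(2)[OF s] in auto)
    also have "\<dots> = (\<Prod>\<nu>\<in>I. K \<nu>) * B * (\<Prod>\<nu>\<in>I. ?e \<nu>)" by (simp add: prod.distrib mult_ac)
    finally show "norm (continuation s) \<le> (\<Prod>\<nu>\<in>I. K \<nu>) * B * (\<Prod>\<nu>\<in>I. ?e \<nu>)" .
  qed
qed

section \<open>The value at the origin\<close>

lemma zero_in_R: "0 \<in> R"
  using \<epsilon>\<^sub>0_pos by (simp add: right_region_def)

lemma local_summand_0: "prime p \<Longrightarrow> local_summand p 0 \<nu> = of_real (local_term f c p \<nu>)"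
proof -
  assume "prime p"
  then have "of_nat p powr (- of_real (pairing \<nu> c)) = (complex_of_real (real p powr (- pairing \<nu> c)))"
    using powr_of_real[of "real p" "- pairing \<nu> c"] by simp
  then show ?thesis by (simp add: local_summand_def local_term_def pairing_def powr_minus field_simps)
qed

lemma local_term_summable: "prime p \<Longrightarrow> local_term f c p summable_on UNIV"
proof -
  assume p: "prime p"
  have "(\<lambda>\<nu>. norm (local_summand p 0 \<nu>)) summable_on UNIV"
    using local_sums p zero_in_R by blast
  then have "(\<lambda>\<nu>. norm (local_term f c p \<nu>)) summable_on UNIV" by (simp add: local_summand_0[OF p])
  then show ?thesis by (rule abs_summable_summable)
qed

lemma corrected_factor_0: "corrected_factor p 0 = (if prime p then of_real (euler_factor g \<kappa> f c p) else 1)"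
proof (cases "prime p")
  case True
  have "(\<Prod>\<nu>\<in>I. (1 - pole_term p 0 \<nu>) ^ g \<nu>) = (1 - 1 / of_nat p) ^ (\<Sum>\<nu>\<in>I. g \<nu>)"
    using prime_gt_0_nat[OF True]
    by (simp add: pole_term_def pairing_def powr_minus_divide power_sum)
  moreover have "local_factor p 0 = of_real (\<Sum>\<^sub>\<infinity>\<nu>\<in>UNIV. local_term f c p \<nu>)"
    unfolding local_factor_def local_summand_0[OF True] using has_sum_of_real[OF has_sum_infsum[OF local_term_summable[OF True]]]
    by (rule infsumI)
  ultimately show ?thesis using True by (simp add: corrected_factor_def euler_factor_def)
qed (simp add: corrected_factor_def)

text \<open>A convergent product in the sense of \<open>has_prod\<close> is more than a limit of
  partial products, so absolute convergence is established before the value is identified with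
  \<open>corrected_product 0\<close>. The zeta factors contribute
  \<open>reg_zeta 1 = 1\<close>.\<close>

lemma continuation_0_has_prod: "(\<lambda>p. if prime p then complex_of_real (euler_factor g \<kappa> f c p) else 1) has_prod continuation 0"
proof -
  obtain M where M: "M \<ge> 0" "\<And>p s. s \<in> R \<Longrightarrow> norm (corrected_factor p s - 1) \<le> M * real p powr (- (1 + \<eta> / 2))"
    using norm_corrected_factor_minus_1_le by blast
  have "summable (\<lambda>p. norm (corrected_factor p 0 - 1))"
    by (rule summable_comparison_test'[OF summable_powr_eta[of M], of 0]) (use M(2)[OF zero_in_R] in auto)
  then have conv: "convergent_prod (\<lambda>p. corrected_factor p 0)"
    by (intro abs_convergent_prod_imp_convergent_prod) (simp add: abs_convergent_prod_conv_summable)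
  have "(\<lambda>n. \<Prod>p\<le>n. corrected_factor p 0) \<longlonglongrightarrow> corrected_product 0"
    using LIMSEQ_Suc[OF corrected_product_tendsto[OF zero_in_R]] by (simp add: lessThan_Suc_atMost)
  then have "prodinf (\<lambda>p. corrected_factor p 0) = corrected_product 0"
    using convergent_prod_LIMSEQ[OF conv] LIMSEQ_unique by blast
  moreover have "continuation 0 = corrected_product 0" by (simp add: continuation_def pairing_def reg_zeta_1)
  ultimately have "(\<lambda>p. corrected_factor p 0) has_prod continuation 0"
    using convergent_prod_has_prod[OF conv] by simp
  then show ?thesis by (simp add: corrected_factor_0)
qed

end

theorem theorem1:
  fixes g :: "nat ^ 'n \<Rightarrow> nat" and \<kappa> :: "nat ^ 'n \<Rightarrow> real"
    and c :: "real ^ 'n" and \<delta> :: real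
    and f :: "nat ^ 'n \<Rightarrow> real"
  assumes "is_data g \<kappa> c \<delta>"
    and "f \<in> mult_class g \<kappa> c \<delta>"
    and "polar_set g \<kappa> \<noteq> {}"
  shows "(\<forall>s \<in> right_region c. (\<lambda>m. norm (zeta_term f s m)) summable_on pos_tuples) \<and>
    (\<exists>\<epsilon>\<^sub>0>0. \<exists>H.
       holomorphic_multi_on H (right_region (\<chi> i. - \<epsilon>\<^sub>0)) \<and>
       (\<forall>s \<in> right_region 0. H s = regularized_zeta g \<kappa> f c s) \<and>
       (\<forall>\<epsilon>>0. \<exists>K>0. \<forall>s \<in> right_region (\<chi> i. - \<epsilon>\<^sub>0).
          norm (H s) \<le> K * (\<Prod>\<nu>\<in>polar_set g \<kappa>. (norm (pairing \<nu> s) + 1) powr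
             (real (g \<nu>) * (1 - 1 / 2 * min 0 (Re (pairing \<nu> s))) + \<epsilon>))) \<and>
       (\<forall>p. prime p \<longrightarrow> local_term f c p summable_on UNIV) \<and>
       (\<lambda>p. if prime p then complex_of_real (euler_factor g \<kappa> f c p) else 1) has_prod H 0)"
proof -
  interpret multi_zeta_class g \<kappa> c \<delta> f by unfold_locales (fact assms)+
  have "(\<lambda>m. norm (zeta_term f s m)) summable_on pos_tuples" if s: "s \<in> right_region c" for s
  proof -
    have "(\<chi> i. s $ i - of_real (c $ i)) \<in> right_region 0" using s by (simp add: right_region_def)
    from multi_zeta_euler(1)[OF this] show ?thesis by simp
  qed
  then show ?thesis
    using \<epsilon>\<^sub>0_pos holomorphic_continuation continuation_eq_regularized_zeta norm_continuation_le local_term_summable continuation_0_has_prod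
    by (intro conjI ballI exI[of _ \<epsilon>\<^sub>0] exI[of _ continuation]) simp_all
qed

end
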